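(* Let $H_o$ be a self-adjoint operator on a Hilbert space $\mathcal H$ with only pure point spectrum, and let $\Lambda(s)$, $s\in[0,1]$, be a family of bounded self-adjoint operators which is $L^1$ in norm, $\int_0^1\|\Lambda(s)\|\,\mathrm ds<\infty$. For $\tau>0$ let $U_\tau(t)$, $t\in[0,\tau]$, solve $\mathrm i\,\dot U_\tau(t)=(H_o+\tfrac1\tau\Lambda(t/\tau))U_\tau(t)$, $U_\tau(0)=\mathbf 1$. For each eigenvalue $E$ of $H_o$ let $P_E=\chi(H_o=E)$ be the orthogonal projection onto the eigenspace of $H_o$ with eigenvalue $E$, and let $\Omega_\infty(s)$, $s\in[0,1]$, be the unitary operator commuting with $H_o$ that solves $$\mathrm i\,\dot\Omega_\infty(s)=\Big(\sum_{E\in\sigma(H_o)}P_E\Lambda(s)P_E\Big)\Omega_\infty(s),\qquad \Omega_\infty(0)=\mathbf 1.$$ Then for each $s\in[0,1]$, $$\lim_{\tau\to\infty}\mathrm e^{\mathrm i\tau sH_o}U_\tau(\tau s)=\Omega_\infty(s)$$ in the strong operator topology.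
   Context: The sum over $E\in\sigma(H_o)$ is effectively over eigenvalues of $H_o$ (for non-eigenvalues $P_E=0$), and converges in the strong operator topology. Convergence in the strong operator topology means $A_\tau\psi\to A\psi$ for every $\psi\in\mathcal H$. *)

theory Defs
  imports "HOL-Analysis.Analysis"
begin

class complex_inner = real_normed_vector +
  fixes scaleC :: "complex \<Rightarrow> 'a \<Rightarrow> 'a"
    and cinner :: "'a \<Rightarrow> 'a \<Rightarrow> complex"
  assumes scaleC_add_right: "scaleC a (x + y) = scaleC a x + scaleC a y"
    and scaleC_add_left: "scaleC (a + b) x = scaleC a x + scaleC b x"
    and scaleC_scaleC: "scaleC a (scaleC b x) = scaleC (a * b) x"
    and scaleC_one: "scaleC 1 x = x"
    and scaleR_scaleC: "scaleR r x = scaleC (complex_of_real r) x"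
    and cinner_commute: "cinner x y = cnj (cinner y x)"
    and cinner_add_right: "cinner x (y + z) = cinner x y + cinner x z"
    and cinner_scaleC_right: "cinner x (scaleC a y) = a * cinner x y"
    and cinner_norm: "cinner x x = complex_of_real ((norm x)\<^sup>2)"

class chilbert = complex_inner + complete_space

definition csubspace :: "'a::complex_inner set \<Rightarrow> bool" where
  "csubspace S \<longleftrightarrow> 0 \<in> S \<and> (\<forall>x\<in>S. \<forall>y\<in>S. x + y \<in> S) \<and> (\<forall>c. \<forall>x\<in>S. scaleC c x \<in> S)"

definition cspan :: "'a::complex_inner set \<Rightarrow> 'a set" where
  "cspan S = {x. \<exists>F c. finite F \<and> F \<subseteq> S \<and> x = (\<Sum>v\<in>F. scaleC (c v) v)}"

definition clinear_on :: "'a::complex_inner set \<Rightarrow> ('a \<Rightarrow> 'a) \<Rightarrow> bool" where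
  "clinear_on D A \<longleftrightarrow> (\<forall>x\<in>D. \<forall>y\<in>D. A (x + y) = A x + A y) \<and> (\<forall>c. \<forall>x\<in>D. A (scaleC c x) = scaleC c (A x))"

definition bounded_op :: "('a::complex_inner \<Rightarrow> 'a) \<Rightarrow> bool" where
  "bounded_op A \<longleftrightarrow> clinear_on UNIV A \<and> (\<exists>K. \<forall>x. norm (A x) \<le> K * norm x)"

definition bounded_selfadjoint :: "('a::complex_inner \<Rightarrow> 'a) \<Rightarrow> bool" where
  "bounded_selfadjoint A \<longleftrightarrow> bounded_op A \<and> (\<forall>x y. cinner (A x) y = cinner x (A y))"

definition unitary :: "('a::complex_inner \<Rightarrow> 'a) \<Rightarrow> bool" where
  "unitary U \<longleftrightarrow> bounded_op U \<and> (\<forall>x y. cinner (U x) (U y) = cinner x y) \<and> surj U"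

text \<open>An (unbounded) operator is given by its domain D and its action H on D.
  It is self-adjoint iff it is densely defined, linear, and equal to its adjoint:
  y is in the domain of the adjoint with adjoint value z (i.e. (Hx, y) = (x, z) for all x in D)
  iff y is in D and z = H y.\<close>
definition selfadjoint :: "'a::complex_inner set \<Rightarrow> ('a \<Rightarrow> 'a) \<Rightarrow> bool" where
  "selfadjoint D H \<longleftrightarrow> csubspace D \<and> closure D = UNIV \<and> clinear_on D H \<and>
     (\<forall>y z. (\<forall>x\<in>D. cinner (H x) y = cinner x z) \<longleftrightarrow> (y \<in> D \<and> z = H y))"

definition eigenspace :: "'a::complex_inner set \<Rightarrow> ('a \<Rightarrow> 'a) \<Rightarrow> complex \<Rightarrow> 'a set" where
  "eigenspace D H E = {v\<in>D. H v = scaleC E v}"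

definition eigenvalues :: "'a::complex_inner set \<Rightarrow> ('a \<Rightarrow> 'a) \<Rightarrow> complex set" where
  "eigenvalues D H = {E. \<exists>v\<in>D. v \<noteq> 0 \<and> H v = scaleC E v}"

definition pure_point :: "'a::complex_inner set \<Rightarrow> ('a \<Rightarrow> 'a) \<Rightarrow> bool" where
  "pure_point D H \<longleftrightarrow> closure (cspan (\<Union>E\<in>eigenvalues D H. eigenspace D H E)) = UNIV"

definition orthproj :: "'a::complex_inner set \<Rightarrow> 'a \<Rightarrow> 'a" where
  "orthproj M x = (THE y. y \<in> M \<and> (\<forall>z\<in>M. cinner z (x - y) = 0))"

definition spec_proj :: "'a::complex_inner set \<Rightarrow> ('a \<Rightarrow> 'a) \<Rightarrow> complex \<Rightarrow> 'a \<Rightarrow> 'a" where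
  "spec_proj D H E = orthproj (eigenspace D H E)"

definition commutes_with :: "'a::complex_inner set \<Rightarrow> ('a \<Rightarrow> 'a) \<Rightarrow> ('a \<Rightarrow> 'a) \<Rightarrow> bool" where
  "commutes_with D H B \<longleftrightarrow> (\<forall>x\<in>D. B x \<in> D \<and> H (B x) = B (H x))"

text \<open>W t = exp(i t H): the strongly continuous one-parameter unitary group whose
  generator (in the sense of Stone's theorem) is i H with domain exactly D.\<close>
definition exp_itH :: "'a::complex_inner set \<Rightarrow> ('a \<Rightarrow> 'a) \<Rightarrow> (real \<Rightarrow> 'a \<Rightarrow> 'a) \<Rightarrow> bool" where
  "exp_itH D H W \<longleftrightarrow> (\<forall>t. unitary (W t)) \<and> W 0 = id \<and> (\<forall>s t. W (s + t) = W s \<circ> W t) \<and>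
     (\<forall>\<psi>. continuous_on UNIV (\<lambda>t. W t \<psi>)) \<and>
     (\<forall>\<psi>. \<psi> \<in> D \<longleftrightarrow> (\<exists>\<phi>. ((\<lambda>t. W t \<psi>) has_vector_derivative \<phi>) (at 0))) \<and>
     (\<forall>\<psi>\<in>D. ((\<lambda>t. W t \<psi>) has_vector_derivative scaleC \<i> (H \<psi>)) (at 0))"

text \<open>U solves i U'(t) = (H + B(t)) U(t), U(0) = 1 on [0,T], where W t = exp(i t H),
  in the (standard, mild / Duhamel) sense: t \<mapsto> U t \<psi> is continuous on [0,T] and
  U t \<psi> = exp(-itH) \<psi> - i \<integral>_0^t exp(-i(t-r)H) B(r) U(r) \<psi> dr.
  With W = (\<lambda>_. id) this is the equation i U' = B U, U(0) = 1.\<close>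
definition solves_schroedinger ::
  "(real \<Rightarrow> 'a::complex_inner \<Rightarrow> 'a) \<Rightarrow> (real \<Rightarrow> 'a \<Rightarrow> 'a) \<Rightarrow> real \<Rightarrow> (real \<Rightarrow> 'a \<Rightarrow> 'a) \<Rightarrow> bool" where
  "solves_schroedinger W B T U \<longleftrightarrow>
     (\<forall>\<psi>. continuous_on {0..T} (\<lambda>t. U t \<psi>)) \<and>
     (\<forall>t\<in>{0..T}. \<forall>\<psi>. \<exists>I. ((\<lambda>r. W (r - t) (B r (U r \<psi>))) has_integral I) {0..t} \<and>
         U t \<psi> = W (- t) \<psi> - scaleC \<i> I)"

text \<open>The block-diagonal part  sum_{E in sigma(H)} P_E A P_E  (strongly convergent sum;
  only eigenvalues contribute since P_E = 0 otherwise).\<close>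
definition diag_part :: "'a::complex_inner set \<Rightarrow> ('a \<Rightarrow> 'a) \<Rightarrow> ('a \<Rightarrow> 'a) \<Rightarrow> 'a \<Rightarrow> 'a" where
  "diag_part D H A \<psi> = (\<Sum>\<^sub>\<infinity>E\<in>eigenvalues D H. spec_proj D H E (A (spec_proj D H E \<psi>)))"

end

theory Submission
  imports Defs
begin

text \<open>
  In the interaction picture \<open>x(s) = e\<^bsup>i\<tau>sH\<^esup> U\<^sub>\<tau>(\<tau>s) \<psi>\<close> solves \<open>i x' = K\<^sub>\<tau> x\<close> with
  \<open>K\<^sub>\<tau>(r) = e\<^bsup>i\<tau>rH\<^esup> \<Lambda>(r) e\<^bsup>-i\<tau>rH\<^esup>\<close>. By density and a Gronwall bound it suffices to treat an eigenvector \<open>\<psi>\<close>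
  with eigenvalue \<open>E\<close>. Then \<open>y(r) = \<Omega>\<^sub>\<infinity>(r) \<psi>\<close> stays in the eigenspace, the diagonal part of \<open>\<Lambda>\<close> acts on it as
  \<open>P\<^sub>E K\<^sub>\<tau>\<close>, and \<open>x - y\<close> solves the equation of \<open>x\<close> up to the error \<open>(1 - P\<^sub>E) \<integral> K\<^sub>\<tau> y\<close>,
  an oscillatory integral without a resonant component, which vanishes by a Riemann-Lebesgue argument.

  No measurability of \<open>\<Lambda>\<close> is assumed beyond the existence of the solutions, and on a nonseparable space a
  vector valued gauge integral does not entail strong measurability. Two devices replace it.
  Integrability of \<open>K\<^sub>\<tau> y\<close> for continuous \<open>y\<close> follows because the solutions take a dense set of values at
  every time. For the Riemann-Lebesgue step, an integrand \<open>f\<close> with \<open>norm f \<le> g\<close> is compared with \<open>g\<close> times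
  its averages \<open>v = \<integral> f / \<integral> g\<close> over a partition that nearly maximises \<open>\<Sum> (norm (\<integral> f))\<^sup>2 / \<integral> g\<close>:
  by Pythagoras, the indefinite integral of \<open>f - g v\<close> then has small variation.
\<close>

section \<open>Complex inner product spaces\<close>

text \<open>Norm convergence is reached through inner products with test vectors
  \<open>\<eta>\<close>, uniformly over the unit ball. Moving the phase and the unitary group onto
  \<open>\<eta>\<close> gives a continuous curve of norm at most 1, but in general there is no
  modulus of continuity common to all frequencies and all \<open>\<eta>\<close>. The averages must
  therefore come from one coarse partition, with an error that is small on every uniform refinement
  of it; only the refinement may depend on the frequency and the test vector. This is why a supremum
  over partitions is used.

  An average of an integrand orthogonal to the eigenspace is again orthogonal to it, and is close to
  a finite combination of eigenvectors with other eigenvalues. These eigenvalues may accumulate at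
  \<open>E\<close>, but a finite combination involves only finitely many frequencies, all nonzero,
  and the scalar lemma handles each of them.

  Solutions are given for \<open>\<tau> > 0\<close> only, so the integrand that is averaged is the
  one at \<open>\<tau> = 1\<close>, and a frequency \<open>\<sigma>\<close> stands for
  \<open>\<tau> = \<sigma> + 1\<close>.\<close>

instance chilbert \<subseteq> banach ..

lemma scaleC_zero_right [simp]: "scaleC a (0::'a::complex_inner) = 0"
  using scaleC_add_right[of a 0 0] by simp

lemma scaleC_zero_left [simp]: "scaleC 0 (x::'a::complex_inner) = 0"
  using scaleC_add_left[of 0 0 x] by simp

lemma scaleC_minus_right: "scaleC a (- x) = - scaleC a (x::'a::complex_inner)"
  using scaleC_add_right[of a x "-x"] by (simp add: eq_neg_iff_add_eq_0 add.commute)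

lemma scaleC_minus_left: "scaleC (- a) x = - scaleC a (x::'a::complex_inner)"
  using scaleC_add_left[of a "-a" x] by (simp add: eq_neg_iff_add_eq_0 add.commute)

lemma scaleC_diff_right: "scaleC a (x - y) = scaleC a x - scaleC a (y::'a::complex_inner)"
  using scaleC_add_right[of a x "-y"] by (simp add: scaleC_minus_right)

lemma cinner_add_left: "cinner (x + y) (z::'a::complex_inner) = cinner x z + cinner y z"
  by (metis cinner_add_right cinner_commute complex_cnj_add)

lemma cinner_scaleC_left: "cinner (scaleC a x) (y::'a::complex_inner) = cnj a * cinner x y"
  by (metis cinner_scaleC_right cinner_commute complex_cnj_mult)

lemma cinner_scaleR_right: "cinner x (r *\<^sub>R y) = r *\<^sub>R cinner x (y::'a::complex_inner)"
  by (simp add: scaleR_scaleC cinner_scaleC_right scaleR_conv_of_real)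

lemma cinner_scaleR_left: "cinner (r *\<^sub>R x) y = r *\<^sub>R cinner x (y::'a::complex_inner)"
  by (simp add: scaleR_scaleC cinner_scaleC_left scaleR_conv_of_real)

lemma cinner_zero_right [simp]: "cinner x (0::'a::complex_inner) = 0"
  using cinner_add_right[of x 0 0] by simp

lemma cinner_zero_left [simp]: "cinner (0::'a::complex_inner) x = 0"
  using cinner_add_left[of 0 0 x] by simp

lemma cinner_minus_right: "cinner x (- y) = - cinner x (y::'a::complex_inner)"
  using cinner_add_right[of x y "-y"] by (simp add: eq_neg_iff_add_eq_0 add.commute)

lemma cinner_minus_left: "cinner (- x) y = - cinner x (y::'a::complex_inner)"
  using cinner_add_left[of x "-x" y] by (simp add: eq_neg_iff_add_eq_0 add.commute)

lemma cinner_diff_right: "cinner x (y - z) = cinner x y - cinner x (z::'a::complex_inner)"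
  using cinner_add_right[of x y "-z"] by (simp add: cinner_minus_right)

lemma cinner_diff_left: "cinner (x - y) z = cinner x z - cinner y (z::'a::complex_inner)"
  using cinner_add_left[of x "-y" z] by (simp add: cinner_minus_left)

lemma norm_diff_square:
  "(norm (x - y))\<^sup>2 = (norm x)\<^sup>2 + (norm y)\<^sup>2 - 2 * Re (cinner y (x::'a::complex_inner))"
proof -
  have "complex_of_real ((norm (x - y))\<^sup>2)
      = complex_of_real ((norm x)\<^sup>2) + complex_of_real ((norm y)\<^sup>2) - (cinner y x + cinner x y)"
    unfolding cinner_norm[symmetric] by (simp add: cinner_diff_left cinner_diff_right)
  also have "cinner y x + cinner x y = complex_of_real (2 * Re (cinner y x))"
    by (subst (2) cinner_commute) (simp add: complex_add_cnj)
  finally show ?thesis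
    by (metis of_real_add of_real_diff of_real_eq_iff)
qed

lemma norm_scaleC: "norm (scaleC a x) = cmod a * norm (x::'a::complex_inner)"
proof -
  have "cinner (scaleC a x) (scaleC a x) = (a * cnj a) * cinner x x"
    by (simp add: cinner_scaleC_left cinner_scaleC_right)
  then have "complex_of_real ((norm (scaleC a x))\<^sup>2) = complex_of_real ((cmod a * norm x)\<^sup>2)"
    by (simp only: cinner_norm complex_norm_square[symmetric] power_mult_distrib of_real_mult)
  then show ?thesis
    unfolding of_real_eq_iff by simp
qed

lemma norm_cinner_le: "cmod (cinner x y) \<le> norm x * norm (y::'a::complex_inner)"
proof (cases "x = 0")
  case False
  \<comment> \<open>\<open>scaleC c x\<close> is the orthogonal projection of \<open>y\<close> onto
    the line through \<open>x\<close>; that the remainder has nonnegative square norm is the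
    Cauchy-Schwarz inequality.\<close>
  define c where "c = cinner x y / (norm x)\<^sup>2"
  have nx: "(norm x)\<^sup>2 > 0" using False by simp
  have "0 \<le> (norm (y - scaleC c x))\<^sup>2" by simp
  also have "\<dots> = (norm y)\<^sup>2 + (cmod c * norm x)\<^sup>2 - 2 * Re (cnj c * cinner x y)"
    by (simp add: norm_diff_square norm_scaleC cinner_scaleC_left)
  also have "cnj c * cinner x y = complex_of_real ((cmod (cinner x y))\<^sup>2 / (norm x)\<^sup>2)"
    unfolding c_def of_real_divide complex_norm_square by (simp add: mult.commute)
  also have "(cmod c * norm x)\<^sup>2 = (cmod (cinner x y))\<^sup>2 / (norm x)\<^sup>2"
    using False by (simp add: c_def norm_divide norm_power power2_eq_square norm_mult)
  finally have "(cmod (cinner x y))\<^sup>2 / (norm x)\<^sup>2 \<le> (norm y)\<^sup>2" by simp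
  then have "(cmod (cinner x y))\<^sup>2 \<le> (norm x * norm y)\<^sup>2"
    using nx by (simp add: divide_simps power_mult_distrib mult.commute)
  then show ?thesis by (rule power2_le_imp_le) simp
qed simp

lemma bounded_bilinear_cinner: "bounded_bilinear (cinner :: 'a::complex_inner \<Rightarrow> _)"
  by unfold_locales
    (auto simp: cinner_add_left cinner_add_right cinner_scaleR_left cinner_scaleR_right
      intro!: exI[of _ 1] norm_cinner_le)

lemma bounded_bilinear_scaleC: "bounded_bilinear (scaleC :: complex \<Rightarrow> 'a::complex_inner \<Rightarrow> 'a)"
  by unfold_locales
    (auto simp: scaleC_add_left scaleC_add_right scaleR_scaleC scaleC_scaleC mult.commute
      norm_scaleC scaleR_conv_of_real intro!: exI[of _ 1])

lemmas bounded_linear_cinner_right = bounded_bilinear.bounded_linear_right[OF bounded_bilinear_cinner]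
lemmas bounded_linear_scaleC_right = bounded_bilinear.bounded_linear_right[OF bounded_bilinear_scaleC]
lemmas continuous_on_cinner = bounded_bilinear.continuous_on[OF bounded_bilinear_cinner]
lemmas continuous_on_scaleC = bounded_bilinear.continuous_on[OF bounded_bilinear_scaleC]

text \<open>A nonzero \<open>x\<close> is tested against its own normalisation. This converts scalar
  estimates that are uniform over the unit ball into norm estimates.\<close>

lemma norm_le_cinner_bound:
  assumes "\<And>y. norm y \<le> 1 \<Longrightarrow> cmod (cinner y (x::'a::complex_inner)) \<le> c"
  shows "norm x \<le> c"
proof (cases "x = 0")
  case True then show ?thesis using assms[of 0] by simp
next
  case False
  have "cmod (cinner ((1 / norm x) *\<^sub>R x) x) \<le> c"
    by (rule assms) (use False in simp)
  then show ?thesis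
    using False by (simp add: cinner_scaleR_left cinner_norm norm_mult power2_eq_square)
qed

text \<open>With this instance the scalar Riemann-Lebesgue lemma is a case of the vector-valued transfer principle.\<close>

instantiation complex :: chilbert
begin

definition scaleC_complex :: "complex \<Rightarrow> complex \<Rightarrow> complex" where "scaleC_complex = (*)"
definition cinner_complex :: "complex \<Rightarrow> complex \<Rightarrow> complex" where "cinner_complex x y = cnj x * y"

instance
proof
  show "cinner x x = complex_of_real ((norm x)\<^sup>2)" for x :: complex
    unfolding cinner_complex_def complex_norm_square by (rule mult.commute)
qed (simp_all add: scaleC_complex_def cinner_complex_def distrib_left distrib_right
    scaleR_conv_of_real mult.assoc mult.left_commute)

end

section \<open>Integrals over partitions of an interval\<close>

lemma sum_blocks: "(\<Sum>i<m*N. h i) = (\<Sum>j<m. \<Sum>k<N. h (j * N + k :: nat))"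
proof -
  have "(\<Sum>k<N. h (j * N + k)) = sum h {j * N..<j * N + N}" for j
    using sum.shift_bounds_nat_ivl[of h 0 "j*N" N] by (simp add: add.commute lessThan_atLeast0)
  then show ?thesis by (simp add: sum.nat_group[symmetric])
qed

lemma integral_sum_partition:
  fixes f :: "real \<Rightarrow> 'b::banach"
  assumes "\<And>i. i < n \<Longrightarrow> t i \<le> t (Suc i)" "f integrable_on {t 0..t n}"
  shows "integral {t 0..t n} f = (\<Sum>i<n. integral {t i..t (Suc i)} f)"
  using assms
proof (induction n)
  case (Suc n)
  have "t 0 \<le> t n" using Suc.prems(1) by (induction n) (auto intro: order_trans)
  moreover have "t n \<le> t (Suc n)" using Suc.prems by simp
  moreover have "f integrable_on {t 0..t n}"
    by (rule integrable_on_subinterval[OF Suc.prems(2)]) (use calculation in auto)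
  ultimately show ?case
    using Suc Henstock_Kurzweil_Integration.integral_combine[of "t 0" "t n" "t (Suc n)" f] by simp
qed simp

text \<open>A nonnegative integrable \<open>g\<close> is absolutely integrable, so its product with
  a bounded measurable function is integrable; the coordinates of \<open>h\<close> are treated one
  at a time, which is where the finite-dimensional codomain enters.\<close>

lemma integrable_scaleR_continuous:
  fixes h :: "real \<Rightarrow> 'b::euclidean_space"
  assumes "g integrable_on {a..b}" "\<And>r. r \<in> {a..b} \<Longrightarrow> 0 \<le> g r" "continuous_on {a..b} h"
  shows "(\<lambda>r. g r *\<^sub>R h r) integrable_on {a..b}"
proof -
  have "(\<lambda>r. (h r \<bullet> c) * g r) absolutely_integrable_on {a..b}" for c
  proof (rule absolutely_integrable_bounded_measurable_product_real)
    show "(\<lambda>r. h r \<bullet> c) \<in> borel_measurable (lebesgue_on {a..b})"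
      by (intro continuous_imp_measurable_on_sets_lebesgue continuous_intros assms) auto
    show "bounded ((\<lambda>r. h r \<bullet> c) ` {a..b})"
      by (intro compact_imp_bounded compact_continuous_image continuous_intros assms) auto
    show "g absolutely_integrable_on {a..b}"
      using assms by (intro nonnegative_absolutely_integrable_1) auto
  qed auto
  then show ?thesis
    by (subst integrable_componentwise_iff)
      (auto simp: mult.commute dest: set_lebesgue_integral_eq_integral(1))
qed

section \<open>Approximation of dominated integrands by local averages\<close>

text \<open>The identity "variance equals second moment minus squared mean" for the vectors
  \<open>F k / G k\<close> with weights \<open>G k\<close>, whose weighted mean is \<open>v\<close>.
  Splitting a block thus raises the quotient sum by exactly the weighted square deviation from the
  mean.\<close>

lemma sum_block_deviation:
  fixes F :: "nat \<Rightarrow> 'a::complex_inner" and G :: "nat \<Rightarrow> real"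
  assumes G: "\<And>k. k < N \<Longrightarrow> 0 < G k" and N: "0 < N"
  defines "v \<equiv> (1 / sum G {..<N}) *\<^sub>R sum F {..<N}"
  shows "(\<Sum>k<N. (norm (F k - G k *\<^sub>R v))\<^sup>2 / G k)
       = (\<Sum>k<N. (norm (F k))\<^sup>2 / G k) - (norm (sum F {..<N}))\<^sup>2 / sum G {..<N}"
proof -
  have S: "0 < sum G {..<N}" using assms by (intro sum_pos) auto
  have "(norm (F k - G k *\<^sub>R v))\<^sup>2 / G k
      = (norm (F k))\<^sup>2 / G k + (norm v)\<^sup>2 * G k - 2 * Re (cinner v (F k))" if "k < N" for k
    using G[OF that] unfolding norm_diff_square
    by (simp add: cinner_scaleR_left power2_eq_square field_simps)
  then have "(\<Sum>k<N. (norm (F k - G k *\<^sub>R v))\<^sup>2 / G k)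
      = (\<Sum>k<N. (norm (F k))\<^sup>2 / G k) + (norm v)\<^sup>2 * sum G {..<N} - 2 * Re (\<Sum>k<N. cinner v (F k))"
    by (simp add: sum.distrib sum_subtractf sum_distrib_left)
  also have "(\<Sum>k<N. cinner v (F k)) = cinner v (sum F {..<N})"
    by (simp add: bounded_bilinear.sum_right[OF bounded_bilinear_cinner])
  finally show ?thesis
    using S by (simp add: v_def cinner_scaleR_left cinner_norm power_mult_distrib power2_eq_square)
qed

text \<open>Uniform meshes are nested under multiplication of the size: interval \<open>j\<close> of
  the mesh of size \<open>m\<close> is the union of the intervals \<open>j * N + k\<close>,
  \<open>k < N\<close>, of the mesh of size \<open>m * N\<close>.\<close>

definition mesh_point :: "real \<Rightarrow> real \<Rightarrow> nat \<Rightarrow> nat \<Rightarrow> real" where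
  "mesh_point a b m i = a + (b - a) * real i / real m"

lemma mesh_point_ends: "mesh_point a b m 0 = a" "0 < m \<Longrightarrow> mesh_point a b m m = b"
  by (simp_all add: mesh_point_def)

lemma mesh_point_width: "mesh_point a b m (Suc i) - mesh_point a b m i = (b - a) / real m"
  by (simp add: mesh_point_def add_divide_distrib distrib_left)

lemma mesh_point_mono: "a < b \<Longrightarrow> i \<le> k \<Longrightarrow> mesh_point a b m i \<le> mesh_point a b m k"
  by (simp add: mesh_point_def divide_right_mono)

lemma mesh_point_in:
  assumes "a < b" "i \<le> m" "0 < m"
  shows "mesh_point a b m i \<in> {a..b}"
  using mesh_point_mono[OF assms(1), of 0 i m] mesh_point_mono[OF assms(1,2), of m] assms
  by (simp add: mesh_point_ends)

lemma mesh_interval_subset: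
  assumes "a < b" "i < m"
  shows "{mesh_point a b m i..mesh_point a b m (Suc i)} \<subseteq> {a..b}"
  using mesh_point_in[of a b i m] mesh_point_in[of a b "Suc i" m] assms by auto

lemma mesh_point_refine:
  assumes "0 < N"
  shows "mesh_point a b (m * N) (j * N) = mesh_point a b m j"
    and "mesh_point a b (m * N) (j * N + N) = mesh_point a b m (Suc j)"
  \<comment> \<open>For \<open>m = 0\<close> both sides equal \<open>a\<close>, because division by
    zero yields zero.\<close>
  using assms by (cases "m = 0"; simp add: mesh_point_def field_simps)+

lemma integral_sum_mesh:
  fixes h :: "real \<Rightarrow> 'b::banach"
  assumes "a < b" "0 < m" "h integrable_on {a..b}"
  shows "integral {a..b} h = (\<Sum>i<m. integral {mesh_point a b m i..mesh_point a b m (Suc i)} h)"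
  using integral_sum_partition[of m "mesh_point a b m" h] assms
  by (simp add: mesh_point_ends mesh_point_mono)

lemma integral_sum_mesh_block:
  fixes h :: "real \<Rightarrow> 'b::banach"
  assumes "a < b" "0 < N" "h integrable_on {mesh_point a b m j..mesh_point a b m (Suc j)}"
  shows "integral {mesh_point a b m j..mesh_point a b m (Suc j)} h
      = (\<Sum>k<N. integral {mesh_point a b (m*N) (j*N+k)..mesh_point a b (m*N) (Suc (j*N+k))} h)"
  using integral_sum_partition[of N "\<lambda>k. mesh_point a b (m*N) (j*N+k)" h] assms
  by (simp add: mesh_point_refine mesh_point_mono)

lemma block_index_less:
  assumes "j < m" "k < N"
  shows "j * N + k < m * (N::nat)"
proof -
  have "j * N + k < Suc j * N" using assms by simp
  also have "\<dots> \<le> m * N" using assms by (intro mult_le_mono1) simp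
  finally show ?thesis .
qed

text \<open>The bound \<open>1 \<le> g\<close> keeps every increment of the integral of
  \<open>g\<close> strictly positive, so that it can serve as a denominator on each mesh
  interval.\<close>

lemma mesh_increments:
  fixes f :: "real \<Rightarrow> 'a::banach" and g :: "real \<Rightarrow> real"
  assumes ab: "a < b" and f: "f integrable_on {a..b}" and g: "g integrable_on {a..b}"
    and fg: "\<And>r. r \<in> {a..b} \<Longrightarrow> norm (f r) \<le> g r" and g1: "\<And>r. r \<in> {a..b} \<Longrightarrow> 1 \<le> g r"
    and i: "i < m"
  defines "J \<equiv> {mesh_point a b m i..mesh_point a b m (Suc i)}"
  shows "f integrable_on J" "g integrable_on J" "norm (integral J f) \<le> integral J g" "0 < integral J g"
proof -
  have sub: "J \<subseteq> {a..b}" unfolding J_def by (rule mesh_interval_subset[OF ab i])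
  show fi: "f integrable_on J" and gi: "g integrable_on J"
    using sub unfolding J_def by (auto intro: integrable_on_subinterval[OF f] integrable_on_subinterval[OF g])
  show "norm (integral J f) \<le> integral J g"
    by (rule integral_norm_bound_integral[OF fi gi]) (use sub fg in auto)
  have "0 < (b - a) / real m" using ab i by simp
  then have "0 < integral J (\<lambda>_. 1::real)" using mesh_point_width[of a b m i] by (simp add: J_def)
  also have "\<dots> \<le> integral J g"
    by (rule integral_le[OF _ gi]) (use sub g1 in \<open>auto simp: J_def\<close>)
  finally show "0 < integral J g" .
qed

text \<open>The quotient sum \<open>S\<close> can only grow under refinement and never exceeds the
  integral of \<open>g\<close>. Once \<open>S m\<close> is close to the supremum, no refinement can
  gain much, whatever \<open>N\<close> is. The order of the quantifiers matters: \<open>m\<close> is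
  fixed before \<open>N\<close>.\<close>

lemma average_approximation:
  fixes f :: "real \<Rightarrow> 'a::chilbert" and g :: "real \<Rightarrow> real"
  assumes ab: "a < b" and f: "f integrable_on {a..b}" and g: "g integrable_on {a..b}"
    and fg: "\<And>r. r \<in> {a..b} \<Longrightarrow> norm (f r) \<le> g r" and g1: "\<And>r. r \<in> {a..b} \<Longrightarrow> 1 \<le> g r"
    and eps: "0 < \<epsilon>"
  defines "t \<equiv> mesh_point a b"
  defines "dF \<equiv> \<lambda>m i. integral {t m i..t m (Suc i)} f"
    and "dG \<equiv> \<lambda>m i. integral {t m i..t m (Suc i)} g"
  shows "\<exists>m>0. \<forall>N>0. (\<Sum>j<m. \<Sum>k<N. norm (dF (m*N) (j*N+k)
            - dG (m*N) (j*N+k) *\<^sub>R ((1 / dG m j) *\<^sub>R dF m j))) \<le> \<epsilon>"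
proof -
  have dFG: "norm (dF m i) \<le> dG m i" and dG: "0 < dG m i" if "i < m" for m i
    unfolding dF_def dG_def t_def using mesh_increments(3,4)[OF ab f g fg g1 that] by auto
  have bF: "dF m j = (\<Sum>k<N. dF (m*N) (j*N+k))" and bG: "dG m j = (\<Sum>k<N. dG (m*N) (j*N+k))"
    if "j < m" "N > 0" for m j N
    unfolding dF_def dG_def t_def
    by (intro integral_sum_mesh_block[OF ab that(2)] mesh_increments(1,2)[OF ab f g fg g1 that(1)]; assumption)+
  define S where "S m = (\<Sum>j<m. (norm (dF m j))\<^sup>2 / dG m j)" for m
  define Gt where "Gt = integral {a..b} g"
  have sumG: "(\<Sum>j<m. dG m j) = Gt" if "m > 0" for m
    using integral_sum_mesh[OF ab that g] by (simp add: Gt_def dG_def t_def)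
  have dev: "(\<Sum>j<m. \<Sum>k<N. (norm (dF (m*N) (j*N+k)
            - dG (m*N) (j*N+k) *\<^sub>R ((1 / dG m j) *\<^sub>R dF m j)))\<^sup>2 / dG (m*N) (j*N+k)) = S (m*N) - S m"
    if N: "N > 0" for m N
  proof -
    have "(\<Sum>k<N. (norm (dF (m*N) (j*N+k)
            - dG (m*N) (j*N+k) *\<^sub>R ((1 / dG m j) *\<^sub>R dF m j)))\<^sup>2 / dG (m*N) (j*N+k))
        = (\<Sum>k<N. (norm (dF (m*N) (j*N+k)))\<^sup>2 / dG (m*N) (j*N+k)) - (norm (dF m j))\<^sup>2 / dG m j"
      if "j < m" for j
      using sum_block_deviation[of N "\<lambda>k. dG (m*N) (j*N+k)" "\<lambda>k. dF (m*N) (j*N+k)"] dG block_index_less that N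
      by (simp flip: bF[OF that N] bG[OF that N])
    then show ?thesis
      unfolding S_def sum_blocks by (simp add: sum_subtractf)
  qed
  have "S m \<le> Gt" if "m > 0" for m
  proof -
    have "(norm (dF m j))\<^sup>2 / dG m j \<le> dG m j" if "j < m" for j
      using dG[OF that] dFG[OF that] by (simp add: divide_simps power2_eq_square mult_mono)
    then show ?thesis unfolding S_def using sumG[OF that] by (metis (no_types, lifting) sum_mono lessThan_iff)
  qed
  then have bdd: "bdd_above (S ` {0<..})" by (auto intro!: bdd_aboveI[of _ Gt])
  have Gt0: "0 \<le> Gt" unfolding Gt_def by (rule integral_nonneg[OF g]) (use g1 in force)
  \<comment> \<open>\<open>\<delta>\<close> is both the weight in the inequality \<open>amgm\<close>
    and the square root of the allowed gain in \<open>S\<close>; the total is then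
    \<open>\<delta> * (Gt + 1) / 2\<close>, which is below \<open>\<epsilon>\<close>.\<close>
  define \<delta> where "\<delta> = \<epsilon> / (Gt + 1)"
  have \<delta>: "\<delta> > 0" using eps Gt0 by (simp add: \<delta>_def)
  have "Sup (S ` {0<..}) - \<delta>\<^sup>2 < Sup (S ` {0<..})" using \<delta> by simp
  then obtain m where m: "m > 0" "Sup (S ` {0<..}) - \<delta>\<^sup>2 < S m"
    using bdd by (subst (asm) less_cSup_iff) auto
  have "(\<Sum>j<m. \<Sum>k<N. norm (dF (m*N) (j*N+k)
            - dG (m*N) (j*N+k) *\<^sub>R ((1 / dG m j) *\<^sub>R dF m j))) \<le> \<epsilon>" if N: "N > 0" for N
  proof -
    let ?d = "\<lambda>j k. norm (dF (m*N) (j*N+k) - dG (m*N) (j*N+k) *\<^sub>R ((1 / dG m j) *\<^sub>R dF m j))"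
    \<comment> \<open>Young's inequality recovers a sum of norms from a sum of squares divided by
      \<open>dG\<close>; the price is \<open>\<delta>\<close> times the total integral of
      \<open>g\<close>.\<close>
    have amgm: "x \<le> (\<delta> * y + (x\<^sup>2 / y) / \<delta>) / 2" if "y > 0" for x y
    proof -
      have "0 \<le> (x - \<delta> * y)\<^sup>2 / (\<delta> * y)" using that \<delta> by simp
      also have "\<dots> = (x\<^sup>2 / y) / \<delta> - 2 * x + \<delta> * y"
        using that \<delta> by (simp add: power2_eq_square field_simps)
      finally show ?thesis by simp
    qed
    have "(\<Sum>j<m. \<Sum>k<N. ?d j k)
        \<le> (\<Sum>j<m. \<Sum>k<N. (\<delta> * dG (m*N) (j*N+k) + ((?d j k)\<^sup>2 / dG (m*N) (j*N+k)) / \<delta>) / 2)"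
      by (intro sum_mono amgm dG) (auto intro: block_index_less)
    also have "\<dots> = (\<delta> * (\<Sum>j<m. \<Sum>k<N. dG (m*N) (j*N+k)) + (S (m*N) - S m) / \<delta>) / 2"
      unfolding dev[OF N, symmetric]
      by (simp add: sum.distrib sum_distrib_left sum_divide_distrib add_divide_distrib)
    also have "(\<Sum>j<m. \<Sum>k<N. dG (m*N) (j*N+k)) = Gt"
      using sumG[of "m*N"] m N by (simp add: sum_blocks)
    also have "(\<delta> * Gt + (S (m*N) - S m) / \<delta>) / 2 \<le> (\<delta> * Gt + \<delta>\<^sup>2 / \<delta>) / 2"
    proof -
      have "S (m*N) \<le> Sup (S ` {0<..})" using bdd m N by (intro cSup_upper) auto
      then have "S (m*N) - S m \<le> \<delta>\<^sup>2" using m by simp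
      then show ?thesis using \<delta> by (intro divide_right_mono add_left_mono) auto
    qed
    also have "\<dots> = \<delta> * (Gt + 1) / 2" using \<delta> by (simp add: power2_eq_square algebra_simps)
    also have "\<dots> \<le> \<epsilon>" using eps Gt0 by (simp add: \<delta>_def)
    finally show ?thesis .
  qed
  then show ?thesis using m by blast
qed

text \<open>The test curve is frozen at the left endpoint \<open>p\<close> in both integrals, each
  time at a cost of \<open>\<delta>\<close> times the integral of \<open>g\<close>, whence the
  factor 2. After freezing, only the inner product of \<open>z p\<close> with the difference of the
  increments remains.\<close>

lemma cinner_integral_sampling:
  fixes f :: "real \<Rightarrow> 'a::chilbert" and g :: "real \<Rightarrow> real"
  assumes f: "f integrable_on {p..q}" and g: "g integrable_on {p..q}"
    and fg: "\<And>r. r \<in> {p..q} \<Longrightarrow> norm (f r) \<le> g r"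
    and zf: "(\<lambda>r. cinner (z r) (f r)) integrable_on {p..q}"
    and zv: "(\<lambda>r. g r *\<^sub>R cinner (z r) v) integrable_on {p..q}"
    and z: "\<And>r. r \<in> {p..q} \<Longrightarrow> norm (z r - z p) \<le> \<delta>" and zp: "norm (z p) \<le> 1" and v: "norm v \<le> 1"
  shows "cmod (integral {p..q} (\<lambda>r. cinner (z r) (f r)) - integral {p..q} (\<lambda>r. g r *\<^sub>R cinner (z r) v))
     \<le> norm (integral {p..q} f - integral {p..q} g *\<^sub>R v) + 2 * \<delta> * integral {p..q} g"
proof -
  note lin = bounded_linear_cinner_right[of "z p"]
  have f': "(\<lambda>r. cinner (z p) (f r)) integrable_on {p..q}"
    and f'': "integral {p..q} (\<lambda>r. cinner (z p) (f r)) = cinner (z p) (integral {p..q} f)"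
    using integrable_linear[OF f lin] integral_linear[OF f lin] by (simp_all add: o_def)
  have g': "(\<lambda>r. g r *\<^sub>R cinner (z p) v) integrable_on {p..q}"
    and g'': "integral {p..q} (\<lambda>r. g r *\<^sub>R cinner (z p) v) = integral {p..q} g *\<^sub>R cinner (z p) v"
    using integrable_linear[OF g bounded_linear_scaleR_left] integral_linear[OF g bounded_linear_scaleR_left]
    by (simp_all add: o_def)
  have 1: "cmod (integral {p..q} (\<lambda>r. cinner (z r) (f r)) - cinner (z p) (integral {p..q} f))
      \<le> \<delta> * integral {p..q} g"
  proof -
    have "cmod (integral {p..q} (\<lambda>r. cinner (z r) (f r) - cinner (z p) (f r)))
        \<le> integral {p..q} (\<lambda>r. \<delta> * g r)"
    proof (rule integral_norm_bound_integral)
      fix r assume r: "r \<in> {p..q}"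
      have "cmod (cinner (z r - z p) (f r)) \<le> norm (z r - z p) * norm (f r)" by (rule norm_cinner_le)
      also have "\<dots> \<le> \<delta> * g r"
        using z[OF r] fg[OF r] norm_ge_zero[of "z r - z p"] by (intro mult_mono norm_ge_zero) linarith+
      finally show "cmod (cinner (z r) (f r) - cinner (z p) (f r)) \<le> \<delta> * g r"
        by (simp add: cinner_diff_left)
    qed (use zf f' g in \<open>auto intro: integrable_diff integrable_on_mult_right\<close>)
    then show ?thesis
      using Henstock_Kurzweil_Integration.integral_diff[OF zf f'] by (simp add: f'')
  qed
  have 2: "cmod (integral {p..q} (\<lambda>r. g r *\<^sub>R cinner (z r) v) - cinner (z p) (integral {p..q} g *\<^sub>R v))
      \<le> \<delta> * integral {p..q} g"
  proof -
    have "cmod (integral {p..q} (\<lambda>r. g r *\<^sub>R cinner (z r) v - g r *\<^sub>R cinner (z p) v))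
        \<le> integral {p..q} (\<lambda>r. \<delta> * g r)"
    proof (rule integral_norm_bound_integral)
      fix r assume r: "r \<in> {p..q}"
      have g0: "0 \<le> g r" using fg[OF r] norm_ge_zero[of "f r"] by linarith
      have "cmod (cinner (z r - z p) v) \<le> norm (z r - z p) * norm v" by (rule norm_cinner_le)
      also have "\<dots> \<le> \<delta> * 1"
        using z[OF r] v norm_ge_zero[of "z r - z p"] by (intro mult_mono norm_ge_zero) linarith+
      finally have "g r * cmod (cinner (z r - z p) v) \<le> g r * \<delta>"
        using g0 by (intro mult_left_mono) auto
      then show "cmod (g r *\<^sub>R cinner (z r) v - g r *\<^sub>R cinner (z p) v) \<le> \<delta> * g r"
        using g0 by (simp add: cinner_diff_left mult.commute flip: scaleR_diff_right)
    qed (use zv g' g in \<open>auto intro: integrable_diff integrable_on_mult_right\<close>)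
    then show ?thesis
      using Henstock_Kurzweil_Integration.integral_diff[OF zv g'] g'' by (simp add: cinner_scaleR_right)
  qed
  let ?D = "integral {p..q} f - integral {p..q} g *\<^sub>R v"
  have 3: "cmod (cinner (z p) ?D) \<le> norm ?D"
    using norm_cinner_le[of "z p" ?D] zp mult_right_mono[OF zp norm_ge_zero[of ?D]] by linarith
  let ?A = "integral {p..q} (\<lambda>r. cinner (z r) (f r))"
  let ?B = "integral {p..q} (\<lambda>r. g r *\<^sub>R cinner (z r) v)"
  let ?c = "cinner (z p) (integral {p..q} f)" let ?d = "cinner (z p) (integral {p..q} g *\<^sub>R v)"
  have "cmod (?A - ?B) \<le> cmod (?A - ?c) + cmod (?c - ?d) + cmod (?B - ?d)"
    using norm_triangle_ineq4[of "(?A - ?c) + (?c - ?d)" "?B - ?d"] norm_triangle_ineq[of "?A - ?c" "?c - ?d"]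
    by simp
  then show ?thesis using 1 2 3 by (simp add: cinner_diff_right)
qed

text \<open>On each coarse interval \<open>f\<close> is replaced by \<open>g\<close> times its
  average, so smallness has to be known only for \<open>g\<close> times a constant vector. The
  vectors in \<open>step\<close> are restricted to integrals of \<open>f\<close>, which lets a
  closed linear condition on the values of \<open>f\<close> pass to them. \<open>Y\<close> indexes
  test curves over which the estimate is uniform.\<close>

lemma oscillatory_integral_transfer:
  fixes f :: "real \<Rightarrow> 'a::chilbert" and g :: "real \<Rightarrow> real"
    and Z :: "real \<Rightarrow> 'b \<Rightarrow> real \<Rightarrow> 'a"
  assumes ab: "a < b" and f: "f integrable_on {a..b}" and g: "g integrable_on {a..b}"
    and fg: "\<And>r. r \<in> {a..b} \<Longrightarrow> norm (f r) \<le> g r" and g1: "\<And>r. r \<in> {a..b} \<Longrightarrow> 1 \<le> g r"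
    and Zc: "\<And>\<sigma> \<eta>. \<lbrakk>0 < \<sigma>; \<eta> \<in> Y\<rbrakk> \<Longrightarrow> continuous_on {a..b} (Z \<sigma> \<eta>)"
    and Zn: "\<And>\<sigma> \<eta> r. \<lbrakk>0 < \<sigma>; \<eta> \<in> Y; r \<in> {a..b}\<rbrakk> \<Longrightarrow> norm (Z \<sigma> \<eta> r) \<le> 1"
    and Zf: "\<And>\<sigma> \<eta>. \<lbrakk>0 < \<sigma>; \<eta> \<in> Y\<rbrakk> \<Longrightarrow> (\<lambda>r. cinner (Z \<sigma> \<eta> r) (f r)) integrable_on {a..b}"
    and step: "\<And>p q e. \<lbrakk>a \<le> p; p \<le> q; q \<le> b; 0 < e\<rbrakk> \<Longrightarrow> \<forall>\<^sub>F \<sigma> in at_top. \<forall>\<eta>\<in>Y.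
        cmod (integral {p..q} (\<lambda>r. g r *\<^sub>R cinner (Z \<sigma> \<eta> r) (integral {p..q} f))) \<le> e"
    and eps: "0 < \<epsilon>"
  shows "\<forall>\<^sub>F \<sigma> in at_top. \<forall>\<eta>\<in>Y. cmod (integral {a..b} (\<lambda>r. cinner (Z \<sigma> \<eta> r) (f r))) \<le> \<epsilon>"
proof -
  define t where "t = mesh_point a b"
  define dF where "dF = (\<lambda>m i. integral {t m i..t m (Suc i)} f)"
  define dG where "dG = (\<lambda>m i. integral {t m i..t m (Suc i)} g)"
  define Gt where "Gt = integral {a..b} g"
  have Gt0: "0 \<le> Gt" unfolding Gt_def by (rule integral_nonneg[OF g]) (use g1 in force)
  obtain m where m: "m > 0" and var: "\<And>N. N > 0 \<Longrightarrow> (\<Sum>j<m. \<Sum>k<N. norm (dF (m*N) (j*N+k)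
            - dG (m*N) (j*N+k) *\<^sub>R ((1 / dG m j) *\<^sub>R dF m j))) \<le> \<epsilon> / 4"
    using average_approximation[OF ab f g fg g1, of "\<epsilon> / 4"] eps
    unfolding dF_def dG_def t_def by auto
  have sub: "{t m i..t m (Suc i)} \<subseteq> {a..b}" if "i < m" for m i
    unfolding t_def by (rule mesh_interval_subset[OF ab that])
  have fi: "f integrable_on {t m i..t m (Suc i)}" and gi: "g integrable_on {t m i..t m (Suc i)}"
    and dFG: "norm (dF m i) \<le> dG m i" and dG: "0 < dG m i" if "i < m" for m i
    unfolding dF_def dG_def t_def using mesh_increments[OF ab f g fg g1 that] by auto
  define v where "v j = (1 / dG m j) *\<^sub>R dF m j" for j
  have v1: "norm (v j) \<le> 1" if "j < m" for j
    using dFG[OF that] dG[OF that] by (simp add: v_def)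
  \<comment> \<open>This holds for every positive frequency with the same \<open>m\<close>: the
    refinement number \<open>N\<close> is chosen inside, from the uniform continuity of the single
    curve \<open>?z\<close>.\<close>
  have approx: "cmod (integral {a..b} (\<lambda>r. cinner (Z \<sigma> \<eta> r) (f r))
       - (\<Sum>j<m. integral {t m j..t m (Suc j)} (\<lambda>r. g r *\<^sub>R cinner (Z \<sigma> \<eta> r) (v j)))) \<le> \<epsilon> / 2"
    if \<sigma>: "0 < \<sigma>" and \<eta>: "\<eta> \<in> Y" for \<sigma> \<eta>
  proof -
    let ?z = "Z \<sigma> \<eta>"
    \<comment> \<open>Freezing the curve costs \<open>2 * \<delta> * Gt\<close> in total, which this
      choice keeps below \<open>\<epsilon> / 4\<close>; the averages cost the other
      \<open>\<epsilon> / 4\<close>.\<close>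
    define \<delta> where "\<delta> = \<epsilon> / (8 * (Gt + 1))"
    have \<delta>: "0 < \<delta>" using eps Gt0 by (simp add: \<delta>_def)
    have "uniformly_continuous_on {a..b} ?z"
      by (rule compact_uniformly_continuous[OF Zc[OF \<sigma> \<eta>]]) simp
    then obtain d where d: "d > 0"
      "\<And>r r'. \<lbrakk>r \<in> {a..b}; r' \<in> {a..b}; dist r' r < d\<rbrakk> \<Longrightarrow> dist (?z r') (?z r) < \<delta>"
      using \<delta> unfolding uniformly_continuous_on_def by metis
    obtain N0 :: nat where N0: "(b - a) / d < real N0" using reals_Archimedean2 by blast
    define N where "N = Suc N0"
    have N: "N > 0" by (simp add: N_def)
    have mesh: "(b - a) / real (m * N) < d"
    proof -
      have "(b - a) / d < real N" using N0 by (simp add: N_def)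
      then have "(b - a) < d * real N" using d by (simp add: field_simps)
      also have "\<dots> \<le> d * real (m * N)" using d m by (simp flip: of_nat_mult)
      finally show ?thesis using m N by (simp add: field_simps)
    qed
    let ?J = "\<lambda>j k. {t (m*N) (j*N+k)..t (m*N) (Suc (j*N+k))}"
    have zvi: "(\<lambda>r. g r *\<^sub>R cinner (?z r) w) integrable_on {p..q}" if "{p..q} \<subseteq> {a..b}" for p q w
    proof (rule integrable_scaleR_continuous)
      show "g integrable_on {p..q}" by (rule integrable_on_subinterval[OF g that])
      show "0 \<le> g r" if "r \<in> {p..q}" for r using g1[of r] that \<open>{p..q} \<subseteq> {a..b}\<close> by auto
      show "continuous_on {p..q} (\<lambda>r. cinner (?z r) w)"
        by (intro continuous_on_cinner continuous_on_const continuous_on_subset[OF Zc[OF \<sigma> \<eta>] that])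
    qed
    have A: "integral {a..b} (\<lambda>r. cinner (?z r) (f r))
        = (\<Sum>j<m. \<Sum>k<N. integral (?J j k) (\<lambda>r. cinner (?z r) (f r)))"
      using integral_sum_mesh[OF ab _ Zf[OF \<sigma> \<eta>], of "m*N"] m N by (simp add: sum_blocks t_def)
    have B: "integral {t m j..t m (Suc j)} h = (\<Sum>k<N. integral (?J j k) h)"
      if "h integrable_on {t m j..t m (Suc j)}" for j and h :: "real \<Rightarrow> complex"
      using integral_sum_mesh_block[OF ab N] that by (simp add: t_def)
    have C: "cmod (integral (?J j k) (\<lambda>r. cinner (?z r) (f r))
         - integral (?J j k) (\<lambda>r. g r *\<^sub>R cinner (?z r) (v j)))
       \<le> norm (dF (m*N) (j*N+k) - dG (m*N) (j*N+k) *\<^sub>R v j) + 2 * \<delta> * dG (m*N) (j*N+k)"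
      if jk: "j < m" "k < N" for j k
      unfolding dF_def dG_def
    proof (rule cinner_integral_sampling)
      note i = block_index_less[OF jk]
      note s = sub[OF i]
      show "f integrable_on ?J j k" "g integrable_on ?J j k" using fi[OF i] gi[OF i] .
      show "(\<lambda>r. cinner (?z r) (f r)) integrable_on ?J j k"
        by (rule integrable_on_subinterval[OF Zf[OF \<sigma> \<eta>] s])
      show "(\<lambda>r. g r *\<^sub>R cinner (?z r) (v j)) integrable_on ?J j k" by (rule zvi[OF s])
      show "norm (v j) \<le> 1" by (rule v1[OF jk(1)])
      have p: "t (m*N) (j*N+k) \<in> {a..b}" unfolding t_def using i m N by (intro mesh_point_in ab) auto
      show "norm (?z (t (m*N) (j*N+k))) \<le> 1" by (rule Zn[OF \<sigma> \<eta> p])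
      fix r assume r: "r \<in> ?J j k"
      have "t (m*N) (Suc (j*N+k)) - t (m*N) (j*N+k) = (b - a) / real (m * N)"
        unfolding t_def by (rule mesh_point_width)
      then have "dist r (t (m*N) (j*N+k)) < d" using r mesh by (auto simp: dist_real_def)
      then show "norm (?z r - ?z (t (m*N) (j*N+k))) \<le> \<delta>"
        using d(2)[OF p, of r] r s by (auto simp: dist_norm intro: less_imp_le)
      show "norm (f r) \<le> g r" using fg r s by auto
    qed
    have D: "integral {a..b} (\<lambda>r. cinner (?z r) (f r))
       - (\<Sum>j<m. integral {t m j..t m (Suc j)} (\<lambda>r. g r *\<^sub>R cinner (?z r) (v j)))
       = (\<Sum>j<m. \<Sum>k<N. integral (?J j k) (\<lambda>r. cinner (?z r) (f r))
         - integral (?J j k) (\<lambda>r. g r *\<^sub>R cinner (?z r) (v j)))"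
      unfolding A sum_subtractf 
      by (rule arg_cong2[of _ _ _ _ minus]) (auto intro!: sum.cong B zvi sub)
    have "cmod (integral {a..b} (\<lambda>r. cinner (?z r) (f r))
       - (\<Sum>j<m. integral {t m j..t m (Suc j)} (\<lambda>r. g r *\<^sub>R cinner (?z r) (v j)))) \<le> (\<Sum>j<m. \<Sum>k<N.
        norm (dF (m*N) (j*N+k) - dG (m*N) (j*N+k) *\<^sub>R v j) + 2 * \<delta> * dG (m*N) (j*N+k))"
      unfolding D by (rule order_trans[OF norm_sum], rule sum_mono, rule order_trans[OF norm_sum], rule sum_mono, rule C) auto
    also have "\<dots> = (\<Sum>j<m. \<Sum>k<N. norm (dF (m*N) (j*N+k) - dG (m*N) (j*N+k) *\<^sub>R v j))
        + 2 * \<delta> * (\<Sum>j<m. \<Sum>k<N. dG (m*N) (j*N+k))"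
      by (simp only: sum.distrib sum_distrib_left)
    also have "(\<Sum>j<m. \<Sum>k<N. dG (m*N) (j*N+k)) = Gt"
      using integral_sum_mesh[OF ab _ g, of "m*N"] m N by (simp add: sum_blocks Gt_def dG_def t_def)
    also have "(\<Sum>j<m. \<Sum>k<N. norm (dF (m*N) (j*N+k) - dG (m*N) (j*N+k) *\<^sub>R v j)) + 2 * \<delta> * Gt
        \<le> \<epsilon> / 4 + 2 * \<delta> * (Gt + 1)"
      using var[OF N] \<delta> by (intro add_mono) (auto simp: v_def)
    also have "\<dots> = \<epsilon> / 2" using Gt0 by (simp add: \<delta>_def field_simps)
    finally show ?thesis .
  qed
  have "\<forall>\<^sub>F \<sigma> in at_top. \<forall>\<eta>\<in>Y. cmod (integral {t m j..t m (Suc j)}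
          (\<lambda>r. g r *\<^sub>R cinner (Z \<sigma> \<eta> r) (v j))) \<le> \<epsilon> / (2 * m)" if j: "j < m" for j
  proof -
    have "\<forall>\<^sub>F \<sigma> in at_top. \<forall>\<eta>\<in>Y. cmod (integral {t m j..t m (Suc j)}
          (\<lambda>r. g r *\<^sub>R cinner (Z \<sigma> \<eta> r) (dF m j))) \<le> dG m j * \<epsilon> / (2 * m)"
      unfolding dF_def
      \<comment> \<open>\<open>step\<close> speaks about the integral \<open>dF m j\<close> itself;
        the factor \<open>dG m j\<close> in the tolerance makes up for the division in
        \<open>v j\<close>, and the factor \<open>m\<close> for the sum over the blocks.\<close>
      by (rule step) (use sub[OF j] mesh_point_mono[OF ab, of j "Suc j" m] j m eps dG[OF j] in \<open>auto simp: t_def\<close>)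
    then show ?thesis
    proof (rule eventually_mono)
      fix \<sigma> assume *: "\<forall>\<eta>\<in>Y. cmod (integral {t m j..t m (Suc j)}
          (\<lambda>r. g r *\<^sub>R cinner (Z \<sigma> \<eta> r) (dF m j))) \<le> dG m j * \<epsilon> / (2 * m)"
      have "(\<lambda>r. g r *\<^sub>R cinner (Z \<sigma> \<eta> r) (v j))
          = (\<lambda>r. (1 / dG m j) *\<^sub>R (g r *\<^sub>R cinner (Z \<sigma> \<eta> r) (dF m j)))" for \<eta>
        by (simp add: v_def cinner_scaleR_right mult.commute)
      then show "\<forall>\<eta>\<in>Y. cmod (integral {t m j..t m (Suc j)}
          (\<lambda>r. g r *\<^sub>R cinner (Z \<sigma> \<eta> r) (v j))) \<le> \<epsilon> / (2 * m)"
        using * dG[OF j] by (auto simp: divide_simps mult_ac simp del: scaleR_scaleR)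
    qed
  qed
  then have "\<forall>\<^sub>F \<sigma> in at_top. \<forall>j\<in>{..<m}. \<forall>\<eta>\<in>Y. cmod (integral {t m j..t m (Suc j)}
          (\<lambda>r. g r *\<^sub>R cinner (Z \<sigma> \<eta> r) (v j))) \<le> \<epsilon> / (2 * m)"
    by (intro eventually_ball_finite) auto
  then show ?thesis using eventually_gt_at_top[of 0]
  proof eventually_elim
    case (elim \<sigma>)
    show ?case
    proof
      fix \<eta> assume \<eta>: "\<eta> \<in> Y"
      let ?s = "\<Sum>j<m. integral {t m j..t m (Suc j)} (\<lambda>r. g r *\<^sub>R cinner (Z \<sigma> \<eta> r) (v j))"
      have "cmod ?s \<le> (\<Sum>j<m. \<epsilon> / (2 * m))"
        by (intro order_trans[OF norm_sum] sum_mono) (use elim \<eta> in auto)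
      also have "\<dots> = \<epsilon> / 2" using m by simp
      finally have s: "cmod ?s \<le> \<epsilon> / 2" .
      show "cmod (integral {a..b} (\<lambda>r. cinner (Z \<sigma> \<eta> r) (f r))) \<le> \<epsilon>"
        using approx[OF elim(2) \<eta>] s norm_triangle_sub[of "integral {a..b} (\<lambda>r. cinner (Z \<sigma> \<eta> r) (f r))" ?s]
        by linarith
    qed
  qed
qed

section \<open>Riemann-Lebesgue lemmas\<close>

text \<open>With the constant \<open>M\<close> as dominating function, the transfer principle leaves
  only integrals of a pure exponential. The fundamental theorem of calculus shows them to be of
  order \<open>1 / \<sigma>\<close>.\<close>

lemma Riemann_Lebesgue_bounded:
  fixes h :: "real \<Rightarrow> real"
  assumes ab: "a < b" and h: "h integrable_on {a..b}"
    and h0: "\<And>r. r \<in> {a..b} \<Longrightarrow> 0 \<le> h r" and hM: "\<And>r. r \<in> {a..b} \<Longrightarrow> h r \<le> M" and M: "1 \<le> M"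
    and w: "\<omega> \<noteq> 0" and eps: "0 < \<epsilon>"
  shows "\<forall>\<^sub>F \<sigma> in at_top. cmod (integral {a..b} (\<lambda>r. h r *\<^sub>R cis (\<sigma> * \<omega> * r))) \<le> \<epsilon>"
proof -
  have h': "(\<lambda>r. complex_of_real (h r)) integrable_on {a..b}"
    using integrable_linear[OF h bounded_linear_of_real] by (simp add: o_def)
  have *: "\<forall>\<^sub>F \<sigma> in at_top. \<forall>\<eta>\<in>{()}. cmod (integral {a..b} (\<lambda>r. cinner (cis (- (\<sigma> * \<omega> * r))) (complex_of_real (h r)))) \<le> \<epsilon>"
  proof (rule oscillatory_integral_transfer[where g = "\<lambda>_. M" and f = "\<lambda>r. complex_of_real (h r)"
        and Z = "\<lambda>\<sigma> _ r. cis (- (\<sigma> * \<omega> * r))"])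
    show "(\<lambda>r. cinner (cis (- (\<sigma> * \<omega> * r))) (complex_of_real (h r))) integrable_on {a..b}" for \<sigma>
    proof -
      have "(\<lambda>r. h r *\<^sub>R cis (\<sigma> * \<omega> * r)) integrable_on {a..b}"
        by (intro integrable_scaleR_continuous h h0 continuous_intros)
      then show ?thesis
        by (simp add: cinner_complex_def cis_cnj scaleR_conv_of_real mult.commute)
    qed
    show "continuous_on {a..b} (\<lambda>r. cis (- (\<sigma> * \<omega> * r)))" for \<sigma>
      by (intro continuous_intros)
    fix p q e :: real assume pq: "a \<le> p" "p \<le> q" "q \<le> b" and e: "0 < e"
    define v where "v = integral {p..q} (\<lambda>r. complex_of_real (h r))"
    \<comment> \<open>The primitive of the exponential has modulus
      \<open>1 / \<bar>\<sigma> * \<omega>\<bar>\<close> at both endpoints, which gives the 2;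
      \<open>B\<close> collects everything except \<open>1 / \<sigma>\<close>.\<close>
    define B where "B = M * cmod v * (2 / \<bar>\<omega>\<bar>)"
    have B0: "B \<ge> 0" using M by (simp add: B_def)
    have int: "cmod (integral {p..q} (\<lambda>r. M *\<^sub>R cinner (cis (- (\<sigma> * \<omega> * r))) v)) \<le> B / \<sigma>"
      if \<sigma>: "\<sigma> > 0" for \<sigma>
    proof -
      let ?c = "\<sigma> * \<omega>"
      have c: "?c \<noteq> 0" using \<sigma> w by simp
      have "((\<lambda>r. cis (?c * r)) has_integral
          (cis (?c * q) / (\<i> * ?c) - cis (?c * p) / (\<i> * ?c))) {p..q}"
      proof (rule fundamental_theorem_of_calculus[OF pq(2)])
        fix x
        have "((\<lambda>z. exp (\<i> * ?c * z) / (\<i> * ?c)) has_field_derivative exp (\<i> * ?c * x)) (at (of_real x))"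
          using c by (auto intro!: derivative_eq_intros)
        from has_vector_derivative_real_field[OF this]
        show "((\<lambda>r. cis (?c * r) / (\<i> * ?c)) has_vector_derivative cis (?c * x)) (at x within {p..q})"
          by (simp add: cis_conv_exp mult.assoc)
      qed
      from has_integral_mult_right[OF this, of "M * v"]
      have "((\<lambda>r. M *\<^sub>R cinner (cis (- (?c * r))) v) has_integral
          M * v * (cis (?c * q) / (\<i> * ?c) - cis (?c * p) / (\<i> * ?c))) {p..q}"
        by (simp add: cinner_complex_def cis_cnj scaleR_conv_of_real mult_ac)
      then have "cmod (integral {p..q} (\<lambda>r. M *\<^sub>R cinner (cis (- (?c * r))) v))
          = cmod (M * v * (cis (?c * q) / (\<i> * ?c) - cis (?c * p) / (\<i> * ?c)))"
        by (simp only: integral_unique)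
      also have "\<dots> = M * cmod v * cmod (cis (?c * q) / (\<i> * ?c) - cis (?c * p) / (\<i> * ?c))"
        using M by (simp add: norm_mult)
      also have "\<dots> \<le> M * cmod v * (2 / \<bar>?c\<bar>)"
      proof (rule mult_left_mono)
        show "cmod (cis (?c * q) / (\<i> * ?c) - cis (?c * p) / (\<i> * ?c)) \<le> 2 / \<bar>?c\<bar>"
          by (rule order_trans[OF norm_triangle_ineq4]) (simp add: norm_divide norm_mult abs_mult mult.commute)
      qed (use M in simp)
      also have "\<dots> = B / \<sigma>" using \<sigma> by (simp add: B_def abs_mult)
      finally show ?thesis .
    qed
    have "\<forall>\<^sub>F \<sigma> in at_top. \<sigma> > 0 \<and> B / e \<le> \<sigma>"
      by (intro eventually_conj eventually_gt_at_top eventually_ge_at_top)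
    then show "\<forall>\<^sub>F \<sigma> in at_top. \<forall>\<eta>\<in>{()}. cmod (integral {p..q}
        (\<lambda>r. M *\<^sub>R cinner (cis (- (\<sigma> * \<omega> * r))) (integral {p..q} (\<lambda>r. complex_of_real (h r))))) \<le> e"
    proof eventually_elim
      case (elim \<sigma>)
      then have "B / \<sigma> \<le> e" using e by (simp add: field_simps)
      then show ?case using int[of \<sigma>] elim by (simp add: v_def)
    qed
  qed (use ab h' h0 hM M eps in auto)
  show ?thesis
    using * unfolding cinner_complex_def cis_cnj scaleR_conv_of_real
    by (simp add: mult.commute[of "cis _"])
qed

text \<open>Truncation at height \<open>N\<close> reduces to the bounded case. Since the exponential
  has modulus one, the truncation error is at most the integral of \<open>g - min g N\<close>,
  independently of \<open>\<sigma>\<close>, and dominated convergence makes it small.\<close>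

lemma Riemann_Lebesgue:
  fixes g :: "real \<Rightarrow> real"
  assumes g: "g integrable_on {a..b}" and g0: "\<And>r. r \<in> {a..b} \<Longrightarrow> 0 \<le> g r"
    and w: "\<omega> \<noteq> 0"
  shows "((\<lambda>\<sigma>. integral {a..b} (\<lambda>r. g r *\<^sub>R cis (\<sigma> * \<omega> * r))) \<longlongrightarrow> 0) at_top"
proof (cases "a < b")
  case True
  have hint: "(\<lambda>r. min (g r) (real N)) integrable_on {a..b}" for N
    by (rule set_lebesgue_integral_eq_integral(1), rule absolutely_integrable_min_1)
      (use g0 in \<open>auto intro: nonnegative_absolutely_integrable_1[OF g]\<close>)
  have lim: "(\<lambda>N. integral {a..b} (\<lambda>r. min (g r) (real N))) \<longlonglongrightarrow> integral {a..b} g"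
  proof (rule dominated_convergence(2)[OF hint g])
    fix r assume r: "r \<in> {a..b}"
    show "norm (min (g r) (real N)) \<le> g r" for N using g0[OF r] by (simp add: min_def)
    obtain N0 :: nat where "g r < real N0" using reals_Archimedean2 by blast
    then have "\<forall>\<^sub>F N in sequentially. min (g r) (real N) = g r"
      by (intro eventually_sequentiallyI[of N0]) (simp add: min_def)
    then show "(\<lambda>N. min (g r) (real N)) \<longlonglongrightarrow> g r" by (rule tendsto_eventually)
  qed
  show ?thesis
  proof (rule tendstoI)
    fix \<epsilon> :: real assume eps: "0 < \<epsilon>"
    have "\<forall>\<^sub>F N in sequentially. dist (integral {a..b} (\<lambda>r. min (g r) (real N))) (integral {a..b} g) < \<epsilon> / 2 \<and> 1 \<le> N"
      using tendstoD[OF lim, of "\<epsilon> / 2"] eps by (auto intro: eventually_conj eventually_ge_at_top)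
    \<comment> \<open>The level is at least 1 so that it can play the role of
      \<open>M\<close>.\<close>
    then obtain N where N: "dist (integral {a..b} (\<lambda>r. min (g r) (real N))) (integral {a..b} g) < \<epsilon> / 2" "1 \<le> N"
      by (auto simp: eventually_sequentially)
    let ?h = "\<lambda>r. min (g r) (real N)"
    have "\<forall>\<^sub>F \<sigma> in at_top. cmod (integral {a..b} (\<lambda>r. ?h r *\<^sub>R cis (\<sigma> * \<omega> * r))) \<le> \<epsilon> / 2"
      by (rule Riemann_Lebesgue_bounded[OF True hint, where M = "real N"]) (use g0 N w eps in auto)
    then show "\<forall>\<^sub>F \<sigma> in at_top. dist (integral {a..b} (\<lambda>r. g r *\<^sub>R cis (\<sigma> * \<omega> * r))) 0 < \<epsilon>"
    proof eventually_elim
      case (elim \<sigma>)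
      have i1: "(\<lambda>r. g r *\<^sub>R cis (\<sigma> * \<omega> * r)) integrable_on {a..b}"
        and i2: "(\<lambda>r. ?h r *\<^sub>R cis (\<sigma> * \<omega> * r)) integrable_on {a..b}"
        using g g0 hint by (auto intro!: integrable_scaleR_continuous continuous_intros)
      have "cmod (integral {a..b} (\<lambda>r. g r *\<^sub>R cis (\<sigma> * \<omega> * r) - ?h r *\<^sub>R cis (\<sigma> * \<omega> * r)))
          \<le> integral {a..b} (\<lambda>r. g r - ?h r)"
        by (rule integral_norm_bound_integral[OF integrable_diff[OF i1 i2] integrable_diff[OF g hint]])
          (simp flip: scaleR_diff_left)
      also have "\<dots> < \<epsilon> / 2"
        using N(1) unfolding Henstock_Kurzweil_Integration.integral_diff[OF g hint] dist_real_def
        by linarith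
      finally show ?case
        using elim norm_triangle_sub[of "integral {a..b} (\<lambda>r. g r *\<^sub>R cis (\<sigma> * \<omega> * r))"
            "integral {a..b} (\<lambda>r. ?h r *\<^sub>R cis (\<sigma> * \<omega> * r))"]
          Henstock_Kurzweil_Integration.integral_diff[OF i1 i2] by simp
    qed
  qed
next
  case False
  then have "integral {a..b} h = 0" for h :: "real \<Rightarrow> complex"
    by (cases "a = b") auto
  then show ?thesis by simp
qed

section \<open>Gronwall estimate and mild solutions\<close>

text \<open>Continuity of the indefinite integral, in the local form that Bolzano's bisection
  argument asks for: all short intervals around a given point carry little mass of
  \<open>g\<close>.\<close>

lemma indefinite_integral_small_increment:
  fixes g :: "real \<Rightarrow> real"
  assumes g: "g integrable_on {0..1}" and g0: "\<And>r. r \<in> {0..1} \<Longrightarrow> 0 \<le> g r" and e: "0 < e"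
    and x: "x \<in> {0..1}"
  shows "\<exists>d>0. \<forall>a b. 0 \<le> a \<and> a \<le> x \<and> x \<le> b \<and> b \<le> 1 \<and> b - a < d \<longrightarrow> integral {a..b} g \<le> e"
proof -
  have "continuous_on {0..1} (\<lambda>s. integral {0..s} g)" by (rule indefinite_integral_continuous_1[OF g])
  then obtain d where d: "d > 0"
    "\<And>y. \<lbrakk>y \<in> {0..1}; dist y x < d\<rbrakk> \<Longrightarrow> dist (integral {0..y} g) (integral {0..x} g) < e / 2"
    using x e unfolding continuous_on_iff by (metis half_gt_zero)
  have "integral {a..b} g \<le> e" if ab: "0 \<le> a" "a \<le> x" "x \<le> b" "b \<le> 1" "b - a < d" for a b
  proof -
    have "integral {0..a} g + integral {a..b} g = integral {0..b} g"
      by (rule Henstock_Kurzweil_Integration.integral_combine)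
        (use ab in \<open>auto intro: integrable_on_subinterval[OF g]\<close>)
    moreover have "dist (integral {0..a} g) (integral {0..x} g) < e / 2"
      "dist (integral {0..b} g) (integral {0..x} g) < e / 2"
      by (rule d; use ab in \<open>simp add: dist_real_def\<close>)+
    ultimately show ?thesis unfolding dist_real_def by linarith
  qed
  then show ?thesis using d(1) by blast
qed

lemma integral_mult_le_bound:
  fixes g u :: "real \<Rightarrow> real"
  assumes g: "g integrable_on {a..b}" and g0: "\<And>r. r \<in> {a..b} \<Longrightarrow> 0 \<le> g r"
    and u: "continuous_on {a..b} u" and uM: "\<And>r. r \<in> {a..b} \<Longrightarrow> u r \<le> M"
  shows "integral {a..b} (\<lambda>r. g r * u r) \<le> M * integral {a..b} g"
proof -
  have "integral {a..b} (\<lambda>r. g r * u r) \<le> integral {a..b} (\<lambda>r. M * g r)"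
  proof (rule integral_le)
    show "(\<lambda>r. g r * u r) integrable_on {a..b}"
      using integrable_scaleR_continuous[OF g g0 u] by simp
    show "(\<lambda>r. M * g r) integrable_on {a..b}" by (rule integrable_on_mult_right[OF g])
    show "g r * u r \<le> M * g r" if "r \<in> {a..b}" for r
      using mult_right_mono[OF uM[OF that] g0[OF that]] by (simp add: mult.commute)
  qed
  then show ?thesis by simp
qed

text \<open>The constant depends on \<open>g\<close> only, which makes the later estimates uniform in \<open>\<tau>\<close>. Splitting the interval
  avoids the chain rule for \<open>exp (\<integral> g)\<close> with merely integrable \<open>g\<close>.\<close>

lemma Gronwall_constant:
  fixes g :: "real \<Rightarrow> real"
  assumes g: "g integrable_on {0..1}" and g0: "\<And>r. r \<in> {0..1} \<Longrightarrow> 0 \<le> g r"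
  shows "\<exists>C\<ge>0. \<forall>u c. continuous_on {0..1} u \<longrightarrow>
      (\<forall>s\<in>{0..1}. 0 \<le> u s \<and> u s \<le> c + integral {0..s} (\<lambda>r. g r * u r)) \<longrightarrow> (\<forall>s\<in>{0..1}. u s \<le> C * c)"
proof -
  \<comment> \<open>The inequality in \<open>P a b\<close> is based at \<open>a\<close> rather than
    at \<open>0\<close>, so that the estimates on adjacent intervals can be joined.\<close>
  define P where "P a b \<longleftrightarrow> (0 \<le> a \<longrightarrow> b \<le> 1 \<longrightarrow> (\<exists>C\<ge>0. \<forall>u c. continuous_on {0..1} u \<longrightarrow>
      (\<forall>s\<in>{a..b}. 0 \<le> u s \<and> u s \<le> c + integral {a..s} (\<lambda>r. g r * u r)) \<longrightarrow>
      (\<forall>s\<in>{a..b}. u s \<le> C * c)))" for a b :: real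
  have gi: "g integrable_on {a..b}" if "0 \<le> a" "b \<le> 1" for a b
    by (rule integrable_on_subinterval[OF g]) (use that in auto)
  have gn: "0 \<le> integral {a..b} g" if "0 \<le> a" "b \<le> 1" for a b
    by (rule integral_nonneg[OF gi[OF that]]) (use that g0 in auto)
  have "P 0 1"
  proof (rule Bolzano[of 0 1 P])
    fix a b c :: real assume trans: "P a b" "P b c" "a \<le> b" "b \<le> c"
    show "P a c" unfolding P_def
    proof (intro impI)
      assume ac: "0 \<le> a" "c \<le> 1"
      obtain C1 where C1: "C1 \<ge> 0" "\<And>u k s. \<lbrakk>continuous_on {0..1} u;
          \<And>s. s \<in> {a..b} \<Longrightarrow> 0 \<le> u s \<and> u s \<le> k + integral {a..s} (\<lambda>r. g r * u r); s \<in> {a..b}\<rbrakk> \<Longrightarrow> u s \<le> C1 * k"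
        using trans(1,4) ac unfolding P_def by (smt (verit, best))
      obtain C2 where C2: "C2 \<ge> 0" "\<And>u k s. \<lbrakk>continuous_on {0..1} u;
          \<And>s. s \<in> {b..c} \<Longrightarrow> 0 \<le> u s \<and> u s \<le> k + integral {b..s} (\<lambda>r. g r * u r); s \<in> {b..c}\<rbrakk> \<Longrightarrow> u s \<le> C2 * k"
        using trans(2,3) ac unfolding P_def by (smt (verit, best))
      define I where "I = integral {a..b} g"
      have I0: "0 \<le> I" unfolding I_def using gn ac trans by simp
      \<comment> \<open>On \<open>{b..c}\<close> the estimate restarts with
        \<open>k + C1 * k * I\<close> in place of \<open>k\<close>, because the integral over
        \<open>{a..b}\<close> contributes at most \<open>C1 * k * I\<close>. The sum of both
        constants serves on either side of \<open>b\<close>.\<close>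
      let ?C = "C1 + C2 * (1 + C1 * I)"
      show "\<exists>C\<ge>0. \<forall>u k. continuous_on {0..1} u \<longrightarrow>
        (\<forall>s\<in>{a..c}. 0 \<le> u s \<and> u s \<le> k + integral {a..s} (\<lambda>r. g r * u r)) \<longrightarrow> (\<forall>s\<in>{a..c}. u s \<le> C * k)"
      proof (intro exI[of _ ?C] conjI allI impI ballI)
        show "?C \<ge> 0" using C1(1) C2(1) I0 by simp
        fix u k s assume u: "continuous_on {0..1} u"
          and le: "\<forall>s\<in>{a..c}. 0 \<le> u s \<and> u s \<le> k + integral {a..s} (\<lambda>r. g r * u r)" and s: "s \<in> {a..c}"
        have k0: "0 \<le> k" using le trans by (force dest: bspec[of _ _ a])
        have 1: "u r \<le> C1 * k" if "r \<in> {a..b}" for r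
          by (rule C1(2)[OF u _ that]) (use le trans in auto)
        have uc: "continuous_on {p..q} u" if "0 \<le> p" "q \<le> 1" for p q
          by (rule continuous_on_subset[OF u]) (use that in auto)
        have gu: "(\<lambda>r. g r * u r) integrable_on {p..q}" if "0 \<le> p" "q \<le> 1" for p q
          using integrable_scaleR_continuous[OF gi[OF that] _ uc[OF that]] g0 that by simp
        have J: "integral {a..b} (\<lambda>r. g r * u r) \<le> C1 * k * I"
          unfolding I_def by (rule integral_mult_le_bound) (use 1 g0 ac trans in \<open>auto intro: gi uc\<close>)
        have 2: "u r \<le> C2 * (k + C1 * k * I)" if "r \<in> {b..c}" for r
        proof (rule C2(2)[OF u _ that])
          fix s assume s: "s \<in> {b..c}"
          have "integral {a..b} (\<lambda>r. g r * u r) + integral {b..s} (\<lambda>r. g r * u r) = integral {a..s} (\<lambda>r. g r * u r)"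
            by (rule Henstock_Kurzweil_Integration.integral_combine) (use s ac trans in \<open>auto intro: gu\<close>)
          moreover have "0 \<le> u s \<and> u s \<le> k + integral {a..s} (\<lambda>r. g r * u r)" using le s trans by auto
          ultimately show "0 \<le> u s \<and> u s \<le> k + C1 * k * I + integral {b..s} (\<lambda>r. g r * u r)" using J by simp
        qed
        have p: "0 \<le> C1 * k" "0 \<le> C2 * (1 + C1 * I) * k" using C1(1) C2(1) I0 k0 by auto
        show "u s \<le> ?C * k"
        proof (cases "s \<le> b")
          case True then show ?thesis using 1[of s] s p by (simp add: distrib_right)
        next
          case False then show ?thesis using 2[of s] s p by (simp add: algebra_simps)
        qed
      qed
    qed
  next
    fix x :: real assume local: "0 \<le> x" "x \<le> 1"
    obtain d where d: "d > 0" "\<And>a b. \<lbrakk>0 \<le> a; a \<le> x; x \<le> b; b \<le> 1; b - a < d\<rbrakk> \<Longrightarrow> integral {a..b} g \<le> 1/2"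
      using indefinite_integral_small_increment[OF g g0, of "1/2" x] local by auto
    show "\<exists>d>0. \<forall>a b. a \<le> x \<and> x \<le> b \<and> b - a < d \<longrightarrow> P a b"
    proof (intro exI[of _ d] conjI allI impI)
      fix a b assume ab: "a \<le> x \<and> x \<le> b \<and> b - a < d"
      show "P a b" unfolding P_def
      proof (intro impI exI[of _ 2] conjI allI ballI)
        assume ab1: "0 \<le> a" "b \<le> 1"
        fix u c s assume u: "continuous_on {0..1} u"
          and le: "\<forall>s\<in>{a..b}. 0 \<le> u s \<and> u s \<le> c + integral {a..s} (\<lambda>r. g r * u r)" and s: "s \<in> {a..b}"
        have uc: "continuous_on {p..q} u" if "0 \<le> p" "q \<le> 1" for p q
          by (rule continuous_on_subset[OF u]) (use that in auto)
        \<comment> \<open>The interval carries mass at most \<open>1/2\<close>, so the maximum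
          absorbs half of itself: \<open>u m \<le> c + u m / 2\<close>. This is the origin of the
          constant 2.\<close>
        obtain m where m: "m \<in> {a..b}" "\<And>r. r \<in> {a..b} \<Longrightarrow> u r \<le> u m"
          using continuous_attains_sup[of "{a..b}" u] uc ab ab1 by auto
        have "integral {a..m} (\<lambda>r. g r * u r) \<le> u m * integral {a..m} g"
          by (rule integral_mult_le_bound) (use m g0 ab1 in \<open>auto intro: gi uc\<close>)
        also have "\<dots> \<le> u m * (1/2)"
        proof (rule mult_left_mono)
          have "integral {a..m} g \<le> integral {a..b} g"
            by (rule integral_subset_le) (use m g0 ab1 in \<open>auto intro: gi\<close>)
          also have "\<dots> \<le> 1/2" using d ab ab1 by simp
          finally show "integral {a..m} g \<le> 1/2" .
        qed (use le m in auto)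
        finally have "u m \<le> 2 * c" using le m(1) by fastforce
        then show "u s \<le> 2 * c" using m(2)[OF s] by simp
      qed simp
    qed (fact d(1))
  qed simp
  then show ?thesis unfolding P_def by simp
qed

text \<open>The Cauchy criterion for Riemann sums suffices: on fine tagged divisions the sums of
  \<open>f\<close> and \<open>h\<close> differ by at most \<open>e\<close> times a Riemann sum of
  \<open>g\<close>, and the latter stays bounded. No measurability of the vector-valued
  \<open>f\<close> has to be discussed.\<close>

lemma integrable_dominated_approximation:
  fixes f :: "real \<Rightarrow> 'b::banach" and g :: "real \<Rightarrow> real"
  assumes g: "g integrable_on {a..b}"
    and approx: "\<And>e. 0 < e \<Longrightarrow> \<exists>h. h integrable_on {a..b} \<and> (\<forall>r\<in>{a..b}. norm (f r - h r) \<le> e * g r)"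
  shows "f integrable_on {a..b}"
proof -
  have "\<exists>\<gamma>. gauge \<gamma> \<and> (\<forall>\<D>1 \<D>2. \<D>1 tagged_division_of {a..b} \<and> \<gamma> fine \<D>1 \<and>
            \<D>2 tagged_division_of {a..b} \<and> \<gamma> fine \<D>2 \<longrightarrow>
            norm ((\<Sum>(x,K)\<in>\<D>1. measure lborel K *\<^sub>R f x) - (\<Sum>(x,K)\<in>\<D>2. measure lborel K *\<^sub>R f x)) < \<epsilon>)"
    if eps: "\<epsilon> > 0" for \<epsilon>
  proof -
    \<comment> \<open>This bounds every Riemann sum of \<open>g\<close> that lies within 1 of the
      integral, as \<open>\<gamma>2\<close> will ensure.\<close>
    define I where "I = \<bar>integral {a..b} g\<bar> + 1"
    define e where "e = \<epsilon> / (4 * I)"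
    have I: "I > 0" by (simp add: I_def)
    then have e: "e > 0" using eps by (simp add: e_def)
    obtain h where h: "h integrable_on {a..b}" "\<And>r. r \<in> {a..b} \<Longrightarrow> norm (f r - h r) \<le> e * g r"
      using approx[OF e] by blast
    obtain \<gamma>1 where \<gamma>1: "gauge \<gamma>1" "\<And>\<D>. \<lbrakk>\<D> tagged_division_of {a..b}; \<gamma>1 fine \<D>\<rbrakk> \<Longrightarrow>
        norm ((\<Sum>(x,K)\<in>\<D>. measure lborel K *\<^sub>R h x) - integral {a..b} h) < \<epsilon> / 4"
      using integrable_integral[OF h(1)] eps has_integral[of h _ a b] unfolding box_real
      by (metis divide_pos_pos zero_less_numeral)
    obtain \<gamma>2 where \<gamma>2: "gauge \<gamma>2" "\<And>\<D>. \<lbrakk>\<D> tagged_division_of {a..b}; \<gamma>2 fine \<D>\<rbrakk> \<Longrightarrow>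
        norm ((\<Sum>(x,K)\<in>\<D>. measure lborel K *\<^sub>R g x) - integral {a..b} g) < 1"
      using integrable_integral[OF g] has_integral[of g _ a b] unfolding box_real
      by (metis zero_less_one)
    have near: "norm ((\<Sum>(x,K)\<in>\<D>. measure lborel K *\<^sub>R f x) - integral {a..b} h) < \<epsilon> / 2"
      if \<D>: "\<D> tagged_division_of {a..b}" "\<gamma>1 fine \<D>" "\<gamma>2 fine \<D>" for \<D>
    proof -
      have "norm ((\<Sum>(x,K)\<in>\<D>. measure lborel K *\<^sub>R f x) - (\<Sum>(x,K)\<in>\<D>. measure lborel K *\<^sub>R h x))
          = norm (\<Sum>(x,K)\<in>\<D>. measure lborel K *\<^sub>R (f x - h x))"
        by (simp add: sum_subtractf scaleR_diff_right case_prod_unfold)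
      also have "\<dots> \<le> (\<Sum>(x,K)\<in>\<D>. e * (measure lborel K *\<^sub>R g x))"
      proof (rule sum_norm_le)
        fix z assume z: "z \<in> \<D>"
        obtain x K where [simp]: "z = (x, K)" by force
        have "x \<in> {a..b}" using tagged_division_ofD(2,3)[OF \<D>(1), of x K] z by auto
        then have "measure lborel K * norm (f x - h x) \<le> measure lborel K * (e * g x)"
          by (intro mult_left_mono h(2)) auto
        then show "norm (case z of (x, K) \<Rightarrow> measure lborel K *\<^sub>R (f x - h x)) \<le> (case z of (x, K) \<Rightarrow> e * (measure lborel K *\<^sub>R g x))"
          by (simp add: mult_ac)
      qed
      also have "\<dots> = e * (\<Sum>(x,K)\<in>\<D>. measure lborel K *\<^sub>R g x)"
        by (simp add: sum_distrib_left case_prod_unfold)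
      also have "\<dots> \<le> e * I"
        using \<gamma>2(2)[OF \<D>(1,3)] e unfolding I_def real_norm_def by (intro mult_left_mono) linarith+
      also have "\<dots> = \<epsilon> / 4" using I by (simp add: e_def)
      finally show ?thesis
        using \<gamma>1(2)[OF \<D>(1,2)] norm_triangle_ineq[of "(\<Sum>(x,K)\<in>\<D>. measure lborel K *\<^sub>R f x) - (\<Sum>(x,K)\<in>\<D>. measure lborel K *\<^sub>R h x)"
            "(\<Sum>(x,K)\<in>\<D>. measure lborel K *\<^sub>R h x) - integral {a..b} h"] by simp
    qed
    show ?thesis
    proof (intro exI[of _ "\<lambda>x. \<gamma>1 x \<inter> \<gamma>2 x"] conjI allI impI)
      show "gauge (\<lambda>x. \<gamma>1 x \<inter> \<gamma>2 x)" using \<gamma>1(1) \<gamma>2(1) by (rule gauge_Int)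
      fix \<D>1 \<D>2 assume *: "\<D>1 tagged_division_of {a..b} \<and> (\<lambda>x. \<gamma>1 x \<inter> \<gamma>2 x) fine \<D>1 \<and>
            \<D>2 tagged_division_of {a..b} \<and> (\<lambda>x. \<gamma>1 x \<inter> \<gamma>2 x) fine \<D>2"
      show "norm ((\<Sum>(x,K)\<in>\<D>1. measure lborel K *\<^sub>R f x) - (\<Sum>(x,K)\<in>\<D>2. measure lborel K *\<^sub>R f x)) < \<epsilon>"
        using near[of \<D>1] near[of \<D>2] *
          norm_triangle_ineq4[of "(\<Sum>(x,K)\<in>\<D>1. measure lborel K *\<^sub>R f x) - integral {a..b} h"
            "(\<Sum>(x,K)\<in>\<D>2. measure lborel K *\<^sub>R f x) - integral {a..b} h"]
        by (simp add: fine_Int)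
    qed
  qed
  then show ?thesis using integrable_Cauchy[of f a b] by simp
qed

text \<open>The integrated form of \<open>i x' = B x\<close>. The initial value is left free as
  \<open>x 0\<close>, so that for linear \<open>B\<close> sums and multiples of solutions are again
  solutions.\<close>

definition mild_solution :: "(real \<Rightarrow> 'a::chilbert \<Rightarrow> 'a) \<Rightarrow> (real \<Rightarrow> 'a) \<Rightarrow> bool" where
  "mild_solution B x \<longleftrightarrow> continuous_on {0..1} x \<and> (\<lambda>r. B r (x r)) integrable_on {0..1} \<and>
     (\<forall>s\<in>{0..1}. x s = x 0 - scaleC \<i> (integral {0..s} (\<lambda>r. B r (x r))))"

lemma mild_solutionD:
  assumes "mild_solution B x"
  shows "continuous_on {0..1} x" "(\<lambda>r. B r (x r)) integrable_on {0..1}"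
    "s \<in> {0..1} \<Longrightarrow> x s = x 0 - scaleC \<i> (integral {0..s} (\<lambda>r. B r (x r)))"
  using assms unfolding mild_solution_def by blast+

text \<open>The majorant \<open>g\<close> is a separate parameter because the families for different
  \<open>\<tau>\<close> share one \<open>g\<close>, and constants obtained from \<open>g\<close> are
  then common to all of them.\<close>

definition dominated_family :: "(real \<Rightarrow> 'a::chilbert \<Rightarrow> 'a) \<Rightarrow> (real \<Rightarrow> real) \<Rightarrow> bool" where
  "dominated_family B g \<longleftrightarrow> g integrable_on {0..1} \<and>
     (\<forall>r\<in>{0..1}. 0 \<le> g r \<and> clinear_on UNIV (B r) \<and> (\<forall>x. norm (B r x) \<le> g r * norm x))"

lemma dominated_familyD:
  assumes "dominated_family B g"
  shows "g integrable_on {0..1}" "\<And>r. r \<in> {0..1} \<Longrightarrow> 0 \<le> g r"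
    "\<And>r x. r \<in> {0..1} \<Longrightarrow> norm (B r x) \<le> g r * norm x"
    "\<And>r x y. r \<in> {0..1} \<Longrightarrow> B r (x + y) = B r x + B r y"
    "\<And>r c x. r \<in> {0..1} \<Longrightarrow> B r (scaleC c x) = scaleC c (B r x)"
    "\<And>r x y. r \<in> {0..1} \<Longrightarrow> B r (x - y) = B r x - B r y"
proof -
  show add: "\<And>r x y. r \<in> {0..1} \<Longrightarrow> B r (x + y) = B r x + B r y"
    using assms by (simp add: dominated_family_def clinear_on_def)
  show "B r (x - y) = B r x - B r y" if "r \<in> {0..1}" for r x y
    using add[OF that, of "x - y" y] by simp
qed (use assms in \<open>auto simp: dominated_family_def clinear_on_def\<close>)

section \<open>Linear structure and growth of mild solutions\<close>

lemma mild_solution_add: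
  assumes B: "dominated_family B g" and x: "mild_solution B x" and y: "mild_solution B y"
  shows "mild_solution B (\<lambda>s. x s + y s)"
proof -
  note xi = mild_solutionD[OF x] and yi = mild_solutionD[OF y]
  have sub: "h integrable_on {0..s}" if "h integrable_on {0..1}" "s \<in> {0..1}" for h :: "real \<Rightarrow> 'a" and s :: real
    by (rule integrable_on_subinterval[OF that(1)]) (use that in auto)
  have eq: "B r (x r + y r) = B r (x r) + B r (y r)" if "r \<in> {0..1}" for r
    using dominated_familyD(4)[OF B that] .
  have int: "integral {0..s} (\<lambda>r. B r (x r + y r)) = integral {0..s} (\<lambda>r. B r (x r)) + integral {0..s} (\<lambda>r. B r (y r))"
    if s: "s \<in> {0..1}" for s
  proof -
    have "integral {0..s} (\<lambda>r. B r (x r + y r)) = integral {0..s} (\<lambda>r. B r (x r) + B r (y r))"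
      by (rule Henstock_Kurzweil_Integration.integral_cong) (use eq s in auto)
    then show ?thesis
      using Henstock_Kurzweil_Integration.integral_add[OF sub[OF xi(2) s] sub[OF yi(2) s]] by simp
  qed
  show ?thesis unfolding mild_solution_def
  proof (intro conjI ballI)
    show "continuous_on {0..1} (\<lambda>s. x s + y s)" by (intro continuous_on_add xi(1) yi(1))
    have "(\<lambda>r. B r (x r) + B r (y r)) integrable_on {0..1}" by (intro integrable_add xi(2) yi(2))
    then show "(\<lambda>r. B r (x r + y r)) integrable_on {0..1}"
      by (rule integrable_eq) (use eq in auto)
    fix s :: real assume s: "s \<in> {0..1}"
    show "x s + y s = x 0 + y 0 - scaleC \<i> (integral {0..s} (\<lambda>r. B r (x r + y r)))"
      unfolding int[OF s] scaleC_add_right by (subst xi(3)[OF s], subst yi(3)[OF s]) simp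
  qed
qed

lemma mild_solution_scaleC:
  assumes B: "dominated_family B g" and x: "mild_solution B x"
  shows "mild_solution B (\<lambda>s. scaleC c (x s))"
proof -
  note xi = mild_solutionD[OF x] and lin = bounded_linear_scaleC_right[of c]
  have eq: "B r (scaleC c (x r)) = scaleC c (B r (x r))" if "r \<in> {0..1}" for r
    using dominated_familyD(5)[OF B that] .
  have int: "integral {0..s} (\<lambda>r. B r (scaleC c (x r))) = scaleC c (integral {0..s} (\<lambda>r. B r (x r)))"
    if s: "s \<in> {0..1}" for s
  proof -
    have i: "(\<lambda>r. B r (x r)) integrable_on {0..s}"
      by (rule integrable_on_subinterval[OF xi(2)]) (use s in auto)
    have "integral {0..s} (\<lambda>r. B r (scaleC c (x r))) = integral {0..s} (\<lambda>r. scaleC c (B r (x r)))"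
      by (rule Henstock_Kurzweil_Integration.integral_cong) (use eq s in auto)
    then show ?thesis using integral_linear[OF i lin] by (simp add: o_def)
  qed
  show ?thesis unfolding mild_solution_def
  proof (intro conjI ballI)
    show "continuous_on {0..1} (\<lambda>s. scaleC c (x s))" by (intro continuous_on_scaleC continuous_on_const xi(1))
    have "(\<lambda>r. scaleC c (B r (x r))) integrable_on {0..1}"
      using integrable_linear[OF xi(2) lin] by (simp add: o_def)
    then show "(\<lambda>r. B r (scaleC c (x r))) integrable_on {0..1}"
      by (rule integrable_eq) (use eq in auto)
    fix s :: real assume s: "s \<in> {0..1}"
    show "scaleC c (x s) = scaleC c (x 0) - scaleC \<i> (integral {0..s} (\<lambda>r. B r (scaleC c (x r))))"
      unfolding int[OF s] by (subst xi(3)[OF s]) (simp add: scaleC_diff_right scaleC_scaleC mult.commute)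
  qed
qed

lemma mild_solution_increment:
  assumes x: "mild_solution B x" and ab: "0 \<le> a" "a \<le> b" "b \<le> 1"
  shows "x b - x a = - scaleC \<i> (integral {a..b} (\<lambda>r. B r (x r)))"
proof -
  have comb: "integral {0..a} (\<lambda>r. B r (x r)) + integral {a..b} (\<lambda>r. B r (x r)) = integral {0..b} (\<lambda>r. B r (x r))"
    by (rule Henstock_Kurzweil_Integration.integral_combine)
      (use ab in \<open>auto intro: integrable_on_subinterval[OF mild_solutionD(2)[OF x]]\<close>)
  have "x a = x 0 - scaleC \<i> (integral {0..a} (\<lambda>r. B r (x r)))"
    "x b = x 0 - scaleC \<i> (integral {0..b} (\<lambda>r. B r (x r)))"
    by (rule mild_solutionD(3)[OF x]; use ab in simp)+
  then have "x b - x a = scaleC \<i> (integral {0..a} (\<lambda>r. B r (x r))) - scaleC \<i> (integral {0..b} (\<lambda>r. B r (x r)))"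
    by simp
  then show ?thesis unfolding comb[symmetric] scaleC_add_right by simp
qed

lemma mild_solution_norm_bound:
  assumes B: "dominated_family B g" and x: "mild_solution B x" and ab: "0 \<le> a" "a \<le> b" "b \<le> 1"
  shows "norm (x b - x a) \<le> integral {a..b} (\<lambda>r. g r * norm (x r))"
proof -
  have "norm (integral {a..b} (\<lambda>r. B r (x r))) \<le> integral {a..b} (\<lambda>r. g r * norm (x r))"
  proof (rule integral_norm_bound_integral)
    show "(\<lambda>r. B r (x r)) integrable_on {a..b}"
      by (rule integrable_on_subinterval[OF mild_solutionD(2)[OF x]]) (use ab in auto)
    have "(\<lambda>r. g r *\<^sub>R norm (x r)) integrable_on {a..b}"
    proof (rule integrable_scaleR_continuous)
      show "g integrable_on {a..b}"
        by (rule integrable_on_subinterval[OF dominated_familyD(1)[OF B]]) (use ab in auto)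
      show "0 \<le> g r" if "r \<in> {a..b}" for r using dominated_familyD(2)[OF B] that ab by auto
      show "continuous_on {a..b} (\<lambda>r. norm (x r))"
        by (rule continuous_on_subset[OF continuous_on_norm[OF mild_solutionD(1)[OF x]]]) (use ab in auto)
    qed
    then show "(\<lambda>r. g r * norm (x r)) integrable_on {a..b}" by simp
    show "norm (B r (x r)) \<le> g r * norm (x r)" if "r \<in> {a..b}" for r
      using dominated_familyD(3)[OF B] that ab by auto
  qed
  then show ?thesis
    unfolding mild_solution_increment[OF x ab] by (simp add: norm_scaleC)
qed

text \<open>If \<open>m\<close> is the point of largest norm, the solution moves by at most
  \<open>norm (x m) / 4\<close>. Hence \<open>norm (x m) \<le> 4/3 * norm (x a)\<close>, and the
  displacement is at most a third of \<open>norm (x a)\<close>.\<close>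

lemma mild_solution_short_time:
  assumes B: "dominated_family B g" and x: "mild_solution B x" and ab: "0 \<le> a" "a \<le> b" "b \<le> 1"
    and small: "integral {a..b} g \<le> 1/4"
  shows "norm (x b - x a) \<le> norm (x a) / 3"
proof -
  have c: "continuous_on {a..b} (\<lambda>r. norm (x r))"
    by (rule continuous_on_subset[OF continuous_on_norm[OF mild_solutionD(1)[OF x]]]) (use ab in auto)
  obtain m where m: "m \<in> {a..b}" "\<And>r. r \<in> {a..b} \<Longrightarrow> norm (x r) \<le> norm (x m)"
    using continuous_attains_sup[of "{a..b}" "\<lambda>r. norm (x r)"] c ab by auto
  have gi: "g integrable_on {a..s}" if "s \<le> b" for s
    by (rule integrable_on_subinterval[OF dominated_familyD(1)[OF B]]) (use ab that in auto)
  have g0: "0 \<le> g r" if "r \<in> {a..b}" for r using dominated_familyD(2)[OF B] that ab by auto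
  have bound: "norm (x s - x a) \<le> norm (x m) / 4" if s: "s \<in> {a..b}" for s
  proof -
    have "norm (x s - x a) \<le> integral {a..s} (\<lambda>r. g r * norm (x r))"
      by (rule mild_solution_norm_bound[OF B x]) (use ab s in auto)
    also have "\<dots> \<le> norm (x m) * integral {a..s} g"
      by (rule integral_mult_le_bound) (use s g0 m gi in \<open>auto intro: continuous_on_subset[OF c]\<close>)
    also have "\<dots> \<le> norm (x m) * (1/4)"
    proof (rule mult_left_mono)
      have "integral {a..s} g \<le> integral {a..b} g"
        by (rule integral_subset_le) (use s g0 gi in auto)
      then show "integral {a..s} g \<le> 1/4" using small by simp
    qed simp
    finally show ?thesis by simp
  qed
  have "norm (x m) \<le> norm (x a) + norm (x m) / 4"
    using bound[OF m(1)] norm_triangle_sub[of "x m" "x a"] by linarith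
  then show ?thesis using bound[of b] ab by simp
qed

text \<open>Approximating the remainder \<open>\<phi> - x\<close> once more halves the error, and
  additivity keeps the corrected vector in \<open>S\<close>. Relative accuracy one half thus
  improves to arbitrary accuracy.\<close>

lemma approximable_iterate:
  fixes S :: "'a::real_normed_vector set"
  assumes add: "\<And>x y. x \<in> S \<Longrightarrow> y \<in> S \<Longrightarrow> x + y \<in> S"
    and half: "\<And>\<phi>. \<exists>x\<in>S. norm (x - \<phi>) \<le> norm \<phi> / 2" and e: "0 < e"
  shows "\<exists>x\<in>S. norm (x - \<phi>) < e"
proof -
  have pow: "\<exists>x\<in>S. norm (x - \<phi>) \<le> norm \<phi> / 2 ^ Suc n" for n
  proof (induction n)
    case 0 then show ?case using half[of \<phi>] by simp
  next
    case (Suc n)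
    then obtain x where x: "x \<in> S" "norm (x - \<phi>) \<le> norm \<phi> / 2 ^ Suc n" by blast
    obtain y where y: "y \<in> S" "norm (y - (\<phi> - x)) \<le> norm (\<phi> - x) / 2" using half by blast
    have "norm (x + y - \<phi>) \<le> norm \<phi> / 2 ^ Suc (Suc n)"
      using x(2) y(2) by (simp add: norm_minus_commute algebra_simps)
    then show ?case using add[OF x(1) y(1)] by blast
  qed
  obtain n where "norm \<phi> / e < 2 ^ n" using real_arch_pow[of 2 "norm \<phi> / e"] by auto
  also have "(2::real) ^ n \<le> 2 ^ Suc n" by simp
  finally have "norm \<phi> / 2 ^ Suc n < e" using e by (simp add: field_simps)
  then show ?thesis using pow[of n] by (meson le_less_trans)
qed

text \<open>Density of the values is propagated forward in time. Over a short interval a solution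
  that starts near \<open>\<phi>\<close> still ends within half the norm of \<open>\<phi>\<close>,
  and the iteration above removes the remaining error. In this way no inverse of the evolution
  enters.\<close>

lemma mild_solutions_dense:
  assumes B: "dominated_family B g" and ex: "\<And>\<psi>. \<exists>x. mild_solution B x \<and> x 0 = \<psi>"
    and s: "s \<in> {0..1}" and e: "0 < e"
  shows "\<exists>x. mild_solution B x \<and> norm (x s - \<phi>) < e"
proof -
  define dn where "dn s \<longleftrightarrow> (\<forall>\<phi> e. 0 < e \<longrightarrow> (\<exists>x. mild_solution B x \<and> norm (x s - \<phi>) < e))" for s
  define P where "P a b \<longleftrightarrow> (0 \<le> a \<longrightarrow> b \<le> 1 \<longrightarrow> dn a \<longrightarrow> dn b)" for a b
  have "P 0 s"
  proof (rule Bolzano[of 0 s P])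
    fix a b c :: real assume "P a b" "P b c" "a \<le> b" "b \<le> c"
    then show "P a c" unfolding P_def by auto
  next
    fix x :: real assume x: "0 \<le> x" "x \<le> s"
    obtain d where d: "d > 0" "\<And>a b. \<lbrakk>0 \<le> a; a \<le> x; x \<le> b; b \<le> 1; b - a < d\<rbrakk> \<Longrightarrow> integral {a..b} g \<le> 1/4"
      using indefinite_integral_small_increment[OF dominated_familyD(1,2)[OF B], of "1/4" x] x s by auto
    have "P a b" if ab: "a \<le> x" "x \<le> b" "b - a < d" for a b
      unfolding P_def
    proof (intro impI)
      assume a0: "0 \<le> a" and b1: "b \<le> 1" and dn: "dn a"
      have small: "integral {a..b} g \<le> 1/4" using d ab a0 b1 by simp
      have half: "\<exists>x\<in>{x b |x. mild_solution B x}. norm (x - \<phi>) \<le> norm \<phi> / 2" for \<phi>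
      proof (cases "\<phi> = 0")
        case True
        \<comment> \<open>For \<open>\<phi> = 0\<close> the required bound is zero, so an
          approximate choice will not do; the zero multiple of some solution is used.\<close>
        obtain y where y: "mild_solution B y" using ex by blast
        have "scaleC 0 (y b) \<in> {x b |x. mild_solution B x}"
          using mild_solution_scaleC[OF B y, of 0]
          by (intro CollectI exI[of _ "\<lambda>s. scaleC 0 (y s)"]) simp
        then show ?thesis using True by (intro bexI[of _ "scaleC 0 (y b)"]) auto
      next
        case False
        \<comment> \<open>The fraction \<open>1/8\<close> is chosen so that
          \<open>(1 + 1/8) / 3 + 1/8 = 1/2\<close>.\<close>
        then obtain y where y: "mild_solution B y" "norm (y a - \<phi>) < norm \<phi> / 8"
          using dn unfolding dn_def by (metis divide_pos_pos zero_less_norm_iff zero_less_numeral)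
        have "norm (y b - y a) \<le> norm (y a) / 3"
          by (rule mild_solution_short_time[OF B y(1) a0 _ b1 small]) (use ab in simp)
        moreover have "norm (y a) \<le> norm \<phi> + norm (y a - \<phi>)" by (rule norm_triangle_sub)
        moreover have "norm (y b - \<phi>) \<le> norm (y b - y a) + norm (y a - \<phi>)"
          using norm_triangle_ineq[of "y b - y a" "y a - \<phi>"] by simp
        ultimately have "norm (y b - \<phi>) \<le> norm \<phi> / 2" using y(2) by linarith
        then show ?thesis using y(1) by blast
      qed
      show "dn b" unfolding dn_def
      proof (intro allI impI)
        fix \<phi> and e :: real assume e: "0 < e"
        have "\<exists>x\<in>{x b |x. mild_solution B x}. norm (x - \<phi>) < e"
        proof (rule approximable_iterate[OF _ half e])
          fix u v assume "u \<in> {x b |x. mild_solution B x}" "v \<in> {x b |x. mild_solution B x}"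
          then obtain x y where "u = x b" "v = y b" "mild_solution B x" "mild_solution B y" by blast
          then show "u + v \<in> {x b |x. mild_solution B x}"
            using mild_solution_add[OF B]
            by (intro CollectI exI[of _ "\<lambda>s. x s + y s"]) simp
        qed
        then show "\<exists>x. mild_solution B x \<and> norm (x b - \<phi>) < e" by blast
      qed
    qed
    then show "\<exists>d>0. \<forall>a b. a \<le> x \<and> x \<le> b \<and> b - a < d \<longrightarrow> P a b" using d(1) by blast
  qed (use s in simp)
  moreover have "dn 0" unfolding dn_def using ex by (metis diff_self norm_zero)
  ultimately show ?thesis using s e unfolding P_def dn_def by auto
qed

text \<open>Near a time \<open>t\<close> the curve \<open>y\<close> stays within \<open>e\<close> of
  one solution \<open>x\<close> with \<open>x t\<close> close to \<open>y t\<close>, and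
  \<open>B r (x r)\<close> is integrable by definition. Gluing such local choices gives an
  integrable function within \<open>e * g\<close> of the integrand, for every
  \<open>e\<close>.\<close>

lemma dominated_family_integrable:
  assumes B: "dominated_family B g" and ex: "\<And>\<psi>. \<exists>x. mild_solution B x \<and> x 0 = \<psi>"
    and y: "continuous_on {0..1} y"
  shows "(\<lambda>r. B r (y r)) integrable_on {0..1}"
proof (rule integrable_dominated_approximation[OF dominated_familyD(1)[OF B]])
  fix e :: real assume e: "0 < e"
  define P where "P a b \<longleftrightarrow> (0 \<le> a \<longrightarrow> a \<le> b \<longrightarrow> b \<le> 1 \<longrightarrow>
      (\<exists>h. h integrable_on {a..b} \<and> (\<forall>r\<in>{a..b}. norm (B r (y r) - h r) \<le> e * g r)))" for a b
  have "P 0 1"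
  proof (rule Bolzano[of 0 1 P])
    fix a b c :: real assume t: "P a b" "P b c" "a \<le> b" "b \<le> c"
    show "P a c" unfolding P_def
    proof (intro impI)
      assume ac: "0 \<le> a" "a \<le> c" "c \<le> 1"
      obtain h1 where h1: "h1 integrable_on {a..b}" "\<And>r. r \<in> {a..b} \<Longrightarrow> norm (B r (y r) - h1 r) \<le> e * g r"
        using t ac unfolding P_def by auto
      obtain h2 where h2: "h2 integrable_on {b..c}" "\<And>r. r \<in> {b..c} \<Longrightarrow> norm (B r (y r) - h2 r) \<le> e * g r"
        using t ac unfolding P_def by auto
      let ?h = "\<lambda>r. if r \<le> b then h1 r else h2 r"
      have "?h integrable_on {a..b}" by (rule integrable_eq[OF h1(1)]) auto
      \<comment> \<open>The glued function takes the value of \<open>h1\<close> at \<open>b\<close>;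
        this single point does not affect integrability on \<open>{b..c}\<close>.\<close>
      moreover have "?h integrable_on {b..c}"
        by (rule integrable_spike_finite[OF _ _ h2(1), of "{b}"]) auto
      ultimately have "?h integrable_on {a..c}" by (rule Henstock_Kurzweil_Integration.integrable_combine[OF t(3,4)])
      then show "\<exists>h. h integrable_on {a..c} \<and> (\<forall>r\<in>{a..c}. norm (B r (y r) - h r) \<le> e * g r)"
        using h1(2) h2(2) by (intro exI[of _ ?h]) auto
    qed
  next
    fix t :: real assume t: "0 \<le> t" "t \<le> 1"
    obtain x where x: "mild_solution B x" "norm (x t - y t) < e"
      using mild_solutions_dense[OF B ex _ e, of t "y t"] t by auto
    have "continuous_on {0..1} (\<lambda>r. x r - y r)"
      by (intro continuous_on_diff mild_solutionD(1)[OF x(1)] y)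
    then obtain d where d: "d > 0"
      "\<And>r. \<lbrakk>r \<in> {0..1}; dist r t < d\<rbrakk> \<Longrightarrow> dist (x r - y r) (x t - y t) < e - norm (x t - y t)"
      using x(2) t unfolding continuous_on_iff by (metis atLeastAtMost_iff diff_gt_0_iff_gt)
    have near: "norm (y r - x r) \<le> e" if "r \<in> {0..1}" "dist r t < d" for r
      using d(2)[OF that] norm_triangle_sub[of "x r - y r" "x t - y t"]
      by (simp add: dist_norm norm_minus_commute)
    have "P a b" if ab: "a \<le> t" "t \<le> b" "b - a < d" for a b
      unfolding P_def
    proof (intro impI exI[of _ "\<lambda>r. B r (x r)"] conjI ballI)
      assume ab1: "0 \<le> a" "a \<le> b" "b \<le> 1"
      show "(\<lambda>r. B r (x r)) integrable_on {a..b}"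
        by (rule integrable_on_subinterval[OF mild_solutionD(2)[OF x(1)]]) (use ab1 in auto)
      fix r assume r: "r \<in> {a..b}"
      then have r1: "r \<in> {0..1}" using ab1 by auto
      have "norm (B r (y r) - B r (x r)) \<le> g r * norm (y r - x r)"
        using dominated_familyD(3)[OF B r1, of "y r - x r"] dominated_familyD(6)[OF B r1] by simp
      also have "\<dots> \<le> g r * e"
        using dominated_familyD(2)[OF B r1] near[OF r1] r ab by (intro mult_left_mono) (auto simp: dist_real_def)
      finally show "norm (B r (y r) - B r (x r)) \<le> e * g r" by (simp add: mult.commute)
    qed
    then show "\<exists>d>0. \<forall>a b. a \<le> t \<and> t \<le> b \<and> b - a < d \<longrightarrow> P a b" using d(1) by blast
  qed simp
  then show "\<exists>h. h integrable_on {0..1} \<and> (\<forall>r\<in>{0..1}. norm (B r (y r) - h r) \<le> e * g r)"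
    unfolding P_def by simp
qed

section \<open>Eigenspaces and spectral projections\<close>

lemma selfadjoint_symmetric:
  assumes "selfadjoint D H" "x \<in> D" "y \<in> D"
  shows "cinner (H x) y = cinner x (H y)"
  using assms unfolding selfadjoint_def by blast

lemma eigenspace_add:
  "selfadjoint D H \<Longrightarrow> u \<in> eigenspace D H E \<Longrightarrow> v \<in> eigenspace D H E \<Longrightarrow> u + v \<in> eigenspace D H E"
  by (simp add: selfadjoint_def csubspace_def clinear_on_def eigenspace_def scaleC_add_right)

lemma eigenspace_scaleC:
  "selfadjoint D H \<Longrightarrow> v \<in> eigenspace D H E \<Longrightarrow> scaleC c v \<in> eigenspace D H E"
  by (simp add: selfadjoint_def csubspace_def clinear_on_def eigenspace_def scaleC_scaleC mult.commute)

lemma eigenspace_zero: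
  assumes "selfadjoint D H"
  shows "0 \<in> eigenspace D H E"
proof -
  have D0: "0 \<in> D" and "\<And>c x. x \<in> D \<Longrightarrow> H (scaleC c x) = scaleC c (H x)"
    using assms unfolding selfadjoint_def csubspace_def clinear_on_def by blast+
  from this(2)[OF D0, of 0] D0 show ?thesis by (simp add: eigenspace_def)
qed

lemma eigenspace_diff:
  assumes "selfadjoint D H" "u \<in> eigenspace D H E" "v \<in> eigenspace D H E"
  shows "u - v \<in> eigenspace D H E"
  using eigenspace_add[OF assms(1,2) eigenspace_scaleC[OF assms(1,3), of "-1"]]
  by (simp add: scaleC_minus_left scaleC_one)

lemma eigenspace_sum:
  assumes "selfadjoint D H" "\<And>i. i \<in> F \<Longrightarrow> v i \<in> eigenspace D H E"
  shows "(\<Sum>i\<in>F. v i) \<in> eigenspace D H E"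
  using assms(2)
  by (induction F rule: infinite_finite_induct) (auto intro: eigenspace_zero eigenspace_add assms(1))

lemma eigenvalue_real:
  assumes "selfadjoint D H" "v \<in> eigenspace D H E" "v \<noteq> 0"
  shows "E = complex_of_real (Re E)"
proof -
  have "cinner (scaleC E v) v = cinner v (scaleC E v)"
    using selfadjoint_symmetric[OF assms(1), of v v] assms(2) by (simp add: eigenspace_def)
  then have "cnj E = E"
    using assms(3) by (simp add: cinner_scaleC_left cinner_scaleC_right cinner_norm)
  then show ?thesis by (metis Reals_cnj_iff complex_is_Real_iff of_real_Re)
qed

lemma eigenspace_orthogonal:
  assumes "selfadjoint D H" "u \<in> eigenspace D H E" "v \<in> eigenspace D H E'" "E \<noteq> E'"
  shows "cinner u v = 0"
proof (cases "u = 0")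
  case False
  have "cinner (scaleC E u) v = cinner u (scaleC E' v)"
    using selfadjoint_symmetric[OF assms(1), of u v] assms(2,3) by (simp add: eigenspace_def)
  moreover have "cnj E = E"
    by (subst (1 2) eigenvalue_real[OF assms(1,2) False]) simp
  ultimately show ?thesis using assms(4) by (simp add: cinner_scaleC_left cinner_scaleC_right)
qed simp

text \<open>\<open>H\<close> may be unbounded, so continuity is not at hand. The eigenvalue relation
  is instead passed to the limit inside \<open>cinner (H x)\<close> for \<open>x\<close> in
  \<open>D\<close>, and the adjoint characterisation of \<open>D\<close> shows that the limit is in
  the domain.\<close>

lemma closed_eigenspace:
  assumes sa: "selfadjoint D H"
  shows "closed (eigenspace D H E)"
  unfolding closed_sequential_limits
proof (intro allI impI, elim conjE)
  fix v and l assume v: "\<forall>n. v n \<in> eigenspace D H E" and lim: "v \<longlonglongrightarrow> l"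
  have "cinner (H x) l = cinner x (scaleC E l)" if x: "x \<in> D" for x
  proof (rule LIMSEQ_unique)
    show "(\<lambda>n. cinner (H x) (v n)) \<longlonglongrightarrow> cinner (H x) l"
      by (rule bounded_linear.tendsto[OF bounded_linear_cinner_right lim])
    have "(\<lambda>n. cinner x (scaleC E (v n))) \<longlonglongrightarrow> cinner x (scaleC E l)"
      by (intro bounded_linear.tendsto[OF bounded_linear_cinner_right]
          bounded_linear.tendsto[OF bounded_linear_scaleC_right] lim)
    moreover have "cinner x (scaleC E (v n)) = cinner (H x) (v n)" for n
      using selfadjoint_symmetric[OF sa x, of "v n"] v by (simp add: eigenspace_def)
    ultimately show "(\<lambda>n. cinner (H x) (v n)) \<longlonglongrightarrow> cinner x (scaleC E l)" by simp
  qed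
  then have "l \<in> D \<and> scaleC E l = H l" using sa unfolding selfadjoint_def by blast
  then show "l \<in> eigenspace D H E" by (simp add: eigenspace_def)
qed

abbreviation other_eigenvectors :: "'a::complex_inner set \<Rightarrow> ('a \<Rightarrow> 'a) \<Rightarrow> complex \<Rightarrow> 'a set" where
  "other_eigenvectors D H E \<equiv> (\<Union>E'\<in>eigenvalues D H - {E}. eigenspace D H E')"

text \<open>The finitely many vectors of a combination are sorted by membership in the eigenspace of
  \<open>E\<close>; each of the others belongs to a different eigenvalue.\<close>

lemma cspan_eigenvectors_split:
  assumes sa: "selfadjoint D H" and w: "w \<in> cspan (\<Union>E\<in>eigenvalues D H. eigenspace D H E)"
  shows "\<exists>c\<in>eigenspace D H E. \<exists>d\<in>cspan (other_eigenvectors D H E). w = c + d"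
proof -
  obtain F k where F: "finite F" "F \<subseteq> (\<Union>E\<in>eigenvalues D H. eigenspace D H E)"
    and w: "w = (\<Sum>v\<in>F. scaleC (k v) v)" using w unfolding cspan_def by blast
  let ?M = "eigenspace D H E"
  have "w = (\<Sum>v\<in>F \<inter> ?M. scaleC (k v) v) + (\<Sum>v\<in>F - ?M. scaleC (k v) v)"
    unfolding w by (subst sum.union_disjoint[symmetric]) (use F in \<open>auto intro: sum.cong\<close>)
  moreover have "(\<Sum>v\<in>F \<inter> ?M. scaleC (k v) v) \<in> ?M"
    by (intro eigenspace_sum[OF sa] eigenspace_scaleC[OF sa]) auto
  moreover have "(\<Sum>v\<in>F - ?M. scaleC (k v) v) \<in> cspan (other_eigenvectors D H E)"
    unfolding cspan_def using F by (intro CollectI exI[of _ "F - ?M"] exI[of _ k]) blast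
  ultimately show ?thesis by blast
qed

lemma orthogonal_other_eigenvectors:
  assumes sa: "selfadjoint D H" and z: "z \<in> eigenspace D H E" and d: "d \<in> cspan (other_eigenvectors D H E)"
  shows "cinner z d = 0"
proof -
  obtain F k where F: "F \<subseteq> other_eigenvectors D H E"
    and d: "d = (\<Sum>v\<in>F. scaleC (k v) v)" using d unfolding cspan_def by blast
  have "cinner z v = 0" if "v \<in> F" for v
    using F that eigenspace_orthogonal[OF sa z] by blast
  then show ?thesis
    by (simp add: d bounded_bilinear.sum_right[OF bounded_bilinear_cinner] cinner_scaleC_right)
qed

lemma norm_orthogonal_component_le:
  assumes "cinner c (d::'a::complex_inner) = 0"
  shows "norm c \<le> norm (c + d)"
proof -
  have "(norm (c + d))\<^sup>2 = (norm c)\<^sup>2 + (norm d)\<^sup>2"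
  proof -
    have "cinner c (c + d) = complex_of_real ((norm c)\<^sup>2)"
      by (simp only: cinner_add_right cinner_norm assms add_0_right)
    then have "Re (cinner c (c + d)) = (norm c)\<^sup>2" by (simp only: Re_complex_of_real)
    then show ?thesis using norm_diff_square[of "c + d" c] by simp
  qed
  then show ?thesis by (auto intro: power2_le_imp_le[of "norm c"])
qed

text \<open>Pure point spectrum yields the projection directly. Approximants of \<open>x\<close>
  split as \<open>c + d\<close> with \<open>c\<close> in the eigenspace and \<open>d\<close>
  orthogonal to it; by Pythagoras the parts \<open>c\<close> form a Cauchy sequence, and their limit
  is the projection. Existence is what gives the definite description in \<open>orthproj\<close> its
  meaning.\<close>

lemma spec_proj_exists:
  fixes D :: "'a::chilbert set"
  assumes sa: "selfadjoint D H" and pp: "pure_point D H"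
  shows "\<exists>y. y \<in> eigenspace D H E \<and> (\<forall>z\<in>eigenspace D H E. cinner z (x - y) = 0)"
proof -
  have "x \<in> closure (cspan (\<Union>E\<in>eigenvalues D H. eigenspace D H E))"
    using pp by (simp add: pure_point_def)
  then obtain w where w: "\<And>n. w n \<in> cspan (\<Union>E\<in>eigenvalues D H. eigenspace D H E)" and wx: "w \<longlonglongrightarrow> x"
    unfolding closure_sequential by blast
  obtain c d where c: "\<And>n. c n \<in> eigenspace D H E" and d: "\<And>n. d n \<in> cspan (other_eigenvectors D H E)"
    and cd: "\<And>n. w n = c n + d n"
  proof -
    have "\<forall>n. \<exists>p. fst p \<in> eigenspace D H E \<and> snd p \<in> cspan (other_eigenvectors D H E) \<and> w n = fst p + snd p"
    proof
      fix n
      obtain c d where "c \<in> eigenspace D H E" "d \<in> cspan (other_eigenvectors D H E)" "w n = c + d"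
        using cspan_eigenvectors_split[OF sa w, of E n] by blast
      then show "\<exists>p. fst p \<in> eigenspace D H E \<and> snd p \<in> cspan (other_eigenvectors D H E) \<and> w n = fst p + snd p"
        by (intro exI[of _ "(c, d)"]) simp
    qed
    from choice[OF this] obtain p where "\<forall>n. fst (p n) \<in> eigenspace D H E
        \<and> snd (p n) \<in> cspan (other_eigenvectors D H E) \<and> w n = fst (p n) + snd (p n)" by blast
    then show ?thesis using that[of "\<lambda>n. fst (p n)" "\<lambda>n. snd (p n)"] by simp
  qed
  have contr: "dist (c m) (c n) \<le> dist (w m) (w n)" for m n
  proof -
    have "cinner (c m - c n) (d m - d n) = 0"
      by (simp only: cinner_diff_right orthogonal_other_eigenvectors[OF sa eigenspace_diff[OF sa c c] d]) simp
    from norm_orthogonal_component_le[OF this] show ?thesis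
      unfolding dist_norm cd add_diff_add .
  qed
  have "Cauchy w" using wx by (rule LIMSEQ_imp_Cauchy)
  then have "Cauchy c" unfolding Cauchy_def by (meson contr le_less_trans)
  then obtain y where y: "c \<longlonglongrightarrow> y" using Cauchy_convergent convergent_def by blast
  have "y \<in> eigenspace D H E" using closed_sequentially[OF closed_eigenspace[OF sa] c y] by simp
  moreover have "cinner z (x - y) = 0" if z: "z \<in> eigenspace D H E" for z
  proof (rule LIMSEQ_unique[where X = "\<lambda>n. cinner z (w n - c n)"])
    show "(\<lambda>n. cinner z (w n - c n)) \<longlonglongrightarrow> cinner z (x - y)"
      by (rule bounded_linear.tendsto[OF bounded_linear_cinner_right tendsto_diff[OF wx y]])
    show "(\<lambda>n. cinner z (w n - c n)) \<longlonglongrightarrow> 0"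
      by (simp add: cd orthogonal_other_eigenvectors[OF sa z d])
  qed
  ultimately show ?thesis by blast
qed

text \<open>The difference of two candidates lies in the eigenspace and is orthogonal to it, hence
  to itself. Every later identity for the projection is checked through this rule.\<close>

lemma spec_proj_eqI:
  assumes sa: "selfadjoint D H" and y: "y \<in> eigenspace D H E"
    and orth: "\<And>z. z \<in> eigenspace D H E \<Longrightarrow> cinner z (x - y) = 0"
  shows "spec_proj D H E x = y"
  unfolding spec_proj_def orthproj_def
proof (rule the_equality)
  fix y' assume y': "y' \<in> eigenspace D H E \<and> (\<forall>z\<in>eigenspace D H E. cinner z (x - y') = 0)"
  then have d: "y - y' \<in> eigenspace D H E" using eigenspace_diff[OF sa y] by blast
  have "cinner (y - y') ((x - y') - (x - y)) = cinner (y - y') (x - y') - cinner (y - y') (x - y)"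
    by (rule cinner_diff_right)
  also have "\<dots> = 0" using y' d orth[OF d] by simp
  finally show "y' = y" by (simp add: cinner_norm)
qed (use y orth in auto)

lemma
  fixes D :: "'a::chilbert set"
  assumes sa: "selfadjoint D H" and pp: "pure_point D H"
  shows spec_proj_in: "spec_proj D H E x \<in> eigenspace D H E"
    and spec_proj_orth: "z \<in> eigenspace D H E \<Longrightarrow> cinner z (x - spec_proj D H E x) = 0"
  using spec_proj_exists[OF sa pp, of E x] spec_proj_eqI[OF sa, of _ E x] by metis+

lemma spec_proj_id: "selfadjoint D H \<Longrightarrow> x \<in> eigenspace D H E \<Longrightarrow> spec_proj D H E x = x"
  by (rule spec_proj_eqI) auto

lemma spec_proj_other:
  "selfadjoint D H \<Longrightarrow> x \<in> eigenspace D H E' \<Longrightarrow> E \<noteq> E' \<Longrightarrow> spec_proj D H E x = 0"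
  by (rule spec_proj_eqI) (auto intro: eigenspace_zero eigenspace_orthogonal)

lemma spec_proj_norm_le:
  fixes D :: "'a::chilbert set"
  assumes sa: "selfadjoint D H" and pp: "pure_point D H"
  shows "norm (spec_proj D H E x) \<le> norm x"
proof -
  have "cinner (spec_proj D H E x) (x - spec_proj D H E x) = 0"
    by (rule spec_proj_orth[OF sa pp spec_proj_in[OF sa pp]])
  from norm_orthogonal_component_le[OF this] show ?thesis by simp
qed

lemma spec_proj_add:
  fixes D :: "'a::chilbert set"
  assumes sa: "selfadjoint D H" and pp: "pure_point D H"
  shows "spec_proj D H E (x + y) = spec_proj D H E x + spec_proj D H E y"
proof (rule spec_proj_eqI[OF sa eigenspace_add[OF sa spec_proj_in[OF sa pp] spec_proj_in[OF sa pp]]])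
  fix z assume z: "z \<in> eigenspace D H E"
  show "cinner z (x + y - (spec_proj D H E x + spec_proj D H E y)) = 0"
    using spec_proj_orth[OF sa pp z, of x] spec_proj_orth[OF sa pp z, of y]
    by (simp add: cinner_diff_right cinner_add_right)
qed

lemma spec_proj_scaleC:
  fixes D :: "'a::chilbert set"
  assumes sa: "selfadjoint D H" and pp: "pure_point D H"
  shows "spec_proj D H E (scaleC c x) = scaleC c (spec_proj D H E x)"
proof (rule spec_proj_eqI[OF sa eigenspace_scaleC[OF sa spec_proj_in[OF sa pp]]])
  fix z assume z: "z \<in> eigenspace D H E"
  show "cinner z (scaleC c x - scaleC c (spec_proj D H E x)) = 0"
    using spec_proj_orth[OF sa pp z, of x]
    by (simp add: cinner_scaleC_right flip: scaleC_diff_right)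
qed

lemma bounded_linear_spec_proj:
  fixes D :: "'a::chilbert set"
  assumes sa: "selfadjoint D H" and pp: "pure_point D H"
  shows "bounded_linear (spec_proj D H E)"
  by (rule bounded_linear_intro[where K = 1])
    (auto simp: spec_proj_add[OF sa pp] scaleR_scaleC spec_proj_scaleC[OF sa pp] spec_proj_norm_le[OF sa pp])

lemma spec_proj_complement_norm_le:
  fixes D :: "'a::chilbert set"
  assumes sa: "selfadjoint D H" and pp: "pure_point D H"
  shows "norm (x - spec_proj D H E x) \<le> norm x"
proof -
  have "cinner (x - spec_proj D H E x) (spec_proj D H E x) = 0"
    by (subst cinner_commute) (simp add: spec_proj_orth[OF sa pp spec_proj_in[OF sa pp]])
  from norm_orthogonal_component_le[OF this] show ?thesis by simp
qed

text \<open>If \<open>w = c + d\<close> approximates \<open>x\<close>, then \<open>c\<close> is the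
  projection of \<open>w\<close>, hence that of \<open>w - x\<close>, and so is as small as
  \<open>w - x\<close>. Dropping \<open>c\<close> at most doubles the error.\<close>

lemma spec_proj_kernel_approx:
  fixes D :: "'a::chilbert set"
  assumes sa: "selfadjoint D H" and pp: "pure_point D H" and x: "spec_proj D H E x = 0" and e: "0 < e"
  shows "\<exists>d\<in>cspan (other_eigenvectors D H E). norm (x - d) < e"
proof -
  have "x \<in> closure (cspan (\<Union>E\<in>eigenvalues D H. eigenspace D H E))"
    using pp by (simp add: pure_point_def)
  then obtain w where w: "w \<in> cspan (\<Union>E\<in>eigenvalues D H. eigenspace D H E)" and wx: "dist w x < e / 2"
    using e by (meson closure_approachable half_gt_zero)
  obtain c d where c: "c \<in> eigenspace D H E" and d: "d \<in> cspan (other_eigenvectors D H E)" and cd: "w = c + d"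
    using cspan_eigenvectors_split[OF sa w] by blast
  have "spec_proj D H E w = c"
    by (rule spec_proj_eqI[OF sa c]) (simp add: cd orthogonal_other_eigenvectors[OF sa _ d])
  then have "c = spec_proj D H E (w - x)"
    using bounded_linear_spec_proj[OF sa pp, of E] x by (simp add: linear_diff bounded_linear.linear)
  then have "norm c \<le> norm (w - x)" using spec_proj_norm_le[OF sa pp] by metis
  moreover have "norm (x - d) \<le> norm (w - x) + norm c"
    using norm_triangle_ineq4[of c "w - x"] by (simp add: cd)
  ultimately show ?thesis using d wx by (auto simp: dist_norm intro!: bexI[of _ d])
qed

text \<open>All projections of \<open>x\<close> onto other eigenspaces vanish, so the infinite sum
  has a single nonzero term at most and no convergence question arises.\<close>

lemma diag_part_eigenvector:
  fixes D :: "'a::chilbert set"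
  assumes sa: "selfadjoint D H" and E: "E \<in> eigenvalues D H" and x: "x \<in> eigenspace D H E"
    and A0: "A 0 = 0"
  shows "diag_part D H A x = spec_proj D H E (A x)"
proof -
  have "diag_part D H A x = (\<Sum>\<^sub>\<infinity>E'\<in>{E}. spec_proj D H E (A x))"
    unfolding diag_part_def
  proof (rule infsum_cong_neutral)
    fix E' assume "E' \<in> eigenvalues D H - {E}"
    then show "spec_proj D H E' (A (spec_proj D H E' x)) = 0"
      by (simp add: spec_proj_other[OF sa x] A0 spec_proj_id[OF sa eigenspace_zero[OF sa]])
  qed (use E in \<open>auto simp: spec_proj_id[OF sa x]\<close>)
  then show ?thesis by simp
qed

section \<open>The unitary group and its action on eigenvectors\<close>

lemma unitaryD:
  assumes "unitary V"
  shows "V (x + y) = V x + V y" "V (scaleC c x) = scaleC c (V x)" "norm (V x) = norm x"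
    "cinner (V x) (V y) = cinner x y" "bounded_linear V" "V (x - y) = V x - V y"
proof -
  show add: "V (x + y) = V x + V y" for x y
    using assms by (simp add: unitary_def bounded_op_def clinear_on_def)
  show sc: "V (scaleC c x) = scaleC c (V x)" for c x
    using assms by (simp add: unitary_def bounded_op_def clinear_on_def)
  show inn: "cinner (V x) (V y) = cinner x y" for x y using assms by (simp add: unitary_def)
  show nm: "norm (V x) = norm x" for x
    using inn[of x x] unfolding cinner_norm of_real_eq_iff by simp
  show "bounded_linear V"
    by (rule bounded_linear_intro[where K = 1]) (auto simp: add scaleR_scaleC sc nm)
  show "V (x - y) = V x - V y" using add[of "x - y" y] by simp
qed

lemma exp_itH_D:
  assumes "exp_itH D H W"
  shows "unitary (W t)" "W 0 x = x" "W (s + t) x = W s (W t x)" "continuous_on UNIV (\<lambda>t. W t x)"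
    "x \<in> D \<Longrightarrow> ((\<lambda>t. W t x) has_vector_derivative scaleC \<i> (H x)) (at 0)"
    "W t (W (- t) x) = x" "cinner (W (- t) x) y = cinner x (W t y)"
proof -
  show u: "unitary (W t)" and z: "W 0 x = x" and a: "W (s + t) x = W s (W t x)" for s t x
    using assms by (auto simp: exp_itH_def)
  show i: "W t (W (- t) x) = x" for t x using a[of t "- t" x] z by simp
  show "cinner (W (- t) x) y = cinner x (W t y)"
    using unitaryD(4)[OF u, of t "W (- t) x" y] by (simp add: i)
qed (use assms in \<open>auto simp: exp_itH_def\<close>)

text \<open>The curve \<open>k\<close>, which is \<open>W u v\<close> with the expected phase
  removed, has derivative zero everywhere. The generator is known only at time \<open>0\<close>; the
  group law and the bounded operator \<open>W u\<close> carry the derivative to time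
  \<open>u\<close>.\<close>

lemma exp_itH_eigenvector:
  assumes W: "exp_itH D H W" and v: "v \<in> eigenspace D H (complex_of_real l)"
  shows "W t v = scaleC (cis (l * t)) v"
proof -
  define k where "k u = scaleC (cis (- (l * u))) (W u v)" for u
  have der: "(k has_vector_derivative 0) (at u)" for u
  proof -
    have vD: "v \<in> D" and Hv: "H v = scaleC (complex_of_real l) v" using v by (auto simp: eigenspace_def)
    have "((\<lambda>h. W u (W h v)) has_vector_derivative W u (scaleC \<i> (H v))) (at 0)"
      by (rule bounded_linear.has_vector_derivative[OF unitaryD(5)[OF exp_itH_D(1)[OF W]] exp_itH_D(5)[OF W vD]])
    then have "((\<lambda>h. W (u + h) v) has_vector_derivative scaleC (\<i> * l) (W u v)) (at 0)"
      by (simp add: exp_itH_D(3)[OF W] Hv scaleC_scaleC unitaryD(2)[OF exp_itH_D(1)[OF W]])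
    moreover have "((\<lambda>h. W h v) has_vector_derivative w) (at u)"
      if "((\<lambda>h. W (u + h) v) has_vector_derivative w) (at 0)" for w
    proof -
      have "((\<lambda>h. h - u) has_vector_derivative 1) (at u)"
        by (auto intro!: derivative_eq_intros)
      from vector_diff_chain_at[OF this, of "\<lambda>h. W (u + h) v"] that
      show ?thesis by (simp add: o_def)
    qed
    ultimately have 1: "((\<lambda>h. W h v) has_vector_derivative scaleC (\<i> * l) (W u v)) (at u)" by blast
    have 2: "((\<lambda>u. cis (- (l * u))) has_vector_derivative (- l) *\<^sub>R (\<i> * cis (- (l * u)))) (at u)"
      by (auto intro!: derivative_eq_intros simp: has_vector_derivative_def)
    have "(k has_vector_derivative scaleC (cis (- (l * u))) (scaleC (\<i> * l) (W u v))
        + scaleC ((- l) *\<^sub>R (\<i> * cis (- (l * u)))) (W u v)) (at u)"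
      unfolding k_def by (rule bounded_bilinear.has_vector_derivative[OF bounded_bilinear_scaleC 2 1])
    then show ?thesis
      by (simp add: scaleC_scaleC scaleC_minus_left scaleR_conv_of_real mult_ac)
  qed
  have "k t = k 0"
  proof -
    obtain c where "\<And>u. u \<in> UNIV \<Longrightarrow> k u = c"
      using has_vector_derivative_zero_constant[of UNIV k] der by auto
    then show ?thesis by simp
  qed
  then have "scaleC (cis (l * t)) (k t) = scaleC (cis (l * t)) v"
    by (simp add: k_def exp_itH_D(2)[OF W] scaleC_one)
  then show ?thesis by (simp add: k_def scaleC_scaleC cis_mult scaleC_one)
qed

lemma spec_proj_exp_itH:
  fixes D :: "'a::chilbert set"
  assumes sa: "selfadjoint D H" and pp: "pure_point D H" and W: "exp_itH D H W"
  shows "spec_proj D H (complex_of_real l) (W t x) = scaleC (cis (l * t)) (spec_proj D H (complex_of_real l) x)"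
proof (rule spec_proj_eqI[OF sa eigenspace_scaleC[OF sa spec_proj_in[OF sa pp]]])
  let ?P = "spec_proj D H (complex_of_real l)"
  fix z assume z: "z \<in> eigenspace D H (complex_of_real l)"
  have "W t x - scaleC (cis (l * t)) (?P x) = W t (x - ?P x)"
    by (simp add: unitaryD(6)[OF exp_itH_D(1)[OF W]] exp_itH_eigenvector[OF W spec_proj_in[OF sa pp]])
  then have "cinner z (W t x - scaleC (cis (l * t)) (?P x)) = cinner (W (- t) z) (x - ?P x)"
    by (simp add: exp_itH_D(7)[OF W])
  also have "\<dots> = 0"
    by (simp add: exp_itH_eigenvector[OF W z] cinner_scaleC_left spec_proj_orth[OF sa pp z])
  finally show "cinner z (W t x - scaleC (cis (l * t)) (?P x)) = 0" .
qed

text \<open>The group is only strongly continuous. As each \<open>W (c s)\<close> is an isometry,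
  the variation of \<open>u\<close> can be split off uniformly in \<open>c s\<close>, and what
  remains is a fixed vector.\<close>

lemma continuous_on_exp_itH:
  assumes W: "exp_itH D H W" and c: "continuous_on S c" and u: "continuous_on S u"
  shows "continuous_on S (\<lambda>s. W (c s) (u s))"
proof -
  have "((\<lambda>s. W (c s) (u s)) \<longlongrightarrow> W (c x) (u x)) (at x within S)" if x: "x \<in> S" for x
  proof -
    have cx: "((\<lambda>s. W (c s) (u x)) \<longlongrightarrow> W (c x) (u x)) (at x within S)"
      by (rule continuous_on_tendsto_compose[OF exp_itH_D(4)[OF W]])
        (use c x in \<open>auto simp: continuous_on_def\<close>)
    have ux: "((\<lambda>s. norm (u s - u x)) \<longlongrightarrow> 0) (at x within S)"
      using u x unfolding continuous_on_def by (simp add: tendsto_norm_zero_iff LIM_zero)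
    have "norm (W (c s) (u s) - W (c s) (u x)) = norm (u s - u x)" for s
      by (simp add: unitaryD(3)[OF exp_itH_D(1)[OF W]] flip: unitaryD(6)[OF exp_itH_D(1)[OF W]])
    with ux have "((\<lambda>s. W (c s) (u s) - W (c s) (u x)) \<longlongrightarrow> 0) (at x within S)"
      by (simp add: tendsto_norm_zero_cancel)
    from tendsto_add[OF this cx] show ?thesis by simp
  qed
  then show ?thesis by (simp add: continuous_on_def)
qed

section \<open>Oscillatory integrals off an eigenspace\<close>

text \<open>An eigenvector in \<open>d\<close> with eigenvalue \<open>m \<noteq> l\<close>
  contributes a scalar oscillation of frequency \<open>\<sigma> * (m - l)\<close>. The test vector
  enters only through its inner products with finitely many eigenvectors, which makes the estimate
  uniform over the unit ball.\<close>

lemma oscillatory_integral_other_eigenvectors: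
  fixes D :: "'a::chilbert set" and g :: "real \<Rightarrow> real"
  assumes sa: "selfadjoint D H" and W: "exp_itH D H W"
    and g: "g integrable_on {p..q}" and g0: "\<And>r. r \<in> {p..q} \<Longrightarrow> 0 \<le> g r"
    and d: "d \<in> cspan (other_eigenvectors D H (complex_of_real l))" and e: "0 < e"
  shows "\<forall>\<^sub>F \<sigma> in at_top. \<forall>\<eta>\<in>{\<eta>. norm \<eta> \<le> 1}. cmod (integral {p..q}
      (\<lambda>r. g r *\<^sub>R cinner (scaleC (cis (\<sigma> * l * r)) (W (- (\<sigma> * r)) \<eta>)) d)) \<le> e"
proof -
  obtain F k where F: "finite F" "F \<subseteq> other_eigenvectors D H (complex_of_real l)"
    and d: "d = (\<Sum>v\<in>F. scaleC (k v) v)" using d unfolding cspan_def by blast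
  have "\<exists>m. m \<noteq> l \<and> v \<in> eigenspace D H (complex_of_real m)" if vF: "v \<in> F" for v
  proof -
    obtain E where E: "E \<in> eigenvalues D H" "E \<noteq> complex_of_real l" "v \<in> eigenspace D H E"
      using F vF by blast
    \<comment> \<open>\<open>v\<close> itself may be zero, so the reality of \<open>E\<close> is
      read off from a nonzero vector of the same eigenspace.\<close>
    then obtain u where "u \<in> eigenspace D H E" "u \<noteq> 0" by (auto simp: eigenvalues_def eigenspace_def)
    then have "E = complex_of_real (Re E)" using eigenvalue_real[OF sa] by blast
    then show ?thesis using E by (intro exI[of _ "Re E"]) auto
  qed
  then obtain m where m: "\<And>v. v \<in> F \<Longrightarrow> m v \<noteq> l" "\<And>v. v \<in> F \<Longrightarrow> v \<in> eigenspace D H (complex_of_real (m v))"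
    by metis
  define R where "R \<sigma> v = integral {p..q} (\<lambda>r. g r *\<^sub>R cis (\<sigma> * (m v - l) * r))" for \<sigma> v
  have R: "((\<lambda>\<sigma>. \<Sum>v\<in>F. cmod (k v) * norm v * cmod (R \<sigma> v)) \<longlongrightarrow> 0) at_top"
  proof -
    have "((\<lambda>\<sigma>. \<Sum>v\<in>F. cmod (k v) * norm v * cmod (R \<sigma> v)) \<longlongrightarrow> (\<Sum>v\<in>F. cmod (k v) * norm v * cmod 0)) at_top"
      unfolding R_def
      by (intro tendsto_sum tendsto_mult tendsto_const tendsto_norm Riemann_Lebesgue g) (use m g0 in auto)
    then show ?thesis by simp
  qed
  have "\<forall>\<^sub>F \<sigma> in at_top. (\<Sum>v\<in>F. cmod (k v) * norm v * cmod (R \<sigma> v)) < e"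
    using order_tendstoD(2)[OF R e] .
  then show ?thesis
  proof eventually_elim
    case (elim \<sigma>)
    show ?case
    proof
      fix \<eta> :: 'a assume \<eta>: "\<eta> \<in> {\<eta>. norm \<eta> \<le> 1}"
      have inner: "cinner (scaleC (cis (\<sigma> * l * r)) (W (- (\<sigma> * r)) \<eta>)) d
          = (\<Sum>v\<in>F. k v * cinner \<eta> v * cis (\<sigma> * (m v - l) * r))" for r
      proof -
        have "cinner (scaleC (cis (\<sigma> * l * r)) (W (- (\<sigma> * r)) \<eta>)) v = cinner \<eta> v * cis (\<sigma> * (m v - l) * r)"
          if "v \<in> F" for v
        proof -
          have "cinner (scaleC (cis (\<sigma> * l * r)) (W (- (\<sigma> * r)) \<eta>)) v
              = cis (- (\<sigma> * l * r)) * (cis (m v * (\<sigma> * r)) * cinner \<eta> v)"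
            by (simp add: cinner_scaleC_left cis_cnj exp_itH_D(7)[OF W]
                exp_itH_eigenvector[OF W m(2)[OF that]] cinner_scaleC_right)
          also have "\<dots> = cinner \<eta> v * cis (- (\<sigma> * l * r) + m v * (\<sigma> * r))"
            by (simp only: cis_mult[symmetric]) (simp add: mult_ac)
          also have "- (\<sigma> * l * r) + m v * (\<sigma> * r) = \<sigma> * (m v - l) * r" by (simp add: algebra_simps)
          finally show ?thesis .
        qed
        then show ?thesis
          by (simp add: d bounded_bilinear.sum_right[OF bounded_bilinear_cinner] cinner_scaleC_right mult.assoc)
      qed
      have ci: "(\<lambda>r. g r *\<^sub>R cis (\<sigma> * (m v - l) * r)) integrable_on {p..q}" for v
        by (rule integrable_scaleR_continuous[OF g g0]) (auto intro!: continuous_intros)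
      have "((\<lambda>r. \<Sum>v\<in>F. (k v * cinner \<eta> v) * (g r *\<^sub>R cis (\<sigma> * (m v - l) * r))) has_integral
          (\<Sum>v\<in>F. (k v * cinner \<eta> v) * R \<sigma> v)) {p..q}"
        unfolding R_def
        by (intro has_integral_sum F(1) has_integral_mult_right integrable_integral ci)
      then have "integral {p..q} (\<lambda>r. g r *\<^sub>R cinner (scaleC (cis (\<sigma> * l * r)) (W (- (\<sigma> * r)) \<eta>)) d)
          = (\<Sum>v\<in>F. (k v * cinner \<eta> v) * R \<sigma> v)"
        unfolding inner by (intro integral_unique) (simp add: sum_distrib_left scaleR_conv_of_real mult_ac)
      moreover have "cmod (\<Sum>v\<in>F. (k v * cinner \<eta> v) * R \<sigma> v) \<le> (\<Sum>v\<in>F. cmod (k v) * norm v * cmod (R \<sigma> v))"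
      proof (rule sum_norm_le)
        fix v assume "v \<in> F"
        have "cmod (cinner \<eta> v) \<le> norm v"
          using norm_cinner_le[of \<eta> v] \<eta> mult_right_mono[of "norm \<eta>" 1 "norm v"] by simp
        then show "cmod (k v * cinner \<eta> v * R \<sigma> v) \<le> cmod (k v) * norm v * cmod (R \<sigma> v)"
          by (simp add: norm_mult mult_left_mono mult_right_mono)
      qed
      ultimately show "cmod (integral {p..q}
          (\<lambda>r. g r *\<^sub>R cinner (scaleC (cis (\<sigma> * l * r)) (W (- (\<sigma> * r)) \<eta>)) d)) \<le> e"
        using elim by simp
    qed
  qed
qed

text \<open>By unitarity the oscillating operators act on the test vector instead, which produces
  the curve \<open>Z\<close>. The transfer principle over the unit ball then bounds the norm of the
  integral. Integrability of the rotated integrand is left to the caller, who gets it from the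
  solution at another \<open>\<tau>\<close>.\<close>

lemma oscillatory_integral_tends_to_zero:
  fixes D :: "'a::chilbert set" and f :: "real \<Rightarrow> 'a" and g :: "real \<Rightarrow> real"
  assumes sa: "selfadjoint D H" and pp: "pure_point D H" and W: "exp_itH D H W"
    and ab: "a < b" and f: "f integrable_on {a..b}" and g: "g integrable_on {a..b}"
    and fg: "\<And>r. r \<in> {a..b} \<Longrightarrow> norm (f r) \<le> g r" and g1: "\<And>r. r \<in> {a..b} \<Longrightarrow> 1 \<le> g r"
    and Pf: "\<And>r. r \<in> {a..b} \<Longrightarrow> spec_proj D H (complex_of_real l) (f r) = 0"
    and Wf: "\<And>\<sigma>. 0 < \<sigma> \<Longrightarrow> (\<lambda>r. scaleC (cis (- (\<sigma> * l * r))) (W (\<sigma> * r) (f r))) integrable_on {a..b}"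
    and eps: "0 < \<epsilon>"
  shows "\<forall>\<^sub>F \<sigma> in at_top. norm (integral {a..b} (\<lambda>r. scaleC (cis (- (\<sigma> * l * r))) (W (\<sigma> * r) (f r)))) \<le> \<epsilon>"
proof -
  define Z where "Z \<sigma> \<eta> r = scaleC (cis (\<sigma> * l * r)) (W (- (\<sigma> * r)) \<eta>)" for \<sigma> \<eta> r
  let ?Y = "{\<eta>::'a. norm \<eta> \<le> 1}"
  have Zc: "continuous_on {a..b} (Z \<sigma> \<eta>)" for \<sigma> \<eta>
    unfolding Z_def
    by (intro continuous_on_scaleC continuous_on_exp_itH[OF W] continuous_intros)
  have Zn: "norm (Z \<sigma> \<eta> r) = norm \<eta>" for \<sigma> \<eta> r
    by (simp add: Z_def norm_scaleC unitaryD(3)[OF exp_itH_D(1)[OF W]])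
  have Zx: "cinner (Z \<sigma> \<eta> r) x = cinner \<eta> (scaleC (cis (- (\<sigma> * l * r))) (W (\<sigma> * r) x))" for \<sigma> \<eta> r x
    by (simp add: Z_def cinner_scaleC_left cinner_scaleC_right cis_cnj exp_itH_D(7)[OF W])
  have "\<forall>\<^sub>F \<sigma> in at_top. \<forall>\<eta>\<in>?Y. cmod (integral {a..b} (\<lambda>r. cinner (Z \<sigma> \<eta> r) (f r))) \<le> \<epsilon>"
  proof (rule oscillatory_integral_transfer[OF ab f g fg g1 _ _ _ _ eps])
    show "(\<lambda>r. cinner (Z \<sigma> \<eta> r) (f r)) integrable_on {a..b}" if "0 < \<sigma>" for \<sigma> \<eta>
      using integrable_linear[OF Wf[OF that] bounded_linear_cinner_right[of \<eta>]] by (simp add: Zx o_def)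
    show "\<forall>\<^sub>F \<sigma> in at_top. \<forall>\<eta>\<in>?Y. cmod (integral {p..q} (\<lambda>r. g r *\<^sub>R cinner (Z \<sigma> \<eta> r) (integral {p..q} f))) \<le> e"
      if pq: "a \<le> p" "p \<le> q" "q \<le> b" and e: "0 < e" for p q e
    proof -
      have sub: "{p..q} \<subseteq> {a..b}" using pq by auto
      have gpq: "g integrable_on {p..q}" by (rule integrable_on_subinterval[OF g sub])
      have g0: "0 \<le> g r" if "r \<in> {p..q}" for r using g1[of r] that sub by auto
      let ?v = "integral {p..q} f"
      \<comment> \<open>A bounded linear map passes through the integral, so the integrals of
        \<open>f\<close> have no component in the eigenspace either.\<close>
      have "spec_proj D H (complex_of_real l) ?v = integral {p..q} (\<lambda>r. spec_proj D H (complex_of_real l) (f r))"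
        using integral_linear[OF integrable_on_subinterval[OF f sub] bounded_linear_spec_proj[OF sa pp]]
        by (simp add: o_def)
      also have "\<dots> = integral {p..q} (\<lambda>r. 0)"
        by (rule Henstock_Kurzweil_Integration.integral_cong) (use Pf sub in auto)
      finally have Pv: "spec_proj D H (complex_of_real l) ?v = 0" by simp
      define I where "I = integral {p..q} g"
      have I: "0 \<le> I" unfolding I_def by (rule integral_nonneg[OF gpq g0])
      \<comment> \<open>Replacing \<open>?v\<close> by \<open>d\<close> costs at most
        \<open>\<delta> * I\<close>, which is within \<open>e / 2\<close>; the oscillation with
        \<open>d\<close> costs the other half.\<close>
      define \<delta> where "\<delta> = e / (2 * (I + 1))"
      have \<delta>: "0 < \<delta>" using e I by (simp add: \<delta>_def)
      obtain d where d: "d \<in> cspan (other_eigenvectors D H (complex_of_real l))" "norm (?v - d) < \<delta>"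
        using spec_proj_kernel_approx[OF sa pp Pv \<delta>] by blast
      have "\<forall>\<^sub>F \<sigma> in at_top. \<forall>\<eta>\<in>?Y. cmod (integral {p..q} (\<lambda>r. g r *\<^sub>R cinner (Z \<sigma> \<eta> r) d)) \<le> e / 2"
        unfolding Z_def
        by (rule oscillatory_integral_other_eigenvectors[OF sa W gpq g0 d(1)]) (use e in auto)
      then show ?thesis
      proof eventually_elim
        case (elim \<sigma>)
        show ?case
        proof
          fix \<eta> assume \<eta>: "\<eta> \<in> ?Y"
          have i: "(\<lambda>r. g r *\<^sub>R cinner (Z \<sigma> \<eta> r) w) integrable_on {p..q}" for w
            by (intro integrable_scaleR_continuous gpq g0 continuous_on_cinner continuous_on_const
                continuous_on_subset[OF Zc sub])
          have "cmod (integral {p..q} (\<lambda>r. g r *\<^sub>R cinner (Z \<sigma> \<eta> r) (?v - d))) \<le> integral {p..q} (\<lambda>r. \<delta> * g r)"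
          proof (rule integral_norm_bound_integral[OF i integrable_on_mult_right[OF gpq]])
            fix r assume r: "r \<in> {p..q}"
            have "cmod (cinner (Z \<sigma> \<eta> r) (?v - d)) \<le> norm (Z \<sigma> \<eta> r) * norm (?v - d)" by (rule norm_cinner_le)
            also have "\<dots> \<le> 1 * \<delta>" using \<eta> d(2) by (intro mult_mono) (auto simp: Zn)
            finally show "cmod (g r *\<^sub>R cinner (Z \<sigma> \<eta> r) (?v - d)) \<le> \<delta> * g r"
              using mult_right_mono[OF _ g0[OF r], of _ \<delta>] g0[OF r] by (simp add: mult.commute[of "g r"])
          qed
          also have "\<dots> = \<delta> * I" by (simp add: I_def)
          also have "\<dots> \<le> \<delta> * (I + 1)" using \<delta> by simp
          also have "\<dots> = e / 2" using I by (simp add: \<delta>_def field_simps)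
          finally have 1: "cmod (integral {p..q} (\<lambda>r. g r *\<^sub>R cinner (Z \<sigma> \<eta> r) (?v - d))) \<le> e / 2" .
          have "integral {p..q} (\<lambda>r. g r *\<^sub>R cinner (Z \<sigma> \<eta> r) (?v - d))
              = integral {p..q} (\<lambda>r. g r *\<^sub>R cinner (Z \<sigma> \<eta> r) ?v) - integral {p..q} (\<lambda>r. g r *\<^sub>R cinner (Z \<sigma> \<eta> r) d)"
            using Henstock_Kurzweil_Integration.integral_diff[OF i i, of ?v d]
            by (simp add: cinner_diff_right scaleR_diff_right)
          then show "cmod (integral {p..q} (\<lambda>r. g r *\<^sub>R cinner (Z \<sigma> \<eta> r) ?v)) \<le> e"
            using 1 elim \<eta> norm_triangle_sub[of "integral {p..q} (\<lambda>r. g r *\<^sub>R cinner (Z \<sigma> \<eta> r) ?v)"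
                "integral {p..q} (\<lambda>r. g r *\<^sub>R cinner (Z \<sigma> \<eta> r) d)"] by fastforce
        qed
      qed
    qed
  qed (auto simp: Zc Zn)
  then show ?thesis using eventually_gt_at_top[of 0]
  proof eventually_elim
    case (elim \<sigma>)
    let ?h = "\<lambda>r. scaleC (cis (- (\<sigma> * l * r))) (W (\<sigma> * r) (f r))"
    show ?case
    proof (rule norm_le_cinner_bound)
      fix \<eta> :: 'a assume "norm \<eta> \<le> 1"
      then have "cmod (integral {a..b} (\<lambda>r. cinner (Z \<sigma> \<eta> r) (f r))) \<le> \<epsilon>" using elim by auto
      then show "cmod (cinner \<eta> (integral {a..b} ?h)) \<le> \<epsilon>"
        using integral_linear[OF Wf[OF elim(2)] bounded_linear_cinner_right[of \<eta>]]
        by (simp add: Zx o_def)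
    qed
  qed
qed

section \<open>The interaction picture\<close>

lemma bounded_op_bounded_linear:
  assumes "bounded_op A"
  shows "bounded_linear A"
proof -
  obtain K where K: "\<And>x. norm (A x) \<le> K * norm x" using assms unfolding bounded_op_def by blast
  show ?thesis
    by (rule bounded_linear_intro[where K = K])
      (use assms K in \<open>auto simp: bounded_op_def clinear_on_def scaleR_scaleC mult.commute\<close>)
qed

definition interaction_picture ::
  "(real \<Rightarrow> 'a::chilbert \<Rightarrow> 'a) \<Rightarrow> (real \<Rightarrow> 'a \<Rightarrow> 'a) \<Rightarrow> real \<Rightarrow> real \<Rightarrow> 'a \<Rightarrow> 'a" where
  "interaction_picture W A \<tau> r x = W (\<tau> * r) (A r (W (- (\<tau> * r)) x))"

lemma dominated_family_interaction_picture:
  assumes W: "exp_itH D H W" and A: "\<forall>r\<in>{0..1}. bounded_selfadjoint (A r)"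
    and L1: "(\<lambda>r. onorm (A r)) integrable_on {0..1}"
  shows "dominated_family (interaction_picture W A \<tau>) (\<lambda>r. onorm (A r))"
  unfolding dominated_family_def
proof (intro conjI ballI L1 allI)
  fix r :: real and x assume r: "r \<in> {0..1}"
  have op: "bounded_op (A r)" using A r by (simp add: bounded_selfadjoint_def)
  note bl = bounded_op_bounded_linear[OF op]
  note u = unitaryD[OF exp_itH_D(1)[OF W]]
  show "0 \<le> onorm (A r)" by (rule onorm_pos_le[OF bl])
  show "clinear_on UNIV (interaction_picture W A \<tau> r)"
    using op by (simp add: clinear_on_def interaction_picture_def bounded_op_def u)
  show "norm (interaction_picture W A \<tau> r x) \<le> onorm (A r) * norm x"
    using onorm[OF bl, of "W (- (\<tau> * r)) x"] by (simp add: interaction_picture_def u)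
qed

text \<open>In the Duhamel formula at time \<open>\<tau> * s\<close> the substitution of
  \<open>\<tau> * r\<close> for the time variable cancels the factor \<open>1 / \<tau>\<close> of
  the perturbation. Applying \<open>W (\<tau> * s)\<close> merges the two group factors into
  \<open>W (\<tau> * r)\<close>.\<close>

lemma mild_solution_interaction_picture:
  fixes V :: "real \<Rightarrow> 'a::chilbert \<Rightarrow> 'a"
  assumes W: "exp_itH D H W" and \<tau>: "0 < \<tau>"
    and V: "solves_schroedinger W (\<lambda>t. scaleR (1 / \<tau>) \<circ> A (t / \<tau>)) \<tau> V"
  shows "mild_solution (interaction_picture W A \<tau>) (\<lambda>s. W (\<tau> * s) (V (\<tau> * s) \<psi>))"
    and "W (\<tau> * 0) (V (\<tau> * 0) \<psi>) = \<psi>"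
proof -
  note u = unitaryD[OF exp_itH_D(1)[OF W]]
  define x where "x s = W (\<tau> * s) (V (\<tau> * s) \<psi>)" for s
  let ?B = "interaction_picture W A \<tau>"
  have ex: "\<exists>J. ((\<lambda>r. ?B r (x r)) has_integral J) {0..s} \<and> x s = \<psi> - scaleC \<i> J" if s: "s \<in> {0..1}" for s
  proof -
    let ?t = "\<tau> * s"
    have t: "?t \<in> {0..\<tau>}" using s \<tau> by (simp add: mult_left_le)
    obtain I where I: "((\<lambda>r. W (r - ?t) ((scaleR (1 / \<tau>) \<circ> A (r / \<tau>)) (V r \<psi>))) has_integral I) {0..?t}"
      and Vt: "V ?t \<psi> = W (- ?t) \<psi> - scaleC \<i> I"
      using V t unfolding solves_schroedinger_def by blast
    have img: "(\<lambda>x. x / \<tau>) ` {0..?t} = {0..s}"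
      using \<tau> s by (simp add: image_divide_atLeastAtMost)
    have "((\<lambda>r. W ?t (W (\<tau> * r - ?t) ((1 / \<tau>) *\<^sub>R A r (V (\<tau> * r) \<psi>)))) has_integral W ?t ((1 / \<tau>) *\<^sub>R I)) {0..s}"
      using has_integral_linear[OF has_integral_stretch_real[OF I, of \<tau>] u(5)] \<tau>
      by (simp add: o_def img)
    moreover have "W ?t (W (\<tau> * r - ?t) ((1 / \<tau>) *\<^sub>R A r (V (\<tau> * r) \<psi>))) = (1 / \<tau>) *\<^sub>R ?B r (x r)" for r
    proof -
      have "W (- (\<tau> * r)) (x r) = V (\<tau> * r) \<psi>"
        using exp_itH_D(6)[OF W, of "- (\<tau> * r)"] by (simp add: x_def)
      moreover have "W ?t (W (\<tau> * r - ?t) z) = W (\<tau> * r) z" for z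
        using exp_itH_D(3)[OF W, of ?t "\<tau> * r - ?t" z] by simp
      ultimately show ?thesis
        by (simp add: interaction_picture_def scaleR_scaleC u)
    qed
    ultimately have "((\<lambda>r. (1 / \<tau>) *\<^sub>R ?B r (x r)) has_integral (1 / \<tau>) *\<^sub>R W ?t I) {0..s}"
      by (simp add: scaleR_scaleC u)
    from has_integral_cmul[OF this, of \<tau>] have "((\<lambda>r. ?B r (x r)) has_integral W ?t I) {0..s}"
      using \<tau> by simp
    moreover have "x s = \<psi> - scaleC \<i> (W ?t I)"
      by (simp add: x_def Vt u exp_itH_D(6)[OF W])
    ultimately show ?thesis by blast
  qed
  have x0: "x 0 = \<psi>"
  proof -
    obtain J where "((\<lambda>r. ?B r (x r)) has_integral J) {0..0}" "x 0 = \<psi> - scaleC \<i> J"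
      using ex[of 0] by auto
    moreover from integral_unique[OF this(1)] have "J = 0" by simp
    ultimately show ?thesis by simp
  qed
  then show "W (\<tau> * 0) (V (\<tau> * 0) \<psi>) = \<psi>" by (simp add: x_def)
  have "mild_solution ?B x" unfolding mild_solution_def
  proof (intro conjI ballI)
    have "continuous_on {0..\<tau>} (\<lambda>t. V t \<psi>)" using V by (simp add: solves_schroedinger_def)
    then have "continuous_on {0..1} (\<lambda>s. V (\<tau> * s) \<psi>)"
      by (rule continuous_on_compose2) (use \<tau> in \<open>auto intro!: continuous_intros simp: mult_left_le\<close>)
    then show "continuous_on {0..1} x"
      unfolding x_def by (intro continuous_on_exp_itH[OF W] continuous_intros)
    show "(\<lambda>r. ?B r (x r)) integrable_on {0..1}" using ex[of 1] by (auto simp: integrable_on_def)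
    fix s :: real assume "s \<in> {0..1}"
    from ex[OF this] show "x s = x 0 - scaleC \<i> (integral {0..s} (\<lambda>r. ?B r (x r)))"
      unfolding x0 by (metis integral_unique)
  qed
  then show "mild_solution ?B (\<lambda>s. W (\<tau> * s) (V (\<tau> * s) \<psi>))" by (simp add: x_def[abs_def])
qed

text \<open>The constant precedes \<open>B\<close> and \<open>x\<close>, so it is the same for all
  \<open>\<tau>\<close>. Applied to differences, the bound also yields uniqueness.\<close>

lemma mild_solution_Gronwall:
  assumes g: "g integrable_on {0..1}" and g0: "\<And>r. r \<in> {0..1} \<Longrightarrow> 0 \<le> g r"
  shows "\<exists>C\<ge>0. \<forall>B (x::real \<Rightarrow> 'a::chilbert). dominated_family B g \<longrightarrow> mild_solution B x \<longrightarrow>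
      (\<forall>s\<in>{0..1}. norm (x s) \<le> C * norm (x 0))"
proof -
  obtain C where C: "C \<ge> 0" "\<forall>u c. continuous_on {0..1} u \<longrightarrow>
      (\<forall>s\<in>{0..1}. 0 \<le> u s \<and> u s \<le> c + integral {0..s} (\<lambda>r. g r * u r)) \<longrightarrow> (\<forall>s\<in>{0..1}. u s \<le> C * c)"
    using Gronwall_constant[OF g g0] by blast
  have "norm (x s) \<le> C * norm (x 0)"
    if B: "dominated_family B g" and x: "mild_solution B x" and s: "s \<in> {0..1}" for B and x :: "real \<Rightarrow> 'a" and s
  proof (rule C(2)[rule_format, OF _ _ s])
    show "continuous_on {0..1} (\<lambda>s. norm (x s))" by (intro continuous_on_norm mild_solutionD(1)[OF x])
    fix s :: real assume s: "s \<in> {0..1}"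
    show "0 \<le> norm (x s) \<and> norm (x s) \<le> norm (x 0) + integral {0..s} (\<lambda>r. g r * norm (x r))"
      using mild_solution_norm_bound[OF B x, of 0 s] s norm_triangle_sub[of "x s" "x 0"] by simp
  qed
  then show ?thesis using C(1) by blast
qed

text \<open>The common majorant \<open>g\<close> makes the functions \<open>R \<tau>\<close>
  eventually equicontinuous, and by compactness of the interval pointwise smallness becomes
  uniform.\<close>

lemma eventually_small_uniformly:
  fixes R :: "real \<Rightarrow> real \<Rightarrow> 'a::real_normed_vector" and g :: "real \<Rightarrow> real"
  assumes g: "g integrable_on {0..1}" and g0: "\<And>r. r \<in> {0..1} \<Longrightarrow> 0 \<le> g r"
    and inc: "\<forall>\<^sub>F \<tau> in F. \<forall>a b. 0 \<le> a \<longrightarrow> a \<le> b \<longrightarrow> b \<le> 1 \<longrightarrow> norm (R \<tau> b - R \<tau> a) \<le> integral {a..b} g"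
    and pt: "\<And>s e. s \<in> {0..1} \<Longrightarrow> 0 < e \<Longrightarrow> \<forall>\<^sub>F \<tau> in F. norm (R \<tau> s) \<le> e" and e: "0 < e"
  shows "\<forall>\<^sub>F \<tau> in F. \<forall>s\<in>{0..1}. norm (R \<tau> s) \<le> e"
proof -
  define P where "P a b \<longleftrightarrow> (0 \<le> a \<longrightarrow> b \<le> 1 \<longrightarrow> (\<forall>\<^sub>F \<tau> in F. \<forall>s\<in>{a..b}. norm (R \<tau> s) \<le> e))" for a b
  have "P 0 1"
  proof (rule Bolzano[of 0 1 P])
    fix a b c :: real assume t: "P a b" "P b c" "a \<le> b" "b \<le> c"
    show "P a c" unfolding P_def
    proof (intro impI)
      assume ac: "0 \<le> a" "c \<le> 1"
      have "\<forall>\<^sub>F \<tau> in F. \<forall>s\<in>{a..b}. norm (R \<tau> s) \<le> e" "\<forall>\<^sub>F \<tau> in F. \<forall>s\<in>{b..c}. norm (R \<tau> s) \<le> e"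
        using t ac unfolding P_def by auto
      then show "\<forall>\<^sub>F \<tau> in F. \<forall>s\<in>{a..c}. norm (R \<tau> s) \<le> e"
        by eventually_elim (metis atLeastAtMost_iff linear)
    qed
  next
    fix x :: real assume x: "0 \<le> x" "x \<le> 1"
    obtain d where d: "d > 0" "\<And>a b. \<lbrakk>0 \<le> a; a \<le> x; x \<le> b; b \<le> 1; b - a < d\<rbrakk> \<Longrightarrow> integral {a..b} g \<le> e / 2"
      using indefinite_integral_small_increment[OF g g0, of "e/2" x] x e by auto
    have "P a b" if ab: "a \<le> x" "x \<le> b" "b - a < d" for a b
      unfolding P_def
    proof (intro impI)
      assume a0: "0 \<le> a" and b1: "b \<le> 1"
      have "\<forall>\<^sub>F \<tau> in F. norm (R \<tau> x) \<le> e / 2" by (rule pt) (use x e in auto)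
      then show "\<forall>\<^sub>F \<tau> in F. \<forall>s\<in>{a..b}. norm (R \<tau> s) \<le> e" using inc
      proof eventually_elim
        case (elim \<tau>)
        show ?case
        proof
          fix s assume s: "s \<in> {a..b}"
          have "norm (R \<tau> s - R \<tau> x) \<le> e / 2"
          proof (cases "s \<le> x")
            case True
            then have "norm (R \<tau> x - R \<tau> s) \<le> integral {s..x} g" using elim s a0 x by simp
            also have "\<dots> \<le> e / 2" using d(2)[of s x] True s a0 x ab by simp
            finally show ?thesis by (simp add: norm_minus_commute)
          next
            case False
            then have "norm (R \<tau> s - R \<tau> x) \<le> integral {x..s} g" using elim s b1 x by simp
            also have "\<dots> \<le> e / 2" using d(2)[of x s] False s b1 x ab by simp
            finally show ?thesis .
          qed
          then show "norm (R \<tau> s) \<le> e" using elim norm_triangle_sub[of "R \<tau> s" "R \<tau> x"] by linarith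
        qed
      qed
    qed
    then show "\<exists>d>0. \<forall>a b. a \<le> x \<and> x \<le> b \<and> b - a < d \<longrightarrow> P a b" using d(1) by blast
  qed simp
  then show ?thesis unfolding P_def by simp
qed

text \<open>The error \<open>R\<close> is added to the integrated equation and enters only through
  its supremum. No norm is taken under its integral sign, so cancellation by oscillation is not
  lost.\<close>

lemma mild_solution_perturbation:
  assumes g: "g integrable_on {0..1}" and g0: "\<And>r. r \<in> {0..1} \<Longrightarrow> 0 \<le> g r"
  shows "\<exists>C\<ge>0. \<forall>B (x::real \<Rightarrow> 'a::chilbert) y R c. dominated_family B g \<longrightarrow> mild_solution B x \<longrightarrow>
      continuous_on {0..1} y \<longrightarrow> (\<lambda>r. B r (y r)) integrable_on {0..1} \<longrightarrow>
      (\<forall>s\<in>{0..1}. y s = x 0 - scaleC \<i> (integral {0..s} (\<lambda>r. B r (y r)) - R s) \<and> norm (R s) \<le> c) \<longrightarrow>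
      (\<forall>s\<in>{0..1}. norm (x s - y s) \<le> C * c)"
proof -
  obtain C where C: "C \<ge> 0" "\<forall>u c. continuous_on {0..1} u \<longrightarrow>
      (\<forall>s\<in>{0..1}. 0 \<le> u s \<and> u s \<le> c + integral {0..s} (\<lambda>r. g r * u r)) \<longrightarrow> (\<forall>s\<in>{0..1}. u s \<le> C * c)"
    using Gronwall_constant[OF g g0] by blast
  have "norm (x s - y s) \<le> C * c"
    if B: "dominated_family B g" and x: "mild_solution B x" and y: "continuous_on {0..1} y"
      and yi: "(\<lambda>r. B r (y r)) integrable_on {0..1}"
      and yR: "\<And>s. s \<in> {0..1} \<Longrightarrow> y s = x 0 - scaleC \<i> (integral {0..s} (\<lambda>r. B r (y r)) - R s)"
      and Rc: "\<And>s. s \<in> {0..1} \<Longrightarrow> norm (R s) \<le> c" and s: "s \<in> {0..1}"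
    for B and x y :: "real \<Rightarrow> 'a" and R c s
  proof (rule C(2)[rule_format, OF _ _ s])
    show c: "continuous_on {0..1} (\<lambda>s. norm (x s - y s))"
      by (intro continuous_on_norm continuous_on_diff mild_solutionD(1)[OF x] y)
    fix s :: real assume s: "s \<in> {0..1}"
    have sub: "{0..s} \<subseteq> {0..1}" using s by auto
    have xi': "(\<lambda>r. B r (x r)) integrable_on {0..s}" and yi': "(\<lambda>r. B r (y r)) integrable_on {0..s}"
      by (rule integrable_on_subinterval[OF _ sub], rule mild_solutionD(2)[OF x] yi)+
    let ?I = "integral {0..s} (\<lambda>r. B r (x r) - B r (y r))"
    have gi: "(\<lambda>r. g r * norm (x r - y r)) integrable_on {0..s}"
      using integrable_scaleR_continuous[OF integrable_on_subinterval[OF g sub] _ continuous_on_subset[OF c sub]] g0 sub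
      by auto
    have "norm ?I \<le> integral {0..s} (\<lambda>r. g r * norm (x r - y r))"
    proof (rule integral_norm_bound_integral[OF integrable_diff[OF xi' yi'] gi])
      fix r assume "r \<in> {0..s}"
      then have r: "r \<in> {0..1}" using sub by auto
      show "norm (B r (x r) - B r (y r)) \<le> g r * norm (x r - y r)"
        using dominated_familyD(3)[OF B r, of "x r - y r"] by (simp add: dominated_familyD(6)[OF B r])
    qed
    moreover have "x s - y s = - scaleC \<i> ?I - scaleC \<i> (R s)"
    proof -
      have "?I = integral {0..s} (\<lambda>r. B r (x r)) - integral {0..s} (\<lambda>r. B r (y r))"
        by (rule Henstock_Kurzweil_Integration.integral_diff[OF xi' yi'])
      then show ?thesis
        by (subst mild_solutionD(3)[OF x s], subst yR[OF s]) (simp add: scaleC_diff_right)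
    qed
    then have "norm (x s - y s) \<le> norm ?I + norm (R s)"
      using norm_triangle_ineq4[of "- scaleC \<i> ?I" "scaleC \<i> (R s)"] by (simp add: norm_scaleC)
    ultimately show "0 \<le> norm (x s - y s) \<and> norm (x s - y s) \<le> c + integral {0..s} (\<lambda>r. g r * norm (x r - y r))"
      using Rc[OF s] by simp
  qed
  then show ?thesis using C(1) by blast
qed

text \<open>On an eigenvector the right-hand group factor is a phase, and linearity of
  \<open>A r\<close> pulls it out.\<close>

lemma interaction_picture_eigenvector:
  fixes D :: "'a::chilbert set"
  assumes W: "exp_itH D H W" and A: "clinear_on UNIV (A r)"
    and y: "y \<in> eigenspace D H (complex_of_real l)"
  shows "interaction_picture W A \<tau> r y = scaleC (cis (- (\<tau> * l * r))) (W (\<tau> * r) (A r y))"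
proof -
  have "A r (scaleC c x) = scaleC c (A r x)" for c x using A by (simp add: clinear_on_def)
  moreover have "l * - (\<tau> * r) = - (\<tau> * l * r)" by simp
  ultimately show ?thesis
    by (simp only: interaction_picture_def exp_itH_eigenvector[OF W y] unitaryD(2)[OF exp_itH_D(1)[OF W]])
qed

text \<open>The projection turns the left-hand group factor into the phase inverse to the one from
  the right, so the resonant part does not depend on \<open>\<tau>\<close>.\<close>

lemma spec_proj_interaction_picture:
  fixes D :: "'a::chilbert set"
  assumes sa: "selfadjoint D H" and pp: "pure_point D H" and W: "exp_itH D H W"
    and A: "clinear_on UNIV (A r)" and y: "y \<in> eigenspace D H (complex_of_real l)"
  shows "spec_proj D H (complex_of_real l) (interaction_picture W A \<tau> r y)
      = spec_proj D H (complex_of_real l) (A r y)"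
proof -
  have "cis (- (\<tau> * l * r)) * cis (l * (\<tau> * r)) = 1" by (simp add: cis_mult)
  then show ?thesis
    by (simp only: interaction_picture_eigenvector[where A = A and r = r, OF W A y] spec_proj_scaleC[OF sa pp]
        spec_proj_exp_itH[OF sa pp W] scaleC_scaleC scaleC_one)
qed

text \<open>The parameters \<open>\<sigma> + 1\<close> and \<open>1\<close> differ by a phase and a
  group element whose product fixes the eigenspace pointwise, and which therefore passes through
  \<open>Q\<close>. The reference parameter is \<open>1\<close> because evolutions are supplied for
  positive parameters only.\<close>

lemma interaction_picture_rescale:
  fixes D :: "'a::chilbert set"
  assumes sa: "selfadjoint D H" and pp: "pure_point D H" and W: "exp_itH D H W"
    and A: "clinear_on UNIV (A r)" and y: "y \<in> eigenspace D H (complex_of_real l)"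
  defines "Q \<equiv> \<lambda>x. x - spec_proj D H (complex_of_real l) x"
  shows "Q (interaction_picture W A (\<sigma> + 1) r y)
      = scaleC (cis (- (\<sigma> * l * r))) (W (\<sigma> * r) (Q (interaction_picture W A 1 r y)))"
proof -
  let ?P = "spec_proj D H (complex_of_real l)"
  note u = unitaryD[OF exp_itH_D(1)[OF W]]
  have "cis (- ((\<sigma> + 1) * l * r)) = cis (- (\<sigma> * l * r)) * cis (- (1 * l * r))"
    by (simp add: cis_mult algebra_simps)
  moreover have "W ((\<sigma> + 1) * r) x = W (\<sigma> * r) (W (1 * r) x)" for x
    using exp_itH_D(3)[OF W, of "\<sigma> * r" "1 * r" x] by (simp add: distrib_right)
  ultimately have 1: "interaction_picture W A (\<sigma> + 1) r y
      = scaleC (cis (- (\<sigma> * l * r))) (W (\<sigma> * r) (interaction_picture W A 1 r y))"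
    by (simp only: interaction_picture_eigenvector[where A = A and r = r, OF W A y] u scaleC_scaleC)
  have "cis (- (\<sigma> * l * r)) * cis (l * (\<sigma> * r)) = 1" by (simp add: cis_mult)
  then have "scaleC (cis (- (\<sigma> * l * r))) (W (\<sigma> * r) (?P x)) = ?P x" for x
    by (simp only: exp_itH_eigenvector[OF W spec_proj_in[OF sa pp]] scaleC_scaleC scaleC_one)
  then show ?thesis
    unfolding Q_def u(6) scaleC_diff_right 1[symmetric] spec_proj_interaction_picture[where A = A and r = r, OF sa pp W A y] by simp
qed

lemma eigenvector_limit:
  fixes D :: "'a::chilbert set"
  assumes sa: "selfadjoint D H" and pp: "pure_point D H" and W: "exp_itH D H W"
    and A: "\<forall>r\<in>{0..1}. bounded_selfadjoint (A r)"
    and L1: "(\<lambda>r. onorm (A r)) integrable_on {0..1}"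
    and U: "\<forall>\<tau>>0. solves_schroedinger W (\<lambda>t. scaleR (1 / \<tau>) \<circ> A (t / \<tau>)) \<tau> (U \<tau>)"
    and Omega_unitary: "\<forall>r\<in>{0..1}. unitary (Omega r)"
    and Omega_comm: "\<forall>r\<in>{0..1}. commutes_with D H (Omega r)"
    and Omega: "solves_schroedinger (\<lambda>_. id) (\<lambda>r. diag_part D H (A r)) 1 Omega"
    and s: "s \<in> {0..1}" and E: "E \<in> eigenvalues D H" and \<psi>: "\<psi> \<in> eigenspace D H E"
  shows "((\<lambda>\<tau>. W (\<tau> * s) (U \<tau> (\<tau> * s) \<psi>)) \<longlongrightarrow> Omega s \<psi>) at_top"
proof -
  obtain v where "v \<in> eigenspace D H E" "v \<noteq> 0" using E by (auto simp: eigenvalues_def eigenspace_def)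
  then obtain l where l: "E = complex_of_real l" using eigenvalue_real[OF sa] by blast
  define y where "y r = Omega r \<psi>" for r
  define P where "P = spec_proj D H E"
  define K where "K = interaction_picture W A"
  define g where "g r = onorm (A r)" for r
  have lin: "clinear_on UNIV (A r)" if "r \<in> {0..1}" for r
    using A that by (simp add: bounded_selfadjoint_def bounded_op_def)
  have dom: "dominated_family (K \<tau>) g" for \<tau>
    using dominated_family_interaction_picture[OF W A L1] by (simp add: K_def g_def[abs_def])
  note gi = dominated_familyD(1)[OF dom] and g0 = dominated_familyD(2)[OF dom]
  have yM: "y r \<in> eigenspace D H E" if "r \<in> {0..1}" for r
    using Omega_comm Omega_unitary that \<psi>
    by (simp add: y_def eigenspace_def commutes_with_def unitaryD(2))
  have yn: "norm (y r) = norm \<psi>" if "r \<in> {0..1}" for r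
    using Omega_unitary that by (simp add: y_def unitaryD(3))
  have yc: "continuous_on {0..1} y"
    using Omega by (simp add: solves_schroedinger_def y_def)
  \<comment> \<open>The right-hand side is the same for every \<open>\<tau>\<close>, so the single
    equation of \<open>Omega\<close> can be compared with the equation for each
    \<open>\<tau>\<close>.\<close>
  have diag: "diag_part D H (A r) (y r) = P (K \<tau> r (y r))" if r: "r \<in> {0..1}" for r \<tau>
  proof -
    have "A r (scaleC 0 0) = scaleC 0 (A r 0)" using lin[OF r] unfolding clinear_on_def by blast
    then have "A r 0 = 0" by simp
    from diag_part_eigenvector[where A = "A r", OF sa E yM[OF r] this] show ?thesis
      using spec_proj_interaction_picture[where A = A and r = r, OF sa pp W lin[OF r] yM[OF r, unfolded l]]
      by (simp add: P_def K_def l)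
  qed
  have Ky: "(\<lambda>r. K \<tau> r (y r)) integrable_on {0..1}" if \<tau>: "0 < \<tau>" for \<tau>
  proof (rule dominated_family_integrable[OF dom _ yc])
    fix \<phi>
    show "\<exists>x. mild_solution (K \<tau>) x \<and> x 0 = \<phi>"
      unfolding K_def using mild_solution_interaction_picture[OF W \<tau> U[rule_format, OF \<tau>]] by blast
  qed
  note Plin = bounded_linear_spec_proj[OF sa pp, of E, folded P_def]
  define q where "q \<tau> r = K \<tau> r (y r) - P (K \<tau> r (y r))" for \<tau> r
  have PKy: "(\<lambda>r. P (K \<tau> r (y r))) integrable_on {0..1}" if "0 < \<tau>" for \<tau>
    using integrable_linear[OF Ky[OF that] Plin] by (simp add: o_def)
  have qi: "q \<tau> integrable_on {0..1}" if "0 < \<tau>" for \<tau>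
    unfolding q_def by (rule integrable_diff[OF Ky[OF that] PKy[OF that]])
  \<comment> \<open>The factor \<open>norm \<psi>\<close> is the constant norm of \<open>y\<close>;
    the summand 1 provides the lower bound on the majorant that the averaging argument asks
    for.\<close>
  define g' where "g' r = g r * norm \<psi> + 1" for r
  have g'i: "g' integrable_on {0..1}"
    unfolding g'_def by (intro integrable_add integrable_on_mult_left gi) auto
  have g'1: "1 \<le> g' r" if "r \<in> {0..1}" for r using g0[OF that] by (simp add: g'_def)
  have qg: "norm (q \<tau> r) \<le> g' r" if r: "r \<in> {0..1}" for \<tau> r
  proof -
    have "norm (q \<tau> r) \<le> norm (K \<tau> r (y r))"
      unfolding q_def P_def by (rule spec_proj_complement_norm_le[OF sa pp])
    also have "\<dots> \<le> g r * norm \<psi>" using dominated_familyD(3)[OF dom r, where x = "y r"] yn[OF r] by simp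
    finally show ?thesis by (simp add: g'_def)
  qed
  define R where "R \<tau> t = integral {0..t} (q \<tau>)" for \<tau> t
  have pointwise: "\<forall>\<^sub>F \<tau> in at_top. norm (R \<tau> t) \<le> e" if t: "t \<in> {0..1}" and e: "0 < e" for t e
  proof (cases "t = 0")
    case True
    then show ?thesis using e by (simp add: R_def)
  next
    case False
    then have t0: "0 < t" and sub: "{0..t} \<subseteq> {0..1}" using t by auto
    have rescale: "q (\<sigma> + 1) r = scaleC (cis (- (\<sigma> * l * r))) (W (\<sigma> * r) (q 1 r))" if "r \<in> {0..t}" for \<sigma> r
    proof -
      have r: "r \<in> {0..1}" using that sub by auto
      show ?thesis
        using interaction_picture_rescale[where A = A and r = r, OF sa pp W lin[OF r] yM[OF r, unfolded l]]
        by (simp add: q_def K_def P_def l)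
    qed
    have "\<forall>\<^sub>F \<sigma> in at_top. norm (integral {0..t} (\<lambda>r. scaleC (cis (- (\<sigma> * l * r))) (W (\<sigma> * r) (q 1 r)))) \<le> e"
    proof (rule oscillatory_integral_tends_to_zero[OF sa pp W t0 _ _ _ _ _ _ e])
      show "q 1 integrable_on {0..t}" "g' integrable_on {0..t}"
        by (rule integrable_on_subinterval[OF _ sub], rule qi g'i, simp?)+
      show "norm (q 1 r) \<le> g' r" "1 \<le> g' r" if "r \<in> {0..t}" for r using that sub qg g'1 by auto
      show "spec_proj D H (complex_of_real l) (q 1 r) = 0" if "r \<in> {0..t}" for r
        using linear_diff[OF bounded_linear.linear[OF Plin]]
          spec_proj_id[OF sa spec_proj_in[OF sa pp, of E]] by (simp add: q_def P_def flip: l)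
      show "(\<lambda>r. scaleC (cis (- (\<sigma> * l * r))) (W (\<sigma> * r) (q 1 r))) integrable_on {0..t}" if "0 < \<sigma>" for \<sigma>
        \<comment> \<open>By \<open>rescale\<close> the rotated integrand coincides with
          \<open>q (\<sigma> + 1)\<close>, whose integrability is known.\<close>
        by (rule integrable_eq[OF integrable_on_subinterval[OF qi[of "\<sigma> + 1"] sub] rescale]) (use that in auto)
    qed
    moreover have "R (\<sigma> + 1) t = integral {0..t} (\<lambda>r. scaleC (cis (- (\<sigma> * l * r))) (W (\<sigma> * r) (q 1 r)))" for \<sigma>
      unfolding R_def by (rule Henstock_Kurzweil_Integration.integral_cong[OF rescale])
    ultimately have "\<forall>\<^sub>F \<sigma> in at_top. norm (R (\<sigma> + 1) t) \<le> e" by simp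
    \<comment> \<open>Undoes the shift between the frequency and the adiabatic parameter:
      \<open>\<sigma> = \<tau> - 1\<close>.\<close>
    moreover have "filterlim (\<lambda>\<tau>. \<tau> - 1 :: real) at_top at_top"
      using filterlim_tendsto_add_at_top[OF tendsto_const[of "-1"] filterlim_ident] by simp
    ultimately have "\<forall>\<^sub>F \<tau> in at_top. norm (R (\<tau> - 1 + 1) t) \<le> e" by (rule eventually_compose_filterlim)
    then show ?thesis by simp
  qed
  have uniform: "\<forall>\<^sub>F \<tau> in at_top. \<forall>t\<in>{0..1}. norm (R \<tau> t) \<le> e" if e: "0 < e" for e
  proof (rule eventually_small_uniformly[OF g'i _ _ pointwise e])
    show "0 \<le> g' r" if "r \<in> {0..1}" for r using g'1[OF that] by simp
    show "\<forall>\<^sub>F \<tau> in at_top. \<forall>a b. 0 \<le> a \<longrightarrow> a \<le> b \<longrightarrow> b \<le> 1 \<longrightarrow> norm (R \<tau> b - R \<tau> a) \<le> integral {a..b} g'"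
      using eventually_gt_at_top[of 0]
    proof eventually_elim
      case (elim \<tau>)
      show ?case
      proof (intro allI impI)
        fix a b :: real assume ab: "0 \<le> a" "a \<le> b" "b \<le> 1"
        have "integral {0..a} (q \<tau>) + integral {a..b} (q \<tau>) = integral {0..b} (q \<tau>)"
          by (rule Henstock_Kurzweil_Integration.integral_combine)
            (use ab in \<open>auto intro: integrable_on_subinterval[OF qi[OF elim]]\<close>)
        then have "R \<tau> b - R \<tau> a = integral {a..b} (q \<tau>)" by (simp add: R_def algebra_simps)
        moreover have "norm (integral {a..b} (q \<tau>)) \<le> integral {a..b} g'"
          by (rule integral_norm_bound_integral)
            (use ab qg in \<open>auto intro: integrable_on_subinterval[OF qi[OF elim]] integrable_on_subinterval[OF g'i]\<close>)
        ultimately show "norm (R \<tau> b - R \<tau> a) \<le> integral {a..b} g'" by simp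
      qed
    qed
  qed
  obtain C where C: "C \<ge> 0" "\<forall>B (x::real \<Rightarrow> 'a) y R c. dominated_family B g \<longrightarrow> mild_solution B x \<longrightarrow>
      continuous_on {0..1} y \<longrightarrow> (\<lambda>r. B r (y r)) integrable_on {0..1} \<longrightarrow>
      (\<forall>s\<in>{0..1}. y s = x 0 - scaleC \<i> (integral {0..s} (\<lambda>r. B r (y r)) - R s) \<and> norm (R s) \<le> c) \<longrightarrow>
      (\<forall>s\<in>{0..1}. norm (x s - y s) \<le> C * c)"
    using mild_solution_perturbation[OF gi g0] by blast
  \<comment> \<open>The integrand of the limit equation is \<open>P (K \<tau> r (y r))\<close>, that
    is, the full integrand minus \<open>q \<tau> r\<close>. This puts \<open>y\<close> into the form
    required by the perturbation lemma.\<close>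
  have yR: "y t = \<psi> - scaleC \<i> (integral {0..t} (\<lambda>r. K \<tau> r (y r)) - R \<tau> t)" if t: "t \<in> {0..1}" and \<tau>: "0 < \<tau>" for t \<tau>
  proof -
    have sub: "{0..t} \<subseteq> {0..1}" using t by auto
    obtain I where I: "((\<lambda>r. diag_part D H (A r) (y r)) has_integral I) {0..t}" and yI: "y t = \<psi> - scaleC \<i> I"
      using Omega t unfolding solves_schroedinger_def y_def id_apply by blast
    have "I = integral {0..t} (\<lambda>r. diag_part D H (A r) (y r))" using I by (simp add: integral_unique)
    also have "\<dots> = integral {0..t} (\<lambda>r. P (K \<tau> r (y r)))"
      by (rule Henstock_Kurzweil_Integration.integral_cong) (use diag sub in auto)
    also have "\<dots> = integral {0..t} (\<lambda>r. K \<tau> r (y r)) - R \<tau> t"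
      unfolding R_def q_def
      using Henstock_Kurzweil_Integration.integral_diff[OF integrable_on_subinterval[OF Ky[OF \<tau>] sub]
          integrable_on_subinterval[OF PKy[OF \<tau>] sub]] by simp
    finally show ?thesis using yI by simp
  qed
  show ?thesis
  proof (rule tendstoI)
    fix \<epsilon> :: real assume eps: "0 < \<epsilon>"
    define c where "c = \<epsilon> / (2 * (C + 1))"
    have c: "0 < c" using eps C(1) by (simp add: c_def)
    have Cc: "C * c < \<epsilon>"
    proof -
      have "C * c \<le> (C + 1) * c" using c by simp
      also have "\<dots> = \<epsilon> / 2" using C(1) by (simp add: c_def field_simps)
      finally show ?thesis using eps by simp
    qed
    show "\<forall>\<^sub>F \<tau> in at_top. dist (W (\<tau> * s) (U \<tau> (\<tau> * s) \<psi>)) (Omega s \<psi>) < \<epsilon>"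
      using uniform[OF c] eventually_gt_at_top[of 0]
    proof eventually_elim
      case (elim \<tau>)
      let ?x = "\<lambda>s. W (\<tau> * s) (U \<tau> (\<tau> * s) \<psi>)"
      note sol = mild_solution_interaction_picture[OF W elim(2) U[rule_format, OF elim(2)], of \<psi>, folded K_def]
      have "norm (?x s - y s) \<le> C * c"
      proof (rule C(2)[rule_format, OF dom sol(1) yc Ky[OF elim(2)] _ s])
        fix t :: real assume t: "t \<in> {0..1}"
        show "y t = ?x 0 - scaleC \<i> (integral {0..t} (\<lambda>r. K \<tau> r (y r)) - R \<tau> t) \<and> norm (R \<tau> t) \<le> c"
          using yR[OF t elim(2)] elim(1) t unfolding sol(2) by blast
      qed
      then show ?case using Cc by (simp add: dist_norm y_def)
    qed
  qed
qed

section \<open>Extension from eigenvectors to all vectors by linearity and density\<close>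

theorem theorem2:
  fixes D :: "'a::chilbert set" and Ho :: "'a \<Rightarrow> 'a"
    and W :: "real \<Rightarrow> 'a \<Rightarrow> 'a"
    and Lambda :: "real \<Rightarrow> 'a \<Rightarrow> 'a"
    and U :: "real \<Rightarrow> real \<Rightarrow> 'a \<Rightarrow> 'a"
    and Omega :: "real \<Rightarrow> 'a \<Rightarrow> 'a"
    and s :: real
  assumes Ho_sa: "selfadjoint D Ho"
    and Ho_pp: "pure_point D Ho"
    and W: "exp_itH D Ho W"
    and Lambda_sa: "\<forall>r\<in>{0..1}. bounded_selfadjoint (Lambda r)"
    and Lambda_L1: "(\<lambda>r. onorm (Lambda r)) integrable_on {0..1}"
    and U: "\<forall>\<tau>>0. solves_schroedinger W (\<lambda>t. scaleR (1 / \<tau>) \<circ> Lambda (t / \<tau>)) \<tau> (U \<tau>)"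
    and Omega_unitary: "\<forall>r\<in>{0..1}. unitary (Omega r)"
    and Omega_comm: "\<forall>r\<in>{0..1}. commutes_with D Ho (Omega r)"
    and Omega: "solves_schroedinger (\<lambda>_. id) (\<lambda>r. diag_part D Ho (Lambda r)) 1 Omega"
    and s: "s \<in> {0..1}"
  shows "\<forall>\<psi>. ((\<lambda>\<tau>. W (\<tau> * s) (U \<tau> (\<tau> * s) \<psi>)) \<longlongrightarrow> Omega s \<psi>) at_top"
proof -
  define X where "X \<tau> \<psi> t = W (\<tau> * t) (U \<tau> (\<tau> * t) \<psi>)" for \<tau> \<psi> t
  define g where "g r = onorm (Lambda r)" for r
  let ?B = "interaction_picture W Lambda"
  have dom: "dominated_family (?B \<tau>) g" for \<tau>
    using dominated_family_interaction_picture[OF W Lambda_sa Lambda_L1] by (simp add: g_def[abs_def])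
  have sol: "mild_solution (?B \<tau>) (X \<tau> \<psi>)" and X0: "X \<tau> \<psi> 0 = \<psi>" if "0 < \<tau>" for \<tau> \<psi>
    using mild_solution_interaction_picture[OF W that U[rule_format, OF that], of \<psi>]
    by (simp_all add: X_def[abs_def])
  obtain C where C: "C \<ge> 0" "\<forall>B (x::real \<Rightarrow> 'a). dominated_family B g \<longrightarrow> mild_solution B x \<longrightarrow>
      (\<forall>s\<in>{0..1}. norm (x s) \<le> C * norm (x 0))"
    using mild_solution_Gronwall[OF dominated_familyD(1,2)[OF dom]] by blast
  note bound = C(2)[rule_format, OF dom]
  note Om = unitaryD[OF Omega_unitary[rule_format, OF s]]
  have diff: "mild_solution (?B \<tau>) (\<lambda>t. x t - y t)"
    if "mild_solution (?B \<tau>) x" "mild_solution (?B \<tau>) y" for \<tau> x y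
    using mild_solution_add[OF dom that(1) mild_solution_scaleC[OF dom that(2), of "-1"]]
    by (simp add: scaleC_minus_left scaleC_one)
  \<comment> \<open>Linearity of \<open>U \<tau>\<close> is not contained in its equation. The
    difference of both sides is a mild solution with initial value zero, and the Gronwall bound
    forces it to vanish.\<close>
  have X_add: "X \<tau> (\<phi> + \<psi>) s = X \<tau> \<phi> s + X \<tau> \<psi> s" if \<tau>: "0 < \<tau>" for \<tau> \<phi> \<psi>
    using bound[OF diff[OF sol[OF \<tau>] mild_solution_add[OF dom sol[OF \<tau>] sol[OF \<tau>]]] s, of "\<phi> + \<psi>" \<phi> \<psi>]
    by (simp add: X0[OF \<tau>])
  have X_scale: "X \<tau> (scaleC c \<psi>) s = scaleC c (X \<tau> \<psi> s)" if \<tau>: "0 < \<tau>" for \<tau> c \<psi>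
    using bound[OF diff[OF sol[OF \<tau>] mild_solution_scaleC[OF dom sol[OF \<tau>]]] s, of "scaleC c \<psi>" c \<psi>]
    by (simp add: X0[OF \<tau>])
  have X_bound: "norm (X \<tau> \<phi> s - X \<tau> \<psi> s) \<le> C * norm (\<phi> - \<psi>)" if \<tau>: "0 < \<tau>" for \<tau> \<phi> \<psi>
    using bound[OF diff[OF sol[OF \<tau>] sol[OF \<tau>]] s, of \<phi> \<psi>] by (simp add: X0[OF \<tau>])
  have span: "((\<lambda>\<tau>. X \<tau> (\<Sum>v\<in>F. scaleC (k v) v) s) \<longlongrightarrow> Omega s (\<Sum>v\<in>F. scaleC (k v) v)) at_top"
    if "finite F" "F \<subseteq> (\<Union>E\<in>eigenvalues D Ho. eigenspace D Ho E)" for F k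
    using that
  proof (induction F rule: finite_induct)
    case empty
    have "\<forall>\<^sub>F \<tau> in at_top. X \<tau> 0 s = Omega s 0"
      using eventually_gt_at_top[of 0]
    proof eventually_elim
      case (elim \<tau>)
      show ?case using X_scale[OF elim, of 0 0] Om(2)[of 0 0] by simp
    qed
    then show ?case by (simp add: tendsto_eventually)
  next
    case (insert v F)
    let ?w = "\<Sum>v\<in>F. scaleC (k v) v"
    obtain E where "E \<in> eigenvalues D Ho" "v \<in> eigenspace D Ho E" using insert.prems by blast
    from eigenvector_limit[OF Ho_sa Ho_pp W Lambda_sa Lambda_L1 U Omega_unitary Omega_comm Omega s this]
    have "((\<lambda>\<tau>. X \<tau> v s) \<longlongrightarrow> Omega s v) at_top" by (simp add: X_def)
    from bounded_linear.tendsto[OF bounded_linear_scaleC_right this, of "k v"]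
    have "((\<lambda>\<tau>. scaleC (k v) (X \<tau> v s) + X \<tau> ?w s) \<longlongrightarrow> scaleC (k v) (Omega s v) + Omega s ?w) at_top"
      by (rule tendsto_add) (use insert in auto)
    moreover have "\<forall>\<^sub>F \<tau> in at_top. scaleC (k v) (X \<tau> v s) + X \<tau> ?w s = X \<tau> (scaleC (k v) v + ?w) s"
      using eventually_gt_at_top[of 0] by eventually_elim (simp add: X_add X_scale)
    ultimately have "((\<lambda>\<tau>. X \<tau> (scaleC (k v) v + ?w) s) \<longlongrightarrow> scaleC (k v) (Omega s v) + Omega s ?w) at_top"
      by (rule Lim_transform_eventually)
    then show ?case using insert by (simp add: Om)
  qed
  have "((\<lambda>\<tau>. X \<tau> \<psi> s) \<longlongrightarrow> Omega s \<psi>) at_top" for \<psi>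
  proof (rule tendstoI)
    fix \<epsilon> :: real assume eps: "0 < \<epsilon>"
    \<comment> \<open>Passing from \<open>\<phi>\<close> to \<open>\<psi>\<close> costs
      \<open>C * \<delta>\<close> in \<open>X\<close> and \<open>\<delta>\<close> in the isometry
      \<open>Omega s\<close>, together \<open>\<epsilon> / 2\<close>.\<close>
    define \<delta> where "\<delta> = \<epsilon> / (2 * (C + 1))"
    have \<delta>: "0 < \<delta>" using eps C(1) by (simp add: \<delta>_def)
    have "\<psi> \<in> closure (cspan (\<Union>E\<in>eigenvalues D Ho. eigenspace D Ho E))"
      using Ho_pp by (simp add: pure_point_def)
    then obtain \<phi> where \<phi>: "\<phi> \<in> cspan (\<Union>E\<in>eigenvalues D Ho. eigenspace D Ho E)" and near: "dist \<phi> \<psi> < \<delta>"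
      using \<delta> by (meson closure_approachable)
    have "((\<lambda>\<tau>. X \<tau> \<phi> s) \<longlongrightarrow> Omega s \<phi>) at_top" using \<phi> span unfolding cspan_def by blast
    then have "\<forall>\<^sub>F \<tau> in at_top. dist (X \<tau> \<phi> s) (Omega s \<phi>) < \<epsilon> / 2" using eps by (intro tendstoD) auto
    then show "\<forall>\<^sub>F \<tau> in at_top. dist (X \<tau> \<psi> s) (Omega s \<psi>) < \<epsilon>" using eventually_gt_at_top[of 0]
    proof eventually_elim
      case (elim \<tau>)
      have "dist (X \<tau> \<psi> s) (X \<tau> \<phi> s) \<le> C * dist \<phi> \<psi>"
        using X_bound[OF elim(2), of \<psi> \<phi>] by (simp add: dist_norm norm_minus_commute)
      also have "\<dots> \<le> C * \<delta>" using near C(1) by (intro mult_left_mono) auto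
      finally have 1: "dist (X \<tau> \<psi> s) (X \<tau> \<phi> s) \<le> C * \<delta>" .
      have 2: "dist (Omega s \<phi>) (Omega s \<psi>) < \<delta>"
        using near by (simp add: dist_norm Om(3) flip: Om(6))
      have "C * \<delta> + \<delta> = (C + 1) * \<delta>" by (simp add: distrib_right)
      also have "\<dots> = \<epsilon> / 2" using C(1) by (simp add: \<delta>_def field_simps)
      finally have "C * \<delta> + \<delta> = \<epsilon> / 2" .
      then show ?case
        using elim(1) 1 2 dist_triangle[of "X \<tau> \<psi> s" "Omega s \<psi>" "X \<tau> \<phi> s"]
          dist_triangle[of "X \<tau> \<phi> s" "Omega s \<psi>" "Omega s \<phi>"] by linarith
    qed
  qed
  then show ?thesis by (simp add: X_def)
qed

end
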